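(* Let $k\ge \ell\ge 1$ be integers with $k+\ell\ge 6$, and let $D$ be a $C(k,\ell)$-free Hamiltonian digraph. Then the underlying graph of $D$ is $(k+\ell-2)$-degenerate, and hence $\chi(D)\le k+\ell-1$.
   Context: All graphs and digraphs are finite and simple (no loops, no multiple edges or arcs), except that a digraph may contain a pair of opposite arcs $(u,v),(v,u)$. The length of a directed path is its number of arcs. For positive integers $k,\ell$, the family $C(k,\ell)$ consists of all digraphs obtained from two internally vertex-disjoint directed paths, of lengths at least $k$ and at least $\ell$ respectively, by identifying their initial vertices and identifying their terminal vertices (so a member consists of two internally vertex-disjoint directed paths from a vertex $s$ to a vertex $t\ne s$, one of length at least $k$ and the other of length at least $\ell$). A digraph is $C(k,\ell)$-free if it contains no member of $C(k,\ell)$ as a subdigraph. A digraph is Hamiltonian if it contains a directed Hamiltonian cycle. The underlying graph of a digraph $D$ is the simple graph on $V(D)$ in which two vertices are adjacent whenever they are joined by at least one arc of $D$. The chromatic number $\chi(D)$ is the chromatic number of the underlying graph of $D$. A graph is $d$-degenerate if each of its nonempty subgraphs has a vertex of degree at most $d$ in that subgraph. *)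

theory Defs
  imports "Graph_Theory.Digraph_Component"
begin

text \<open>
  Finite simple digraphs are the locale \<^locale>\<open>digraph\<close>, which permits opposite arcs.
  Finite simple graphs are the locale \<^locale>\<open>graph\<close>: symmetric simple digraphs, where an edge
  is a pair of opposite arcs, so that the degree of a vertex is its out-degree.
\<close>

text \<open>
  The condition \<open>set p \<inter> set q = {}\<close> only matters when both paths have length one: it prevents
  a single arc from being counted as both paths. In all other cases it follows from
  internal vertex-disjointness.
\<close>

definition two_block_cycles :: "nat \<Rightarrow> nat \<Rightarrow> ('a, 'b) pre_digraph set" where
  "two_block_cycles k l = {H. digraph H \<and>
     (\<exists>s t p q. s \<noteq> t \<and>
        pre_digraph.apath H s p t \<and> k \<le> length p \<and>
        pre_digraph.apath H s q t \<and> l \<le> length q \<and>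
        set (pre_digraph.awalk_verts H s p) \<inter> set (pre_digraph.awalk_verts H s q) = {s, t} \<and>
        set p \<inter> set q = {} \<and>
        verts H = set (pre_digraph.awalk_verts H s p) \<union> set (pre_digraph.awalk_verts H s q) \<and>
        arcs H = set p \<union> set q)}"

definition two_block_free :: "nat \<Rightarrow> nat \<Rightarrow> ('a, 'b) pre_digraph \<Rightarrow> bool" where
  "two_block_free k l D \<longleftrightarrow> \<not> (\<exists>H. subgraph H D \<and> H \<in> two_block_cycles k l)"

text \<open>A pair of opposite arcs counts as a directed cycle (of length two).\<close>

definition hamiltonian :: "('a, 'b) pre_digraph \<Rightarrow> bool" where
  "hamiltonian D \<longleftrightarrow> (\<exists>u p. pre_digraph.cycle D p \<and> pre_digraph.awalk D u p u \<and>
     set (pre_digraph.awalk_verts D u p) = verts D)"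

abbreviation underlying_graph :: "('a, 'b) pre_digraph \<Rightarrow> ('a, 'a \<times> 'a) pre_digraph" where
  "underlying_graph D \<equiv> with_proj (mk_symmetric D)"

text \<open>
  The next three notions are meant for \<open>G\<close> satisfying \<^locale>\<open>graph\<close>. Requiring
  \<^locale>\<open>graph\<close> of \<open>H\<close> makes the subdigraph \<open>H\<close> an undirected subgraph.
\<close>

definition degenerate :: "nat \<Rightarrow> ('a, 'b) pre_digraph \<Rightarrow> bool" where
  "degenerate d G \<longleftrightarrow> (\<forall>H. subgraph H G \<and> graph H \<and> verts H \<noteq> {} \<longrightarrow>
     (\<exists>v \<in> verts H. out_degree H v \<le> d))"

definition proper_coloring :: "('a, 'b) pre_digraph \<Rightarrow> nat \<Rightarrow> ('a \<Rightarrow> nat) \<Rightarrow> bool" where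
  "proper_coloring G n c \<longleftrightarrow> c ` verts G \<subseteq> {..<n} \<and>
     (\<forall>(u, v) \<in> arcs_ends G. c u \<noteq> c v)"

definition chromatic_number :: "('a, 'b) pre_digraph \<Rightarrow> nat" where
  "chromatic_number G = (LEAST n. \<exists>c. proper_coloring G n c)"

end

theory Submission
  imports Defs "HOL-Library.Sublist"
begin

text \<open>
  Suppose that every vertex of a subgraph with vertex set \<open>S\<close> has degree at least \<open>k + l - 1\<close> in it.
  Delete a vertex outside \<open>S\<close> from the Hamiltonian cycle and bridge the gap by a new arc: a path through
  the new arc can be rerouted through the deleted vertex, so no member of \<open>C(k, l)\<close> arises. Hence we may
  assume that \<open>S\<close> consists of all \<open>n\<close> vertices of the cycle, and every vertex has at most
  \<open>N = n - k - l\<close> non-neighbours.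

  Two crossing chords of the cycle form a pair of disjoint paths whose lengths are read off from the
  positions of the ends. If \<open>N \<ge> 2\<close>, a shortest chord that is long on both sides therefore excludes
  \<open>N\<close> neighbours of the vertices next to its ends; this determines their neighbourhoods exactly, and
  propagating the information along the chord leads to a contradiction, separately for \<open>k = l\<close>,
  \<open>k = l + 1\<close>, \<open>k = l + 2\<close> and \<open>k \<ge> l + 3\<close>. If \<open>N \<le> 1\<close>, the jumps of length \<open>l\<close> (or those of length
  \<open>k\<close>) all go forward along every Hamiltonian cycle. There is a Hamiltonian cycle with a forward jump of
  length two, and the vertex skipped by this jump can be moved to another place of the cycle; comparing
  the two Hamiltonian cycles gives the contradiction.
\<close>

section \<open>Paths along a Hamiltonian cycle\<close>

text \<open>The number N comes from the minimum degree: of the n - 1 other vertices at least k + l -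
  1 are neighbours. Only adjacency is controlled by degrees, never the direction of an arc, so every
  obstruction is needed for both directions of a chord and of the arc tested against it. This is the
  reason for integer positions: a backward chord of length d is, for other representatives of its
  ends, a forward chord of length n - d, so two pictures of crossing forward chords yield all cases.
  For small N counting gives little, because nearly all pairs are adjacent and only directions carry
  information; the given cycle alone is then too rigid and has to be compared with other Hamiltonian
  cycles on the same vertices. The bound k + l >= 6 enters as k >= 5 for l = 1, as l >= 3 for k = l
  and k = l + 1, and as l >= 2 for k = l + 2.\<close>

definition vpath :: "('v \<Rightarrow> 'v \<Rightarrow> bool) \<Rightarrow> 'v list \<Rightarrow> bool" where
  "vpath E xs \<longleftrightarrow> xs \<noteq> [] \<and> distinct xs \<and> successively E xs"

text \<open>Lengths are counted in vertices here: a path with at least \<open>k\<close> arcs has more than \<open>k\<close> vertices.\<close>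

definition theta :: "('v \<Rightarrow> 'v \<Rightarrow> bool) \<Rightarrow> int \<Rightarrow> int \<Rightarrow> bool" where
  "theta E k l \<longleftrightarrow> (\<exists>P Q. vpath E P \<and> vpath E Q \<and> hd P = hd Q \<and> last P = last Q \<and>
     set P \<inter> set Q \<subseteq> {hd P, last P} \<and> k < int (length P) \<and> l < int (length Q))"

lemma theta_sym: "theta E k l \<Longrightarrow> theta E l k"
  unfolding theta_def by (metis Int_commute)

text \<open>A list of intervals \<open>[(a, b), (x, y), \<dots>]\<close> describes a path that runs along the Hamiltonian
  cycle from \<open>a\<close> to \<open>b\<close>, takes a chord from \<open>b\<close> to \<open>x\<close>, runs on to \<open>y\<close>, and so on.\<close>

fun seg_vertices :: "(int \<times> int) list \<Rightarrow> int list" where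
  "seg_vertices [] = []"
| "seg_vertices ((a,b) # S) = [a..b] @ seg_vertices S"

fun seg_length :: "(int \<times> int) list \<Rightarrow> int" where
  "seg_length [] = 0"
| "seg_length ((a,b) # S) = b - a + 1 + seg_length S"

fun seg_disjoint :: "(int \<times> int) list \<Rightarrow> bool" where
  "seg_disjoint [] = True"
| "seg_disjoint ((a,b) # S) = (list_all (\<lambda>(x,y). b < x \<or> y < a) S \<and> seg_disjoint S)"

fun seg_chain :: "(int \<Rightarrow> int \<Rightarrow> bool) \<Rightarrow> (int \<times> int) list \<Rightarrow> bool" where
  "seg_chain A [] = False"
| "seg_chain A [(a,b)] = (a \<le> b)"
| "seg_chain A ((a,b) # (x,y) # S) = (a \<le> b \<and> A b x \<and> seg_chain A ((x,y) # S))"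

text \<open>The intervals of two paths from \<open>s\<close> to \<open>t\<close> may only share a one-point interval at an end.\<close>

definition seg_meet :: "int \<Rightarrow> int \<Rightarrow> int \<times> int \<Rightarrow> int \<times> int \<Rightarrow> bool" where
  "seg_meet s t I J = (case (I, J) of ((a,b), (x,y)) \<Rightarrow>
     b < x \<or> y < a \<or> (a = b \<and> (a = s \<or> a = t)) \<or> (x = y \<and> (x = s \<or> x = t)))"

lemma set_seg_vertices: "set (seg_vertices S) = (\<Union>(a,b)\<in>set S. {a..b})"
  by (induction S rule: seg_vertices.induct) auto

lemma distinct_seg_vertices: "seg_disjoint S \<Longrightarrow> distinct (seg_vertices S)"
proof (induction S rule: seg_vertices.induct)
  case (2 a b S)
  then show ?case by (fastforce simp: set_seg_vertices list_all_iff)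
qed simp

text \<open>Only an inequality, since an interval with b < a - 1 contributes a negative number. This
  lets \<open>missing\<close> be applied to intervals that may turn out to be empty.\<close>

lemma length_seg_vertices: "seg_length S \<le> int (length (seg_vertices S))"
  by (induction S rule: seg_vertices.induct) auto

lemma length_seg_vertices_chain: "seg_chain A S \<Longrightarrow> seg_length S = int (length (seg_vertices S))"
  by (induction A S rule: seg_chain.induct) auto

lemma successively_upto:
  assumes "\<And>i. A i (i+1)" shows "successively A [a..b]"
proof (induction a b rule: upto.induct)
  case (1 i j)
  show ?case
  proof (cases "i < j")
    case True
    then have "[i..j] = i # (i+1) # [i+2..j]" by (simp add: upto_rec1 add.commute)
    moreover have "[i+1..j] = (i+1) # [i+2..j]" using True by (simp add: upto_rec1 add.commute)
    ultimately show ?thesis using 1 True assms by simp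
  next
    case False
    then show ?thesis by (cases "i = j") auto
  qed
qed

lemma last_upto: "a \<le> b \<Longrightarrow> last [a..b] = b"
  by (simp add: upto_rec2)
lemma hd_upto: "a \<le> b \<Longrightarrow> hd [a..b] = a"
  by (simp add: upto_rec1)

lemma seg_chain_vertices:
  assumes "\<And>i. A i (i+1)" "seg_chain A S"
  shows "successively A (seg_vertices S) \<and> seg_vertices S \<noteq> [] \<and>
    hd (seg_vertices S) = fst (hd S) \<and> last (seg_vertices S) = snd (last S)"
  using assms
proof (induction A S rule: seg_chain.induct)
  case (2 A a b)
  have "successively A [a..b]" by (rule successively_upto) (use 2 in blast)
  then show ?case using 2 by (auto simp: hd_upto last_upto)
next
  case (3 A a b x y S)
  have "successively A [a..b]" by (rule successively_upto) (use 3 in blast)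
  then show ?case using 3 by (auto simp: successively_append_iff hd_upto last_upto)
qed auto

definition two_blocks :: "int \<Rightarrow> int \<Rightarrow> int \<Rightarrow> int \<Rightarrow> bool" where
  "two_blocks k l x y \<longleftrightarrow> (k \<le> x \<and> l \<le> y) \<or> (l \<le> x \<and> k \<le> y)"

lemmas two_def = two_blocks_def

text \<open>Positions on the cycle are integers, read modulo \<open>n\<close>; an arc goes forward or backward depending
  on the chosen representatives. The order of \<open>k\<close> and \<open>l\<close> is left open, which keeps the locale
  symmetric in the two.\<close>

locale cyclic =
  fixes E :: "'v \<Rightarrow> 'v \<Rightarrow> bool" and c :: "int \<Rightarrow> 'v" and n k l :: int
  assumes periodic: "c (i + n) = c i"
    and inj: "c i = c j \<Longrightarrow> n dvd (i - j)"
    and step: "E (c i) (c (i + 1))"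
    and free: "\<not> theta E k l"
    and pos: "1 \<le> k" "1 \<le> l" "k + l \<le> n" "6 \<le> k + l"
    and degree: "card {x. i < x \<and> x < i + n \<and> \<not> (E (c i) (c x) \<or> E (c x) (c i))} \<le> nat (n - k - l)"
begin

definition "A i j \<longleftrightarrow> E (c i) (c j)"
definition "Adj i j \<longleftrightarrow> A i j \<or> A j i"

lemma A_step [simp]: "A i (i+1)" "A (i-1) i" using step[of i] step[of "i-1"] by (auto simp: A_def)
lemma c_minus: "c (i - n) = c i" using periodic[of "i-n"] by simp
lemma A_periodic [simp]: "A (i+n) j = A i j" "A i (j+n) = A i j" "A (i-n) j = A i j" "A i (j-n) = A i j"
  "A (n+i) j = A i j" "A i (n+j) = A i j"
  using periodic c_minus by (auto simp: A_def add.commute)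
lemma Adj_periodic [simp]: "Adj (i+n) j = Adj i j" "Adj i (j+n) = Adj i j" "Adj (i-n) j = Adj i j" "Adj i (j-n) = Adj i j"
  by (auto simp: Adj_def)
lemma Adj_sym: "Adj i j = Adj j i" by (auto simp: Adj_def)
lemma A_n0: "A n j = A 0 j" "A j n = A j 0" using A_periodic(1)[of 0 j] A_periodic(2)[of j 0] by auto
lemma Adj_step [simp]: "Adj i (i+1)" "Adj (i-1) i" by (auto simp: Adj_def)

lemma inj_window: "inj_on c {w..<w+n}"
proof
  fix x y assume "x \<in> {w..<w+n}" "y \<in> {w..<w+n}" "c x = c y"
  then have "n dvd (x-y)" "\<bar>x - y\<bar> < n" using inj by auto
  then show "x = y" by (metis dvd_imp_le_int not_less right_minus_eq zdvd_not_zless abs_of_nonneg abs_ge_zero abs_dvd_iff dvd_abs_iff abs_eq_0 linorder_not_le order_le_less)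
qed

text \<open>All intervals lie in one window of n consecutive integers, on which \<open>c\<close> is
  injective, so disjointness of paths becomes a comparison of interval ends. Lengths count vertices,
  hence the strict inequalities.\<close>

lemma theta_segs:
  assumes "seg_chain A S" "seg_chain A T" "seg_disjoint S" "seg_disjoint T"
    and "fst (hd S) = s" "fst (hd T) = s" "snd (last S) = t" "snd (last T) = t"
    and "list_all (\<lambda>I. list_all (seg_meet s t I) T) S"
    and "list_all (\<lambda>(a,b). w \<le> a \<and> b < w + n) S" "list_all (\<lambda>(a,b). w \<le> a \<and> b < w + n) T"
    and len: "k < seg_length S \<and> l < seg_length T \<or> l < seg_length S \<and> k < seg_length T"
  shows False
proof -
  let ?P = "map c (seg_vertices S)" and ?Q = "map c (seg_vertices T)"
  have st: "\<And>i. A i (i+1)" by simp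
  note S = seg_chain_vertices[OF st assms(1)] and T = seg_chain_vertices[OF st assms(2)]
  have wS: "set (seg_vertices S) \<subseteq> {w..<w+n}" and wT: "set (seg_vertices T) \<subseteq> {w..<w+n}"
    using assms(10,11) by (fastforce simp: set_seg_vertices list_all_iff)+
  have inter: "set (seg_vertices S) \<inter> set (seg_vertices T) \<subseteq> {s,t}"
  proof
    fix z assume "z \<in> set (seg_vertices S) \<inter> set (seg_vertices T)"
    then obtain a b x y where "(a,b) \<in> set S" "(x,y) \<in> set T" "a \<le> z" "z \<le> b" "x \<le> z" "z \<le> y"
      by (auto simp: set_seg_vertices)
    moreover have "seg_meet s t (a,b) (x,y)" using assms(9) calculation(1,2) by (auto simp: list_all_iff)
    ultimately show "z \<in> {s,t}" by (auto simp: seg_meet_def)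
  qed
  have vp: "vpath E ?P" "vpath E ?Q"
    using S T wS wT inj_on_subset[OF inj_window wS] inj_on_subset[OF inj_window wT]
      distinct_seg_vertices[OF assms(3)] distinct_seg_vertices[OF assms(4)]
    by (auto simp: vpath_def distinct_map successively_map A_def[abs_def])
  have hd: "hd ?P = c s" "hd ?Q = c s" "last ?P = c t" "last ?Q = c t"
    using S T assms(5-8) by (auto simp: hd_map last_map)
  have "set ?P \<inter> set ?Q \<subseteq> c ` (set (seg_vertices S) \<inter> set (seg_vertices T))"
    using inj_on_image_Int[OF inj_window wS wT] by auto
  then have i: "set ?P \<inter> set ?Q \<subseteq> {c s, c t}" using inter by blast
  have "theta E k l"
    using len
  proof
    assume "k < seg_length S \<and> l < seg_length T"
    then show ?thesis unfolding theta_def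
      by (intro exI[of _ ?P] exI[of _ ?Q]) (use vp hd i assms(1,2) in \<open>auto simp: length_seg_vertices_chain\<close>)
  next
    assume "l < seg_length S \<and> k < seg_length T"
    then show ?thesis unfolding theta_def
      by (intro exI[of _ ?Q] exI[of _ ?P]) (use vp hd i assms(1,2) in \<open>auto simp: length_seg_vertices_chain\<close>)
  qed
  then show False using free by simp
qed

abbreviation "two \<equiv> two_blocks k l"

text \<open>The two paths lead from a to d: the first chord followed by b, ..., d, and a, ...,
  \<open>c'\<close> followed by the second chord.\<close>

lemma crossing1:
  assumes "a \<le> c'" "c' < b" "b \<le> d" "d < a + n" "A a b" "A c' d" "c' \<noteq> a \<or> b \<noteq> d"
  shows "\<not> two (c' - a + 1) (d - b + 1)"
proof
  assume t: "two (c' - a + 1) (d - b + 1)"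
  show False
    by (rule theta_segs[of "[(a,a),(b,d)]" "[(a,c'),(d,d)]" a d a])
      (use assms t in \<open>auto simp: seg_meet_def two_def\<close>)
qed

text \<open>The two paths lead from \<open>c'\<close> to b: one along the cycle, the other by the
  second chord to d, on to a + n, which is the vertex a again, and by the first chord to b.\<close>

lemma crossing2:
  assumes "a < c'" "c' < b" "b < d" "d \<le> a + n" "A a b" "A c' d"
  shows "\<not> two (b - c') (a + n - d + 2)"
proof
  assume t: "two (b - c') (a + n - d + 2)"
  have "A (a + n) b" using assms by simp
  then show False
    by (intro theta_segs[of "[(c',b)]" "[(c',c'),(d,a+n),(b,b)]" c' b c'])
      (use assms t in \<open>auto simp: seg_meet_def two_def\<close>)
qed

lemma missing:
  assumes "seg_disjoint D"
    and "list_all (\<lambda>(a,b). \<forall>x. a \<le> x \<longrightarrow> x \<le> b \<longrightarrow> i < x \<and> x < i + n \<and> \<not> Adj i x) D"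
  shows "seg_length D \<le> n - k - l"
proof -
  let ?M = "{x. i < x \<and> x < i + n \<and> \<not> Adj i x}"
  have "set (seg_vertices D) \<subseteq> ?M" using assms(2) by (auto simp: set_seg_vertices list_all_iff)
  moreover have "finite ?M" by (rule finite_subset[of _ "{i..i+n}"]) auto
  ultimately have "card (set (seg_vertices D)) \<le> card ?M" by (rule card_mono[rotated])
  also have "card ?M \<le> nat (n-k-l)" using degree[of i] by (simp add: Adj_def A_def)
  finally have "card (set (seg_vertices D)) \<le> nat (n-k-l)" .
  then have "length (seg_vertices D) \<le> nat (n-k-l)"
    using distinct_card[OF distinct_seg_vertices[OF assms(1)]] by simp
  then show ?thesis using length_seg_vertices[of D] pos by linarith
qed

end

section \<open>Pairs of chords\<close>

context cyclic
begin

text \<open>The chord between x and y is tested against an arc between i inside and q outside. This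
  and the next three lemmas are the four combinations of directions, obtained from
  \<open>crossing1\<close> and \<open>crossing2\<close> by adding or subtracting n until both chords
  go forward.\<close>

lemma fwd_out:
  assumes "A x y" "x < i" "i < y" "y < q" "q < x + n" "two (i - x + 1) (q - y + 1) \<or> two (y - i) (x + n - q + 2)"
  shows "\<not> A i q"
  using crossing1[of x i y q] crossing2[of x i y q] assms by auto

lemma fwd_in:
  assumes "A x y" "x < i" "i < y" "y < q" "q < x + n" "two (x + n - q + 1) (y - i + 1) \<or> two (i - x) (q - y + 2)"
  shows "\<not> A q i"
proof
  assume "A q i"
  then have 1: "A (q - n) i" by simp
  have "\<not> two (x - (q - n) + 1) (y - i + 1)"
    by (rule crossing1) (use assms 1 in auto)
  moreover have "\<not> two (i - x) ((q - n) + n - y + 2)"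
    by (rule crossing2) (use assms 1 in auto)
  moreover have "\<not> two (i - x) (q - y + 2)" using calculation(2) by (simp add: algebra_simps)
  ultimately show False using assms(6) by (simp add: algebra_simps)
qed

lemma bwd_out:
  assumes "A y x" "x < i" "i < y" "y < q" "q < x + n" "two (y - i + 1) (x + n - q + 1) \<or> two (q - y) (i - x + 2)"
  shows "\<not> A i q"
proof
  assume a: "A i q"
  from assms(1) have 1: "A y (x + n)" by simp
  have "\<not> two (y - i + 1) ((x + n) - q + 1)"
    by (rule crossing1) (use assms 1 a in auto)
  moreover have "\<not> two (q - y) (i + n - (x + n) + 2)"
    by (rule crossing2) (use assms 1 a in auto)
  ultimately show False using assms(6) by (simp add: algebra_simps)
qed

lemma bwd_in:
  assumes "A y x" "x < i" "i < y" "y < q" "q < x + n" "two (q - y + 1) (i - x + 1) \<or> two (x + n - q) (y - i + 2)"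
  shows "\<not> A q i"
proof
  assume "A q i"
  then have a: "A q (i + n)" by simp
  from assms(1) have 1: "A y (x + n)" by simp
  have "\<not> two (q - y + 1) ((i + n) - (x + n) + 1)"
    by (rule crossing1) (use assms 1 a in auto)
  moreover have "\<not> two ((x + n) - q) (y + n - (i + n) + 2)"
    by (rule crossing2) (use assms 1 a in auto)
  ultimately show False using assms(6) by (simp add: algebra_simps)
qed

lemma fwd_nonadj:
  assumes "A x y" "x < i" "i < y" "y < q" "q < x + n"
    and "two (i - x + 1) (q - y + 1) \<or> two (y - i) (x + n - q + 2)"
    and "two (x + n - q + 1) (y - i + 1) \<or> two (i - x) (q - y + 2)"
  shows "\<not> Adj i q"
  using fwd_out[OF assms(1-6)] fwd_in[OF assms(1-5,7)] by (simp add: Adj_def)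

lemma bwd_nonadj:
  assumes "A y x" "x < i" "i < y" "y < q" "q < x + n"
    and "two (y - i + 1) (x + n - q + 1) \<or> two (q - y) (i - x + 2)"
    and "two (q - y + 1) (i - x + 1) \<or> two (x + n - q) (y - i + 2)"
  shows "\<not> Adj i q"
  using bwd_out[OF assms(1-6)] bwd_in[OF assms(1-5,7)] by (simp add: Adj_def)

text \<open>Two paths from s to t that exchange sides at the middle chord. Together they use every
  vertex from s to t, so their lengths add up to t - s + 1.\<close>

lemma braid:
  assumes "1 \<le> a" "1 \<le> b" "s + a + b - 1 < t" "t < s + n"
    and "A s (s + a)" "A (s + a - 1) (s + a + b)" "A (s + a + b - 1) t"
    and "two (b + 1) (t - s - b)"
  shows False
  by (rule theta_segs[of "[(s,s),(s+a,s+a+b-1),(t,t)]" "[(s,s+a-1),(s+a+b,t)]" s t s])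
    (use assms in \<open>auto simp: seg_meet_def two_def algebra_simps\<close>)

text \<open>The backward chord from \<open>y\<close> to \<open>x\<close> closes a cycle, and \<open>i - 1\<close> and \<open>i\<close> are consecutive on it.\<close>

lemma back_cycle_out_in:
  assumes "A y x" "x < i" "i \<le> y" "y < q" "q \<le> u" "u < x + n" "A i q" "A u (i - 1)" "two (y - x) (u - q + 2)"
  shows False
proof -
  have "A y (x + n)" "A u (i - 1 + n)" using assms by auto
  then show ?thesis
    by (intro theta_segs[of "[(i,y),(x+n,i-1+n)]" "[(i,i),(q,u),(i-1+n,i-1+n)]" i "i-1+n" i])
      (use assms in \<open>auto simp: seg_meet_def two_def\<close>)
qed

lemma back_cycle_out_out:
  assumes "A y x" "x < i" "i \<le> y" "y < q" "q < u" "u < x + n" "A i q" "A (i - 1) u" "two (y - x + 1) (u - q + 1)"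
  shows False
proof -
  have "A y (x + n)" "A (i - 1 + n) u" using assms by auto
  then show ?thesis
    by (intro theta_segs[of "[(i,y),(x+n,i-1+n),(u,u)]" "[(i,i),(q,u)]" i u i])
      (use assms in \<open>auto simp: seg_meet_def two_def\<close>)
qed

lemma back_cycle_in_in:
  assumes "A y x" "x < i" "i \<le> y" "y < q" "q < u" "u < x + n" "A q i" "A u (i - 1)" "two (y - x + 1) (u - q + 1)"
  shows False
proof -
  have "A y (x + n)" "A u (i - 1 + n)" using assms by auto
  then show ?thesis
    by (intro theta_segs[of "[(q,q),(i,y),(x+n,i-1+n)]" "[(q,u),(i-1+n,i-1+n)]" q "i-1+n" i])
      (use assms in \<open>auto simp: seg_meet_def two_def\<close>)
qed

lemma back_cycle_in_out:
  assumes "A y x" "x < i" "i \<le> y" "y < q" "q < u" "u < x + n" "A q i" "A (i - 1) u" "two (y - x + 2) (u - q)"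
  shows False
proof -
  have "A y (x + n)" "A (i - 1 + n) u" using assms by auto
  then show ?thesis
    by (intro theta_segs[of "[(q,q),(i,y),(x+n,i-1+n),(u,u)]" "[(q,u)]" q u i])
      (use assms in \<open>auto simp: seg_meet_def two_def\<close>)
qed

lemma two_mono: "two x y \<Longrightarrow> x \<le> x' \<Longrightarrow> y \<le> y' \<Longrightarrow> two x' y'"
  by (auto simp: two_def)

text \<open>The direction of the arc between i - 1 and u is unknown, so the lengths in the
  hypothesis are the smaller ones of the two cases.\<close>

lemma back_cycle_out_adj:
  assumes "A y x" "x < i" "i \<le> y" "y < q" "q < u" "u < x + n" "A i q" "Adj (i - 1) u" "two (y - x) (u - q + 1)"
  shows False
  using back_cycle_out_in[of y x i q u] back_cycle_out_out[of y x i q u] assms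
    two_mono[OF assms(9)] by (force simp: Adj_def)

lemma back_cycle_adj_adj:
  assumes "A y x" "x < i" "i \<le> y" "y < q" "q < u" "u < x + n" "Adj i q" "Adj (i - 1) u" "two (y - x) (u - q)"
  shows False
  using back_cycle_out_adj[of y x i q u] back_cycle_in_in[of y x i q u] back_cycle_in_out[of y x i q u] assms
    two_mono[OF assms(9)] by (force simp: Adj_def)

section \<open>Paths built from backward jumps of a fixed length\<close>

fun back_segs :: "int \<Rightarrow> nat \<Rightarrow> int \<Rightarrow> (int \<times> int) list" where
  "back_segs b 0 v = []"
| "back_segs b (Suc j) v = (v - b, v - 1) # (v - b - 1, v - b - 1) # back_segs b j (v - b - 1)"

lemma back_segs_bounds:
  assumes "0 < b" "(x, y) \<in> set (back_segs b j v)"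
  shows "v - (b+1) * int j \<le> x \<and> x \<le> y \<and> y < v \<and> (v - (b+1) * int j < x \<or> x = y)"
  using assms(2)
proof (induction j arbitrary: v)
  case (Suc j)
  consider "(x,y) = (v - b, v - 1)" | "(x,y) = (v - b - 1, v - b - 1)"
    | "(x,y) \<in> set (back_segs b j (v - b - 1))" using Suc.prems by auto
  then show ?case
  proof cases
    case 3
    then have "v - b - 1 - (b+1) * int j \<le> x \<and> x \<le> y \<and> y < v - b - 1 \<and>
      (v - b - 1 - (b+1) * int j < x \<or> x = y)" by (rule Suc.IH)
    then show ?thesis using assms(1) by (auto simp: algebra_simps)
  next
    case 1
    have "0 \<le> (b + 1) * int j" using assms(1) by simp
    moreover have "(b + 1) * int (Suc j) = (b + 1) * int j + (b + 1)" by (simp add: algebra_simps)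
    ultimately have "v - (b + 1) * int (Suc j) < v - b" by linarith
    then show ?thesis using 1 assms(1) by auto
  qed (use assms(1) in \<open>auto simp: algebra_simps\<close>)
qed simp

lemma back_segs_disjoint: "0 < b \<Longrightarrow> seg_disjoint (back_segs b j v)"
proof (induction j arbitrary: v)
  case (Suc j)
  then show ?case using back_segs_bounds[of b _ _ j "v - b - 1"]
    by (fastforce simp: list_all_iff)
qed simp

lemma back_segs_length: "seg_length (back_segs b j v) = (b+1) * int j"
  by (induction j arbitrary: v) (auto simp: algebra_simps)

lemma back_segs_last: "0 < j \<Longrightarrow> last (back_segs b j v) = (v - (b+1) * int j, v - (b+1) * int j)"
proof (induction j arbitrary: v)
  case (Suc j)
  then show ?case by (cases "j = 0") (auto simp: algebra_simps, cases j, auto simp: algebra_simps)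
qed simp

text \<open>Here \<open>z\<close> is the vertex \<open>v\<close> under another integer:
  \<open>backward_braid\<close> starts at v but descends from v + n, which keeps the whole path in
  one window.\<close>

lemma back_segs_chain:
  assumes "0 < b" "\<And>w. v - (b+1) * int j \<le> w \<Longrightarrow> w + b \<le> v \<Longrightarrow> A (w + b) w" "\<And>w. A z w = A v w"
  shows "seg_chain A ((z,z) # back_segs b j v)"
  using assms(2-)
proof (induction j arbitrary: v z)
  case (Suc j)
  have "A v (v - b)" "A (v - 1) (v - b - 1)"
    using Suc.prems(1)[of "v - b"] Suc.prems(1)[of "v - b - 1"] assms(1) by (auto simp: algebra_simps)
  moreover have "seg_chain A ((v - b - 1, v - b - 1) # back_segs b j (v - b - 1))"
    by (rule Suc.IH) (use Suc.prems(1) assms(1) in \<open>auto simp: algebra_simps\<close>)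
  ultimately show ?case using Suc.prems(2) assms(1) by auto
qed simp

lemma seg_chain_append:
  "S \<noteq> [] \<Longrightarrow> seg_chain A (S @ [(a,b)]) \<longleftrightarrow> seg_chain A S \<and> A (snd (last S)) a \<and> a \<le> b"
  by (induction A S rule: seg_chain.induct) auto

lemma seg_disjoint_append:
  "seg_disjoint (S @ [(a,b)]) \<longleftrightarrow> seg_disjoint S \<and> list_all (\<lambda>(x,y). y < a \<or> b < x) S"
  by (induction S rule: seg_disjoint.induct) auto

lemma seg_length_append: "seg_length (S @ T) = seg_length S + seg_length T"
  by (induction S rule: seg_length.induct) auto

text \<open>Backward jumps of length \<open>b\<close> and forward steps traverse a block of \<open>b + 1\<close> vertices
  completely: \<open>v, v - b, v - b + 1, \<dots>, v - 1, v - b - 1\<close>.\<close>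

lemma backward_braid:
  assumes b: "0 < b" and j: "0 < j" and m: "m = (b+1) * int j" "m < n" "m' = m \<or> m' = m + b" "m' < n"
    and bk: "\<And>w. v - m' \<le> w \<Longrightarrow> w + b \<le> v \<Longrightarrow> A (w + b) w"
    and two: "two (n - m') (if m' = m then m else m + 1)"
  shows False
proof -
  \<comment> \<open>The other path is the direct one from v up to the common end v + n -
    \<open>m'\<close>. The optional last jump adds one arc to the backward path; it serves lengths
    with remainder 1 modulo b + 1.\<close>
  define B where "B = back_segs b j (v + n)"
  have Bb: "v + n - m \<le> x \<and> x \<le> y \<and> y < v + n \<and> (v + n - m < x \<or> x = y)" if "(x,y) \<in> set B" for x y
    using back_segs_bounds[OF b, of x y j "v+n"] that m by (simp add: B_def)
  have "seg_chain A ((v,v) # B)"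
    unfolding B_def
  proof (rule back_segs_chain[OF b])
    fix w assume w: "v + n - (b + 1) * int j \<le> w" "w + b \<le> v + n"
    have "v - m' \<le> w - n" "w - n + b \<le> v" using w m b by auto
    from bk[OF this] have "A (w + b - n) (w - n)" by (simp add: algebra_simps)
    then show "A (w + b) w" by simp
  qed simp
  moreover have "last B = (v + n - m, v + n - m)" "B \<noteq> []"
    using back_segs_last[OF j, of b "v+n"] j m by (auto simp: B_def gr0_conv_Suc)
  moreover have "seg_disjoint B" "seg_length B = m" using back_segs_disjoint[OF b] back_segs_length m by (auto simp: B_def)
  moreover have "v < x" if "(x,y) \<in> set B" for x y using Bb[OF that] m(2) by linarith
  ultimately have B: "seg_chain A ((v,v) # B)" "seg_disjoint ((v,v) # B)" "last B = (v + n - m, v + n - m)"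
    "B \<noteq> []" "seg_length ((v,v) # B) = m + 1"
    using Bb by (auto simp: list_all_iff)
  have m0: "0 < m" using b j m by simp
  have w: "list_all (\<lambda>(a,b). v \<le> a \<and> b < v + n) B"
    using Bb m(2) by (fastforce simp: list_all_iff)
  show False
  proof (cases "m' = m")
    case True
    have meet: "list_all (\<lambda>I. list_all (seg_meet v (v+n-m) I) [(v,v+n-m)]) B"
      using Bb by (fastforce simp: list_all_iff seg_meet_def)
    show False
      by (rule theta_segs[of "(v,v) # B" "[(v,v+n-m)]" v "v+n-m" v])
        (use B w meet m(2,4) two True m0 in \<open>auto simp: seg_meet_def two_def\<close>)
  next
    case False
    then have m': "m' = m + b" using m by simp
    have "A (v - m) (v - m - b)" using bk[of "v - m - b"] m' m0 by simp
    then have 1: "A (v + n - m) (v + n - m - b)"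
      using A_periodic(1)[of "v-m" "v-m-b+n"] A_periodic(2)[of "v-m" "v-m-b"] by (simp add: algebra_simps)
    let ?S = "((v,v) # B) @ [(v+n-m-b, v+n-m-b)]"
    have "seg_chain A ?S" using B 1 by (subst seg_chain_append) auto
    moreover have "v + n - m - b < x" if "(x,y) \<in> set B" for x y using Bb[OF that] b by linarith
    then have "seg_disjoint ?S" using B(2) m' m(4) by (subst seg_disjoint_append) (auto simp: list_all_iff)
    moreover have "seg_length ?S = m + 2" using B(5) by (subst seg_length_append) simp
    moreover have "list_all (\<lambda>I. list_all (seg_meet v (v+n-m-b) I) [(v,v+n-m-b)]) B"
      using Bb b by (fastforce simp: list_all_iff seg_meet_def)
    ultimately show False
      by (intro theta_segs[of ?S "[(v,v+n-m-b)]" v "v+n-m-b" v])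
        (use w m(2,4) two m' m0 b in \<open>auto simp: seg_meet_def two_def\<close>)
  qed
qed

end

lemma cyclic_shift: "cyclic E c n k l \<Longrightarrow> cyclic E (\<lambda>i. c (s + i)) n k l"
proof -
  assume "cyclic E c n k l"
  then interpret cyclic E c n k l .
  show ?thesis
  proof
    fix i j
    show "c (s + (i + n)) = c (s + i)" using periodic[of "s+i"] by (simp add: add.assoc)
    show "n dvd i - j" if "c (s + i) = c (s + j)" using inj[OF that] by simp
    show "E (c (s + i)) (c (s + (i + 1)))" using step[of "s+i"] by (simp add: add.assoc)
    have "bij_betw (\<lambda>x. s + x) {x. i < x \<and> x < i + n \<and> \<not> (E (c (s+i)) (c (s+x)) \<or> E (c (s+x)) (c (s+i)))}
       {x. s+i < x \<and> x < s+i + n \<and> \<not> (E (c (s+i)) (c x) \<or> E (c x) (c (s+i)))}"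
      by (rule bij_betw_byWitness[where f' = "\<lambda>x. x - s"]) auto
    from bij_betw_same_card[OF this] degree[of "s + i"]
    show "card {x. i < x \<and> x < i + n \<and> \<not> (E (c (s+i)) (c (s+x)) \<or> E (c (s+x)) (c (s+i)))} \<le> nat (n - k - l)"
      by simp
  qed (use pos free in auto)
qed

context cyclic
begin

lemma shift: "cyclic E (\<lambda>i. c (s + i)) n k l"
  by (rule cyclic_shift) (rule cyclic_axioms)
lemma shift_A: "cyclic.A E (\<lambda>i. c (s + i)) i j = A (s + i) (s + j)"
  by (simp add: cyclic.A_def[OF shift] A_def)
lemma missing1:
  assumes "\<And>x. a \<le> x \<Longrightarrow> x \<le> b \<Longrightarrow> i < x \<and> x < i + n \<and> \<not> Adj i x"
  shows "b - a + 1 \<le> n - k - l"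
  using missing[of "[(a,b)]" i] assms by simp
lemma missing2:
  assumes "\<And>x. a \<le> x \<Longrightarrow> x \<le> b \<Longrightarrow> i < x \<and> x < i + n \<and> \<not> Adj i x" "b < a'"
    "\<And>x. a' \<le> x \<Longrightarrow> x \<le> b' \<Longrightarrow> i < x \<and> x < i + n \<and> \<not> Adj i x"
  shows "(b - a + 1) + (b' - a' + 1) \<le> n - k - l"
  using missing[of "[(a,b),(a',b')]" i] assms by simp
text \<open>A single arc is a path of length l, so forward chords are shorter than k, and by
  \<open>crossing2\<close> two crossing forward chords span at least n - k + 3. For a shortest
  forward chord of length at least 2, starting at v, the vertex v + 1 loses N neighbours, hence is
  adjacent to v - 1. That arc must go from v - 1 to v + 1, so the shortest length is 2 and the two
  chords span only 3.\<close>

lemma case_l1: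
  assumes l1: "l = 1" and n: "k + 1 < n"
  shows False
proof -
  have k: "5 \<le> k" using pos l1 by simp
  have short: "y - x \<le> k - 1" if "A x y" "x < y" "y < x + n" for x y
  proof (rule ccontr)
    assume "\<not> ?thesis"
    then show False
      by (intro theta_segs[of "[(x,y)]" "[(x,x),(y,y)]" x y x])
        (use that l1 pos in \<open>auto simp: seg_meet_def\<close>)
  qed
  have cross: "n - k + 3 \<le> d - a" if "a < c'" "c' < b" "b < d" "d \<le> a + n" "A a b" "A c' d" for a b c' d
    using crossing2[OF that, unfolded two_def] that l1 by auto
  let ?P = "\<lambda>b::nat. 2 \<le> b \<and> int b \<le> k - 1 \<and> (\<exists>x. A x (x + int b))"
  have "\<exists>b. ?P b"
  proof (rule ccontr)
    assume no: "\<not> ?thesis"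
    have no': "\<not> A x y" if "x + 2 \<le> y" "y < x + n" for x y
    proof
      assume a: "A x y"
      then have "y - x \<le> k - 1" using short[of x y] that by simp
      then have "?P (nat (y - x))" using a that by (auto intro: exI[of _ x])
      then show False using no by blast
    qed
    have "n - 2 - 2 + 1 \<le> n - k - l"
    proof (rule missing1[of 2 "n-2" 0])
      fix x assume x: "2 \<le> x" "x \<le> n - 2"
      then show "0 < x \<and> x < 0 + n \<and> \<not> Adj 0 x" using no'[of 0 x] no'[of x n] by (auto simp: Adj_def A_n0)
    qed
    then show False using k l1 by simp
  qed
  then obtain bn :: nat where bn: "?P bn" and least: "\<And>b. ?P b \<Longrightarrow> bn \<le> b"
    using exists_least_iff[of ?P] by (metis not_le)
  define b where "b = int bn"
  obtain v where v: "A v (v + b)" and b: "2 \<le> b" "b \<le> k - 1" using bn b_def by auto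
  have min: "b \<le> y - x" if "A x y" "x + 2 \<le> y" "y < x + n" for x y
  proof -
    have "?P (nat (y - x))" using that short[of x y] by (auto intro: exI[of _ x])
    from least[OF this] show ?thesis using that b_def by simp
  qed
  have miss: "\<not> Adj (v + 1) q" if "v + 3 \<le> q" "q \<le> v + n - k + 1" for q
  proof
    assume "Adj (v + 1) q"
    then consider "A (v + 1) q" | "A q (v + 1)" by (auto simp: Adj_def)
    then show False
    proof cases
      case 1
      then have "b \<le> q - (v + 1)" using min that k by simp
      then show False using cross[of v "v+1" "v+b" q] 1 v that b k by auto
    next
      case 2
      then have "A q (v + 1 + n)" by simp
      from short[OF this] show False using that k by simp
    qed
  qed
  have "Adj (v + 1) (v + n - 1)"
  proof (rule ccontr)
    assume "\<not> ?thesis"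
    then show False
      using missing2[of "v+3" "v+n-k+1" "v+1" "v+n-1" "v+n-1"] miss k n l1 by force
  qed
  moreover have "\<not> A (v + 1) (v + n - 1)" using short[of "v+1" "v+n-1"] k n pos by auto
  ultimately have "A (v + n - 1) (v + 1)" by (simp add: Adj_def)
  then have a: "A (v - 1) (v + 1)" using A_periodic(1)[of "v-1" "v+1"] by (simp add: algebra_simps)
  then have "b = 2" using min[OF a] b n k by simp
  then show False using cross[of "v-1" v "v+1" "v+2"] a v n k by auto
qed

end

section \<open>The case \<open>k = l + 1\<close>\<close>

context cyclic
begin

text \<open>A discrete intermediate value argument: at lo the arc points to z, at hi it leaves z, so
  it changes direction between consecutive u and u + 1, and z can be inserted there.\<close>

lemma insertion:
  assumes "A lo z" "A z hi" "lo < hi" "\<And>u. lo < u \<Longrightarrow> u < hi \<Longrightarrow> Adj z u"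
  shows "\<exists>u. lo \<le> u \<and> u < hi \<and> A u z \<and> A z (u + 1)"
proof (rule ccontr)
  assume no: "\<not> ?thesis"
  have "A u z" if "lo \<le> u" "u < hi" for u
    using that
  proof (induction u rule: int_ge_induct)
    case (step u)
    then show ?case using no assms(4)[of "u+1"] by (auto simp: Adj_def)
  qed (use assms in simp)
  from this[of "hi - 1"] show False using no assms by force
qed

lemma least_length:
  assumes "Adj x (x + d)" "p \<le> d" "d \<le> q" "1 \<le> p"
  obtains v L where "Adj v (v + L)" "p \<le> L" "L \<le> q"
    "\<And>x y. Adj x y \<Longrightarrow> p \<le> y - x \<Longrightarrow> y - x \<le> q \<Longrightarrow> L \<le> y - x"
proof -
  let ?P = "\<lambda>m::nat. p \<le> int m \<and> int m \<le> q \<and> (\<exists>x. Adj x (x + int m))"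
  have "?P (nat d)" using assms by (auto intro: exI[of _ x])
  then obtain m where m: "?P m" and least: "\<And>m'. ?P m' \<Longrightarrow> m \<le> m'"
    using exists_least_iff[of ?P] by (metis not_le)
  obtain v where v: "Adj v (v + int m)" using m by auto
  show ?thesis
  proof (rule that[OF v])
    fix x y assume "Adj x y" "p \<le> y - x" "y - x \<le> q"
    then have "?P (nat (y - x))" using assms(4) by (auto intro: exI[of _ x])
    from least[OF this] show "int m \<le> y - x" using \<open>p \<le> y - x\<close> assms(4) by simp
  qed (use m in auto)
qed

context
  assumes kl: "k = l + 1" and n: "2 * l + 2 \<le> n"
begin

lemma l3: "3 \<le> l" using kl pos by simp
lemma kl': "k \<le> l + 1" "l + 1 \<le> k" using kl by auto

text \<open>Such a chord takes n - 2l neighbours from v + 1, which is N + 1.\<close>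

lemma k1_no_back: "\<not> A (v + l) v"
proof
  assume a: "A (v + l) v"
  have "(v + n - l) - (v + l + 1) + 1 \<le> n - k - l"
  proof (rule missing1[of _ _ "v+1"])
    fix q assume q: "v + l + 1 \<le> q" "q \<le> v + n - l"
    have "\<not> Adj (v + 1) q"
      by (rule bwd_nonadj[OF a]) (use q l3 n kl' in \<open>auto simp: two_def\<close>)
    then show "v + 1 < q \<and> q < v + 1 + n \<and> \<not> Adj (v + 1) q" using q l3 by simp
  qed
  then show False using kl by simp
qed

text \<open>For a shortest long chord, going backward from \<open>v + L\<close> to \<open>v\<close>, the neighbourhoods of
  \<open>v + 1, v + 2, \<dots>\<close> are determined one after the other, until \<open>v + a\<close> is forced to have an arc
  leaving the interval.\<close>

lemma k1_no_long: "\<not> (Adj x (x + d) \<and> l + 1 \<le> d \<and> d \<le> n - l - 1)"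
proof
  assume "Adj x (x + d) \<and> l + 1 \<le> d \<and> d \<le> n - l - 1"
  then obtain v L where vL: "Adj v (v + L)" "l + 1 \<le> L" "L \<le> n - l - 1" and
    min: "\<And>x y. Adj x y \<Longrightarrow> l + 1 \<le> y - x \<Longrightarrow> y - x \<le> n - l - 1 \<Longrightarrow> L \<le> y - x"
    using least_length[of x d "l+1" "n-l-1"] l3 by auto
  have "\<not> A v (v + L)"
  proof
    assume a: "A v (v + L)"
    have "(v + n - l + 1) - (v + l + 2) + 1 \<le> n - k - l"
    proof (rule missing1[of _ _ "v+1"])
      fix q assume q: "v + l + 2 \<le> q" "q \<le> v + n - l + 1"
      have "\<not> Adj (v + 1) q"
      proof (cases "q \<le> v + L")
        case True
        then show ?thesis using min[of "v+1" q] q vL by auto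
      next
        case False
        then show ?thesis
          by (intro fwd_nonadj[OF a]) (use q l3 n kl' vL in \<open>auto simp: two_def\<close>)
      qed
      then show "v + 1 < q \<and> q < v + 1 + n \<and> \<not> Adj (v + 1) q" using q l3 by simp
    qed
    then show False using kl by simp
  qed
  then have a: "A (v + L) v" using vL by (simp add: Adj_def)
  \<comment> \<open>The vertex v + a is the first one whose jump of length l ends beyond v +
    L.\<close>
  define a where "a = L - l + 1"
  have a2: "2 \<le> a" using vL a_def by simp
  have inside: "\<not> Adj (v + i) q" if "1 \<le> i" "i \<le> a" "v + i + l + 1 \<le> q" "q \<le> v + L" for i q
    using min[of "v+i" q] that vL by (auto simp: a_def)
  have inside': "\<not> Adj (v + i) q" if "1 \<le> i" "i \<le> a" "v + n \<le> q" "q \<le> v + n + i - l - 1" for i q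
    using min[of "q - n" "v + i"] that vL l3 by (auto simp: a_def Adj_sym)
  \<comment> \<open>By \<open>k1_no_back\<close>, the jumps of length l that start or end at such a
    vertex v + i are forward.\<close>
  define good where "good i \<longleftrightarrow> (\<forall>d. 1 \<le> d \<longrightarrow> d \<le> l \<longrightarrow> Adj (v + i) (v + i + d) \<and> Adj (v + i) (v + i - d))" for i
  have goodF: "A (v + i) (v + i + l)" if "good i" for i
    using that k1_no_back[of "v+i"] l3 unfolding good_def Adj_def by (auto dest: spec[of _ l])
  have goodB: "A (v + i - l) (v + i)" if "good i" for i
    using that k1_no_back[of "v+i-l"] l3 unfolding good_def Adj_def by (auto dest: spec[of _ l])
  have out: "\<not> A (v + i) q" if i: "1 \<le> i" "i \<le> a" and g: "\<forall>j. 1 \<le> j \<and> j < i \<longrightarrow> good j"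
    and q: "v + L + 1 \<le> q" "q \<le> v + n + i - l - 1" "q < v + n" "i = a \<longrightarrow> q \<noteq> v + n + 1 - l" for i q
  proof (cases "q < v + n + 1 - l \<or> q = v + n + 1 - l \<and> i < a")
    case True
    then show ?thesis
      by (intro bwd_out[OF a]) (use i q l3 n kl' vL a_def in \<open>auto simp: two_def\<close>)
  next
    case False
    \<comment> \<open>The forward jump of length l ending at v + j starts just before q - n, so it
      encloses q - n but not v + i.\<close>
    define j where "j = q - n - v + l - 1"
    have j: "1 \<le> j" "j < i" using False q i by (auto simp: j_def)
    have "\<not> A (v + i) (q - n)"
      by (rule fwd_in[OF goodB[of j]]) (use g j i q l3 n kl' vL a_def j_def in \<open>auto simp: two_def\<close>)
    then show ?thesis by simp
  qed
  have inn: "\<not> A q (v + i)" if i: "1 \<le> i" "i \<le> a" and g: "\<forall>j. 1 \<le> j \<and> j < i \<longrightarrow> good j"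
    and q: "v + L + 1 \<le> q" "q \<le> v + n + i - l - 1" "q < v + n" for i q
  proof (cases "q \<le> v + n - l")
    case True
    then show ?thesis
      by (intro bwd_in[OF a]) (use i q l3 n kl' vL a_def in \<open>auto simp: two_def\<close>)
  next
    case False
    then have i1: "1 \<le> i - 1" using q by simp
    then have "A (v + (i - 1)) (v + (i - 1) + l)" using goodF[of "i-1"] g by simp
    then show ?thesis
      by (rule fwd_in) (use i q l3 n kl' vL a_def in \<open>auto simp: two_def\<close>)
  qed
  have non: "\<not> Adj (v + i) q" if "1 \<le> i" "i \<le> a" "\<forall>j. 1 \<le> j \<and> j < i \<longrightarrow> good j"
    "v + i + l + 1 \<le> q" "q \<le> v + n + i - l - 1" "i = a \<longrightarrow> q \<noteq> v + n + 1 - l" for i q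
  proof -
    consider "q \<le> v + L" | "v + L + 1 \<le> q" "q < v + n" | "v + n \<le> q" by linarith
    then show ?thesis
    proof cases
      case 1 then show ?thesis using inside that by auto
    next
      case 2 then show ?thesis using inn[of i q] out[of i q] that by (auto simp: Adj_def)
    next
      case 3 then show ?thesis using inside' that by auto
    qed
  qed
  have near: "Adj (v + i) p" if "1 \<le> i" "i < a" "\<forall>j. 1 \<le> j \<and> j < i \<longrightarrow> good j"
    "v + i < p \<and> p \<le> v + i + l \<or> v + n + i - l \<le> p \<and> p < v + i + n" for i p
  proof (rule ccontr)
    assume no: "\<not> ?thesis"
    note non' = non[OF that(1) less_imp_le[OF that(2)] that(3)]
    show False
    proof (cases "p \<le> v + i + l")
      case True
      then have "p - p + 1 + ((v + n + i - l - 1) - (v + i + l + 1) + 1) \<le> n - k - l"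
        by (intro missing2[of _ _ "v+i"]) (use no non' that l3 n in auto)
      then show False using kl' by simp
    next
      case False
      then have "((v + n + i - l - 1) - (v + i + l + 1) + 1) + (p - p + 1) \<le> n - k - l"
        by (intro missing2[of _ _ "v+i"]) (use no non' that l3 n in auto)
      then show False using kl' by simp
    qed
  qed
  have good: "1 \<le> i \<longrightarrow> i < a \<longrightarrow> good i" for i
  proof (induction "nat i" arbitrary: i rule: less_induct)
    case less
    show ?case
    proof (intro impI)
      assume i: "1 \<le> i" "i < a"
      have g: "\<forall>j. 1 \<le> j \<and> j < i \<longrightarrow> good j" using less i by auto
      show "good i" unfolding good_def
      proof (intro allI impI conjI)
        fix d assume d: "1 \<le> d" "d \<le> l"
        show "Adj (v + i) (v + i + d)" using near[OF i g] d n by simp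
        have "Adj (v + i) (v + i - d + n)" by (rule near[OF i g]) (use d n in auto)
        then show "Adj (v + i) (v + i - d)" by simp
      qed
    qed
  qed
  \<comment> \<open>The interval from v + L + 1 to v + n + a - l - 1 has N + 1 vertices, and q0 is
    the only one not excluded as a neighbour of v + a.\<close>
  define q0 where "q0 = v + n + 1 - l"
  have g: "\<forall>j. 1 \<le> j \<and> j < a \<longrightarrow> good j" using good by auto
  have non_a: "\<not> Adj (v + a) q" if "v + L + 1 \<le> q" "q \<le> v + n + a - l - 1" "q \<noteq> q0" for q
  proof (cases "q = v + L + 1")
    case True
    then show ?thesis using out[of a q] inn[of a q] a2 g that vL l3 a_def q0_def by (auto simp: Adj_def)
  next
    case False
    then show ?thesis using non[of a q] a2 g that q0_def a_def by auto
  qed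
  have "Adj (v + a) q0"
  proof (rule ccontr)
    assume "\<not> ?thesis"
    then have "(v + n + a - l - 1) - (v + L + 1) + 1 \<le> n - k - l"
      by (intro missing1[of _ _ "v+a"]) (use non_a vL a_def l3 in force)+
    then show False using kl' a_def by simp
  qed
  moreover have "\<not> A q0 (v + a)" by (rule inn) (use a2 g q0_def vL l3 a_def in auto)
  ultimately have aq: "A (v + a) q0" by (simp add: Adj_def)
  show False
  proof (cases "l \<le> a")
    case True
    have "A (v + (l - 1) - l) (v + (l - 1))" by (rule goodB) (use good True l3 in auto)
    then have "A (v + n - 1) (v + n + l - 1)"
      using A_periodic(1)[of "v-1" "v+n+l-1"] A_periodic(2)[of "v-1" "v+l-1"] by (simp add: algebra_simps)
    then show False
      by (intro theta_segs[of "[(v+a,v+L),(v+n,v+n+l-1)]" "[(v+a,v+a),(q0,v+n-1),(v+n+l-1,v+n+l-1)]" "v+a" "v+n+l-1" "v+a"])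
        (use a aq True l3 kl' vL a_def q0_def in \<open>auto simp: seg_meet_def\<close>)
  next
    case False
    \<comment> \<open>The paths from v + a to v by way of v + L and by way of q0 have l arcs each.
      Neither uses z = v + a - 1, and inserting z into the second one gives it k = l + 1
      arcs.\<close>
    define z where "z = v + a - 1"
    have ga: "good (a - 1)" using good a2 by auto
    then have ga': "1 \<le> d \<Longrightarrow> d \<le> l \<Longrightarrow> Adj z (z - d)" for d
      using add_diff_eq[of v a 1] by (simp add: good_def z_def)
    have "\<not> A (v + n - 1) (v + a - 1)"
      using back_cycle_out_in[of "v+L" v "v+a" q0 "v+n-1"] a aq a2 l3 kl' vL a_def q0_def by (auto simp: two_def)
    then have "\<not> A (v - 1) z" using A_periodic(1)[of "v-1" z] by (simp add: z_def algebra_simps)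
    moreover have "Adj z (v - 1)" using ga'[of a] False a2 by (simp add: z_def)
    ultimately have 1: "A z (v - 1)" by (simp add: Adj_def)
    have 2: "A (z - l) z" using goodB[OF ga] by (simp add: z_def algebra_simps)
    obtain u where u: "z - l \<le> u" "u < v - 1" "A u z" "A z (u + 1)"
    proof -
      have "Adj z u" if "z - l < u" "u < v - 1" for u
        using ga'[of "z - u"] that False a2 by (simp add: z_def)
      then show ?thesis using insertion[OF 2 1] that False by (auto simp: z_def)
    qed
    have u': "A (u + n) (z + n)" "A (z + n) (u + n + 1)"
      using u A_periodic(2)[of z "u+1"] by (auto simp: algebra_simps)
    show False
      by (rule theta_segs[of "[(v+a,v+L),(v+n,v+n)]" "[(v+a,v+a),(q0,u+n),(z+n,z+n),(u+n+1,v+n)]" "v+a" "v+n" "v+a"])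
        (use a aq False u u' z_def a2 l3 kl' vL a_def q0_def n in \<open>auto simp: seg_meet_def\<close>)
  qed
qed

text \<open>By \<open>k1_no_long\<close>, the vertices at distance l + 1 to n - l - 1 are already N
  non-neighbours.\<close>

lemma k1_near: "1 \<le> d \<Longrightarrow> d \<le> l \<Longrightarrow> Adj v (v + d)"
proof (rule ccontr)
  assume d: "1 \<le> d" "d \<le> l" and no: "\<not> Adj v (v + d)"
  have "(v + d - (v + d) + 1) + ((v + n - l - 1) - (v + l + 1) + 1) \<le> n - k - l"
  proof (rule missing2[of _ _ v])
    fix x assume "v + l + 1 \<le> x" "x \<le> v + n - l - 1"
    then show "v < x \<and> x < v + n \<and> \<not> Adj v x"
      using k1_no_long[of v "x - v"] l3 by auto
  qed (use d no l3 n in auto)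
  then show False using kl' by simp
qed

lemma k1_False: False
proof -
  have l_jump: "A v (v + l)" for v using k1_near[of l v] k1_no_back[of v] l3 by (auto simp: Adj_def)
  have no2: "\<not> A v (v + 2)" for v
  proof
    assume a: "A v (v + 2)"
    \<comment> \<open>Two jumps of length l and one of length 2 form a braid with paths of l and l +
      1 arcs.\<close>
    show False
      by (rule braid[of l "l-1" "v-2*l+2" "v+2"])
        (use a l_jump[of "v-2*l+2"] l_jump[of "v-l+1"] l3 n kl' in \<open>auto simp: two_def algebra_simps\<close>)
  qed
  have bk: "A (w + 2) w" for w using k1_near[of 2 w] no2[of w] l3 by (auto simp: Adj_def)
  \<comment> \<open>A round of backward jumps of length 2 takes 3 arcs. Depending on l modulo 3, the
    backward path gets l arcs, l arcs including an extra jump, or l + 1 = k arcs.\<close>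
  obtain j where "l = 3 * int j \<or> l = 3 * int j + 1 \<or> l = 3 * int j + 2"
  proof -
    have "l = 3 * int (nat (l div 3)) + l mod 3" "0 \<le> l mod 3" "l mod 3 < 3" using l3 by auto
    then show ?thesis using that[of "nat (l div 3)"] by linarith
  qed
  then consider "l = 3 * int j" | "l = 3 * int j + 1" | "l = 3 * int j + 2" by blast
  then show False
  proof cases
    case 1
    show False
      by (rule backward_braid[of 2 j l l 0]) (use 1 l3 n kl' bk in \<open>auto simp: two_def\<close>)
  next
    case 2
    show False
      by (rule backward_braid[of 2 j "l-1" "l+1" 0]) (use 2 l3 n kl' bk in \<open>auto simp: two_def\<close>)
  next
    case 3
    show False
      by (rule backward_braid[of 2 "j+1" "l+1" "l+1" 0]) (use 3 l3 n kl' bk in \<open>auto simp: two_def\<close>)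
  qed
qed

end
end

section \<open>The case \<open>k \<ge> l + 3\<close>\<close>

context cyclic
begin

text \<open>The chord takes the same N - 1 neighbours from v + 1 and from v + 2, so each can have
  only one more non-neighbour. But the far neighbours of v + 1 take further neighbours from v +
  2.\<close>

lemma no_back_l1:
  assumes kl: "l + 2 \<le> k" and l2: "2 \<le> l" and n: "k + l + 2 \<le> n"
  shows "\<not> A (v + l + 1) v"
proof
  assume a: "A (v + l + 1) v"
  have m1: "\<not> Adj (v + 1) q" if "v + l + 2 \<le> q" "q \<le> v + n - k" for q
    by (rule bwd_nonadj[OF a]) (use that kl l2 n in \<open>auto simp: two_def\<close>)
  have o1: "\<not> A (v + 1) (v + n - k + 1)"
    by (rule bwd_out[OF a]) (use kl l2 n in \<open>auto simp: two_def\<close>)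
  have m2: "\<not> Adj (v + 2) q" if "v + l + 2 \<le> q" "q \<le> v + n - k" for q
    by (rule bwd_nonadj[OF a]) (use that kl l2 n in \<open>auto simp: two_def\<close>)
  have o2: "\<not> A (v + 2) (v + n - k + 1)"
    by (rule bwd_out[OF a]) (use kl l2 n in \<open>auto simp: two_def\<close>)
  have extra1: "p = q" if "\<not> Adj (v + 1) p" "\<not> Adj (v + 1) q"
      "v + 1 < p \<and> p < v + l + 2 \<or> v + n - k < p \<and> p < v + n + 1"
      "v + 1 < q \<and> q < v + l + 2 \<or> v + n - k < q \<and> q < v + n + 1" for p q
  proof (rule ccontr)
    assume "p \<noteq> q"
    then consider "p < q" | "q < p" by linarith
    then show False
    proof cases
      case 1
      have "seg_length (if q < v + l + 2 then [(p,p),(q,q),(v+l+2,v+n-k)]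
          else if p < v + l + 2 then [(p,p),(v+l+2,v+n-k),(q,q)] else [(v+l+2,v+n-k),(p,p),(q,q)]) \<le> n - k - l"
        by (rule missing[of _ "v+1"]) (use 1 that m1 n kl l2 in auto)
      then show False using n by (auto split: if_splits)
    next
      case 2
      have "seg_length (if p < v + l + 2 then [(q,q),(p,p),(v+l+2,v+n-k)]
          else if q < v + l + 2 then [(q,q),(v+l+2,v+n-k),(p,p)] else [(v+l+2,v+n-k),(q,q),(p,p)]) \<le> n - k - l"
        by (rule missing[of _ "v+1"]) (use 2 that m1 n kl l2 in auto)
      then show False using n by (auto split: if_splits)
    qed
  qed
  \<comment> \<open>A forward chord from v + 1 to v + p may give a path with only p - 2 arcs, a
    backward chord one with at least p - 1; hence the two thresholds for p.\<close>
  have far: "\<not> Adj (v + 2) q" if "Adj (v + 1) (v + p)" "k + 2 \<le> p \<or> k + 1 \<le> p \<and> \<not> A (v + 1) (v + p)"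
     "v + p < q" "q \<le> v + n - l + 1" for p q
  proof (cases "A (v + 1) (v + p)")
    case True
    then show ?thesis by (rule fwd_nonadj) (use that True kl l2 n in \<open>auto simp: two_def\<close>)
  next
    case False
    then have "A (v + p) (v + 1)" using that by (simp add: Adj_def)
    then show ?thesis by (rule bwd_nonadj) (use that kl l2 n in \<open>auto simp: two_def\<close>)
  qed
  have near2: "\<not> Adj (v + 2) (v + n - k + 1)" if "Adj (v + 1) (v + l + 1)"
  proof -
    have "\<not> A (v + n - k + 1) (v + 2)"
    proof (cases "A (v + 1) (v + l + 1)")
      case True
      then show ?thesis by (rule fwd_in) (use kl l2 n in \<open>auto simp: two_def\<close>)
    next
      case False
      then have "A (v + l + 1) (v + 1)" using that by (simp add: Adj_def)
      then show ?thesis by (rule bwd_in) (use kl l2 n in \<open>auto simp: two_def\<close>)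
    qed
    then show ?thesis using o2 by (simp add: Adj_def)
  qed
  show False
  proof (cases "2 * k \<le> n")
    \<comment> \<open>Since n - k + 1 >= k + 1, \<open>far\<close> applies to the vertex v + n - k +
      1, to which v + 1 has no arc by \<open>o1\<close>.\<close>
    case True
    show False
    proof (cases "Adj (v + 1) (v + n - k + 1)")
      case T2: True
      have f: "\<not> Adj (v + 2) q" if "v + n - k + 2 \<le> q" "q \<le> v + n - l + 1" for q
        using far[of "n-k+1" q] T2 o1 that True by (simp add: add_diff_eq add.assoc[symmetric])
      have "((v + n - k) - (v + l + 2) + 1) + ((v + n - l + 1) - (v + n - k + 2) + 1) \<le> n - k - l"
        by (rule missing2[of _ _ "v+2"]) (use f m2 kl l2 n in auto)
      then show False using kl by simp
    next
      case F: False
      have 1: "Adj (v + 1) (v + n - k + 2)" using extra1[of "v+n-k+1" "v+n-k+2"] F kl l2 n by fastforce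
      have 2: "Adj (v + 1) (v + l + 1)" using extra1[of "v+n-k+1" "v+l+1"] F kl l2 n by fastforce
      have f: "\<not> Adj (v + 2) q" if "v + n - k + 3 \<le> q" "q \<le> v + n - l + 1" for q
        using far[of "n-k+2" q] 1 that True by (simp add: add_diff_eq add.assoc[symmetric])
      have m: "\<not> Adj (v + 2) q" if "v + l + 2 \<le> q" "q \<le> v + n - k + 1" for q
        using m2[of q] near2[OF 2] that by (cases "q = v + n - k + 1") auto
      have "((v + n - k + 1) - (v + l + 2) + 1) + ((v + n - l + 1) - (v + n - k + 3) + 1) \<le> n - k - l"
        by (rule missing2[of _ _ "v+2"]) (use f m kl l2 n in auto)
      then show False using kl by simp
    qed
  next
    case small: False
    have k4: "\<not> Adj (v + 2) (v + k + 4)" if "A (v + 1) (v + (k + 1))" "Adj (v + 1) (v + k + 3)"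
    proof -
      have "\<not> A (v + k + 4) (v + 2)"
        by (rule fwd_in[OF that(1)]) (use kl l2 n small in \<open>auto simp: two_def\<close>)
      moreover have "\<not> A (v + 2) (v + k + 4)"
      proof (cases "A (v + 1) (v + k + 3)")
        case True
        then show ?thesis by (rule fwd_out) (use kl l2 n small in \<open>auto simp: two_def\<close>)
      next
        case False
        then have "A (v + k + 3) (v + 1)" using that by (simp add: Adj_def)
        then show ?thesis by (rule bwd_out) (use kl l2 n small in \<open>auto simp: two_def\<close>)
      qed
      ultimately show ?thesis by (simp add: Adj_def)
    qed
    show False
    proof (cases "Adj (v + 1) (v + l + 1)")
      case True
      have m: "\<not> Adj (v + 2) q" if "v + l + 2 \<le> q" "q \<le> v + n - k + 1" for q
        using m2[of q] near2[OF True] that by (cases "q = v + n - k + 1") auto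
      have all: "Adj (v + 2) q" if "v + n - k + 1 < q" "q < v + n + 2" for q
      proof (rule ccontr)
        assume "\<not> Adj (v + 2) q"
        then have "((v + n - k + 1) - (v + l + 2) + 1) + (q - q + 1) \<le> n - k - l"
          by (intro missing2[of _ _ "v+2"]) (use m that kl l2 n in auto)
        then show False by simp
      qed
      have 2: "\<not> Adj (v + 1) (v + (k + 2))"
        using far[of "k+2" "v+k+3"] all[of "v+k+3"] small n kl l2 by auto
      have 3: "Adj (v + 1) (v + p)" if "k + 1 \<le> p" "p \<noteq> k + 2" "p \<le> n" for p
        using extra1[of "v+p" "v+(k+2)"] 2 that small n kl l2 by fastforce
      have 4: "A (v + 1) (v + (k + 1))"
        using far[of "k+1" "v+k+2"] all[of "v+k+2"] 3[of "k+1"] small n kl l2 by auto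
      show False using k4[OF 4] 3[of "k+3"] all[of "v+k+4"] small n kl l2 by (simp add: add.assoc)
    next
      case False
      have 3: "Adj (v + 1) (v + p)" if "k + 1 \<le> p" "p \<le> n" for p
        using extra1[of "v+p" "v+l+1"] False that small n kl l2 by fastforce
      have 4: "A (v + 1) (v + (k + 1))"
      proof (rule ccontr)
        assume no: "\<not> ?thesis"
        have f: "\<not> Adj (v + 2) q" if "v + k + 2 \<le> q" "q \<le> v + n - l + 1" for q
          using far[of "k+1" q] 3[of "k+1"] no that n l2 by simp
        have "((v + n - k) - (v + l + 2) + 1) + ((v + n - l + 1) - (v + k + 2) + 1) \<le> n - k - l"
          by (rule missing2[of _ _ "v+2"]) (use f m2 kl l2 n small in auto)
        then show False using n by simp
      qed
      have f: "\<not> Adj (v + 2) q" if "v + k + 3 \<le> q" "q \<le> max (v + n - l + 1) (v + k + 4)" for q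
      proof (cases "q = v + k + 4")
        case True
        then show ?thesis using k4[OF 4] 3[of "k+3"] n l2 by (simp add: add.assoc)
      next
        case False
        then show ?thesis using far[of "k+2" q] 3[of "k+2"] that n l2 by auto
      qed
      have "((v + n - k) - (v + l + 2) + 1) + (max (v + n - l + 1) (v + k + 4) - (v + k + 3) + 1) \<le> n - k - l"
        by (rule missing2[of _ _ "v+2"]) (use f m2 kl l2 n small in auto)
      then show False using n by auto
    qed
  qed
qed

text \<open>A shortest chord of length between k + 1 and n - 2 takes N - 1 neighbours from v + 1. If
  v + 1 is adjacent to v + l + 2, that jump is forward by \<open>no_back_l1\<close> and takes N
  neighbours from v + 2, while the chord helps to exclude one more. Otherwise v + 1 has no further
  non-neighbour, and its neighbours exclude n - 2l - 2 vertices for v + 2, which exceeds N because k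
  >= l + 3.\<close>

lemma far_large:
  assumes kl: "l + 3 \<le> k" and l2: "2 \<le> l" and n: "k + l + 2 \<le> n" "2 * k \<le> n"
  shows False
proof -
  obtain x d where "Adj x (x + d)" "k + 1 \<le> d" "d \<le> n - 2"
  proof (rule ccontr)
    assume no: "\<not> thesis"
    note that' = that
    have 1: "\<not> Adj 0 q" if "k + 1 \<le> q" "q \<le> n - 2" for q
      using no that'[of 0 q] that by auto
    have 2: "\<not> Adj 0 q" if "2 \<le> q" "q \<le> k - 1" for q
    proof
      assume "Adj 0 q"
      then have "Adj q (q + (n - q))" using Adj_periodic(2)[of q 0] by (simp add: Adj_sym)
      then show False using no that'[of q "n-q"] that n by simp
    qed
    have "((k - 1) - 2 + 1) + ((n - 2) - (k + 1) + 1) \<le> n - k - l"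
      by (rule missing2[of _ _ 0]) (use 1 2 kl n l2 in auto)
    then show False using kl l2 by simp
  qed
  then obtain v L where vL: "Adj v (v + L)" "k + 1 \<le> L" "L \<le> n - 2" and
    min: "\<And>x y. Adj x y \<Longrightarrow> k + 1 \<le> y - x \<Longrightarrow> y - x \<le> n - 2 \<Longrightarrow> L \<le> y - x"
    using least_length[of x d "k+1" "n-2"] kl l2 by auto
  have m1: "\<not> Adj (v + 1) q" if "v + k + 2 \<le> q" "q \<le> v + n - l" for q
  proof (cases "q \<le> v + L")
    case True
    then show ?thesis using min[of "v+1" q] that vL by auto
  next
    case F: False
    show ?thesis
    proof (cases "A v (v + L)")
      case True
      then show ?thesis by (rule fwd_nonadj) (use that F kl l2 n vL in \<open>auto simp: two_def\<close>)
    next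
      case False
      then have "A (v + L) v" using vL by (simp add: Adj_def)
      then show ?thesis by (rule bwd_nonadj) (use that F kl l2 n vL in \<open>auto simp: two_def\<close>)
    qed
  qed
  show False
  proof (cases "Adj (v + 1) (v + l + 2)")
    case True
    then have a: "A (v + 1) (v + l + 2)"
      using no_back_l1[of "v+1"] kl l2 n by (simp add: Adj_def add.commute add.left_commute)
    have m2: "\<not> Adj (v + 2) q" if "v + l + 3 \<le> q" "q \<le> v + n - k + 2" for q
      by (rule fwd_nonadj[OF a]) (use that kl l2 n in \<open>auto simp: two_def\<close>)
    define p where "p = v + n - k + 3"
    have adj: "Adj (v + 2) p"
    proof (rule ccontr)
      assume no: "\<not> ?thesis"
      have "(v + n - k + 3) - (v + l + 3) + 1 \<le> n - k - l"
      proof (rule missing1[of _ _ "v+2"])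
        fix q assume "v + l + 3 \<le> q" "q \<le> v + n - k + 3"
        then show "v + 2 < q \<and> q < v + 2 + n \<and> \<not> Adj (v + 2) q"
          using no m2[of q] kl l2 by (cases "q = p") (auto simp: p_def)
      qed
      then show False by simp
    qed
    have "\<not> A (v + 2) p"
      by (rule fwd_out[OF a]) (use kl l2 n p_def in \<open>auto simp: two_def\<close>)
    moreover have "\<not> A p (v + 2)"
    proof (cases "p \<le> v + L")
      case True
      then show ?thesis using min[of "v+2" p] adj vL n kl p_def by auto
    next
      case F: False
      show ?thesis
      proof (cases "A v (v + L)")
        case True
        then show ?thesis by (rule fwd_in) (use F kl l2 n vL p_def in \<open>auto simp: two_def\<close>)
      next
        case False
        then have "A (v + L) v" using vL by (simp add: Adj_def)
        then show ?thesis by (rule bwd_in) (use F kl l2 n vL p_def in \<open>auto simp: two_def\<close>)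
      qed
    qed
    ultimately show False using adj by (simp add: Adj_def)
  next
    case no: False
    have near: "Adj (v + 1) q" if "v + l + 3 \<le> q \<and> q \<le> v + k + 1 \<or> q = v + n - l + 1" for q
    proof (rule ccontr)
      assume a: "\<not> ?thesis"
      have "seg_length (if q = v + n - l + 1 then [(v+l+2,v+l+2),(v+k+2,v+n-l),(q,q)]
        else [(v+l+2,v+l+2),(q,q),(v+k+2,v+n-l)]) \<le> n - k - l"
        by (rule missing[of _ "v+1"]) (use a no that m1 kl l2 n in auto)
      then show False by (auto split: if_splits)
    qed
    have "\<not> A v (v + L)"
    proof
      assume a: "A v (v + L)"
      have "\<not> Adj (v + 1) (v + n - l + 1)"
      proof (cases "v + n - l + 1 \<le> v + L")
        case True
        then show ?thesis using min[of "v+1" "v+n-l+1"] vL n kl by auto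
      next
        case False
        then show ?thesis
          by (intro fwd_nonadj[OF a]) (use kl l2 n vL in \<open>auto simp: two_def\<close>)
      qed
      then show False using near by simp
    qed
    then have a: "A (v + L) v" using vL by (simp add: Adj_def)
    have far: "\<not> Adj (v + 2) q" if "Adj (v + 1) (v + p)" "l + 2 \<le> p" "p \<le> k + 1" "v + p < q" "q \<le> v + k + 1 \<or> p = k + 1 \<and> q = v + k + 2" for p q
    proof (cases "A (v + 1) (v + p)")
      case True
      then show ?thesis by (rule fwd_nonadj) (use that kl l2 n in \<open>auto simp: two_def\<close>)
    next
      case False
      then have "A (v + p) (v + 1)" using that by (simp add: Adj_def)
      then show ?thesis by (rule bwd_nonadj) (use that kl l2 n in \<open>auto simp: two_def\<close>)
    qed
    have last: "\<not> Adj (v + 2) (v + n - l + 1)"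
    proof (cases "v + n - l + 1 \<le> v + L")
      case True
      then show ?thesis using min[of "v+2" "v+n-l+1"] vL n kl by auto
    next
      case F: False
      have out: "\<not> A (v + 2) (v + n - l + 1)"
        by (rule bwd_out[OF a]) (use F kl l2 n vL in \<open>auto simp: two_def\<close>)
      show ?thesis
      proof (cases "A (v + 1) (v + k + 1)")
        case True
        then have "\<not> A (v + n - l + 1) (v + 2)"
          by (rule fwd_in) (use kl l2 n in \<open>auto simp: two_def\<close>)
        then show ?thesis using out by (simp add: Adj_def)
      next
        case False
        then have "A (v + k + 1) (v + 1)" using near[of "v+k+1"] kl by (simp add: Adj_def)
        then show ?thesis
          by (rule bwd_nonadj) (use kl l2 n in \<open>auto simp: two_def\<close>)
      qed
    qed
    have m2: "\<not> Adj (v + 2) q" if q: "v + l + 4 \<le> q" "q \<le> v + n - l + 1" for q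
    proof -
      consider "q \<le> v + k + 1" | "q = v + k + 2" | "v + k + 3 \<le> q" "q \<le> v + L" | "v + L < q" "q \<le> v + n - l"
        | "q = v + n - l + 1" using q vL by linarith
      then show ?thesis
      proof cases
        case 1
        then show ?thesis using far[of "l+3" q] near[of "v+l+3"] q kl by (simp add: add.assoc)
      next
        case 2
        then show ?thesis using far[of "k+1" q] near[of "v+k+1"] q kl by (simp add: add.assoc)
      next
        case 3
        then show ?thesis using min[of "v+2" q] vL by auto
      next
        case 4
        then show ?thesis
          by (intro bwd_nonadj[OF a]) (use q kl l2 n vL in \<open>auto simp: two_def\<close>)
      qed (use last in simp)
    qed
    have "(v + n - l + 1) - (v + l + 4) + 1 \<le> n - k - l"
      by (rule missing1[of _ _ "v+2"]) (use m2 kl l2 n in auto)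
    then show False using kl by simp
  qed
qed

text \<open>The range l + 1 to n - l - 1 is invariant under replacing d by n - d, so a shortest
  chord restricts both sides of its ends. Its length M turns out to be l + 1 or l + 2; for M = l + 1
  it is forward by \<open>no_back_l1\<close>.\<close>

lemma far_small:
  assumes kl: "l + 3 \<le> k" and l2: "2 \<le> l" and n: "k + l + 2 \<le> n" "n < 2 * k"
  shows False
proof -
  obtain x d where "Adj x (x + d)" "l + 1 \<le> d" "d \<le> n - l - 1"
  proof (rule ccontr)
    assume no: "\<not> thesis"
    have "\<not> Adj 0 q" if "l + 1 \<le> q" "q \<le> n - l - 1" for q
      using no \<open>\<And>x d. Adj x (x + d) \<Longrightarrow> l + 1 \<le> d \<Longrightarrow> d \<le> n - l - 1 \<Longrightarrow> thesis\<close>[of 0 q] that by auto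
    then have "(n - l - 1) - (l + 1) + 1 \<le> n - k - l"
      by (intro missing1[of _ _ 0]) (use l2 in auto)
    then show False using kl n by simp
  qed
  then obtain v M where vM: "Adj v (v + M)" "l + 1 \<le> M" "M \<le> n - l - 1" and
    min: "\<And>x y. Adj x y \<Longrightarrow> l + 1 \<le> y - x \<Longrightarrow> y - x \<le> n - l - 1 \<Longrightarrow> M \<le> y - x"
    using least_length[of x d "l+1" "n-l-1"] kl l2 by auto
  have M2: "M \<le> n - M"
  proof -
    have "Adj (v + M) (v + n)" using vM(1) by (simp add: Adj_sym)
    from min[OF this] show ?thesis using vM by simp
  qed
  show False
  proof (cases "M = l + 1")
    case False
    then have Ml: "l + 2 \<le> M" using vM by simp
    have "((v + M - 1) - (v + l + 1) + 1) + ((v + n - l - 1) - (v + n - M + 1) + 1) \<le> n - k - l"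
    proof (rule missing2[of _ _ v])
      fix q assume "v + l + 1 \<le> q" "q \<le> v + M - 1"
      then show "v < q \<and> q < v + n \<and> \<not> Adj v q" using min[of v q] vM M2 l2 by auto
    next
      fix q assume q: "v + n - M + 1 \<le> q" "q \<le> v + n - l - 1"
      then have "\<not> Adj q (v + n)" using min[of q "v+n"] vM M2 by auto
      then show "v < q \<and> q < v + n \<and> \<not> Adj v q" using q vM M2 l2 by (auto simp: Adj_sym)
    qed (use M2 in auto)
    then have MN: "2 * (M - l - 1) \<le> n - k - l" by simp
    have nofwd: "\<not> A x (x + M)" for x
    proof
      assume a: "A x (x + M)"
      have 1: "\<not> Adj (x + 1) q" if "x + l + 2 \<le> q" "q \<le> x + n - k + 1" for q
      proof (cases "q \<le> x + M")
        case True
        then show ?thesis using min[of "x+1" q] that vM by auto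
      next
        case False
        then show ?thesis
          by (intro fwd_nonadj[OF a]) (use that kl l2 n vM Ml MN in \<open>auto simp: two_def\<close>)
      qed
      have "\<not> Adj (x + n - l) (x + 1 + n)" using min[of "x+n-l" "x+1+n"] vM Ml M2 by auto
      then have 2: "\<not> Adj (x + 1) (x + n - l)" by (simp add: Adj_sym)
      have "((x + n - k + 1) - (x + l + 2) + 1) + ((x + n - l) - (x + n - l) + 1) \<le> n - k - l"
        by (rule missing2[of _ _ "x+1"]) (use 1 2 kl l2 n in auto)
      then show False by simp
    qed
    have a: "A (v + M) v" using vM nofwd[of v] by (simp add: Adj_def)
    have m1: "\<not> Adj (v + 1) q" if "v + l + 2 \<le> q" "q \<le> v + n - k" for q
    proof (cases "q \<le> v + M")
      case True
      then show ?thesis using min[of "v+1" q] that vM by auto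
    next
      case False
      then show ?thesis
        by (intro bwd_nonadj[OF a]) (use that kl l2 n vM Ml MN in \<open>auto simp: two_def\<close>)
    qed
    have m1': "\<not> Adj (v + 1) q" if "v + n - M + 2 \<le> q" "q \<le> v + n - l" for q
    proof -
      have "\<not> Adj q (v + 1 + n)" using min[of q "v+1+n"] that vM M2 by auto
      then show ?thesis by (simp add: Adj_sym)
    qed
    \<comment> \<open>N - 1 non-neighbours of v + 1 on one side and M - l - 1 on the other, so M - l
      - 1 is at most 1.\<close>
    have "((v + n - k) - (v + l + 2) + 1) + ((v + n - l) - (v + n - M + 2) + 1) \<le> n - k - l"
      by (rule missing2[of _ _ "v+1"]) (use m1 m1' kl l2 n Ml MN in auto)
    then have M: "M = l + 2" using Ml by simp
    have mid: "\<not> Adj (v + 1) (v + n - l)" using m1' M by simp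
    have "Adj (v + 1) (v + n - l - 1)"
    proof (rule ccontr)
      assume no: "\<not> ?thesis"
      have "\<not> Adj (v + 1) q" if q: "v + n - l - 1 \<le> q" "q \<le> v + n - l" for q
      proof -
        have "q = v + n - l - 1 \<or> q = v + n - l" using q by linarith
        then show ?thesis using no mid by auto
      qed
      then have "((v + n - k) - (v + l + 2) + 1) + ((v + n - l) - (v + n - l - 1) + 1) \<le> n - k - l"
        by (intro missing2[of _ _ "v+1"]) (use m1 kl l2 n in auto)
      then show False by simp
    qed
    moreover have "\<not> A (v + n - l - 1) (v + 1 + n)" using nofwd[of "v+n-l-1"] M by (simp add: algebra_simps)
    ultimately have a1: "A (v + 1) (v + n - l - 1)" by (simp add: Adj_def)
    have adj: "Adj (v + 1) (v + n - l + 1)"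
    proof (rule ccontr)
      assume no: "\<not> ?thesis"
      have "\<not> Adj (v + 1) q" if q: "v + n - l \<le> q" "q \<le> v + n - l + 1" for q
      proof -
        have "q = v + n - l \<or> q = v + n - l + 1" using q by linarith
        then show ?thesis using no mid by auto
      qed
      then have "((v + n - k) - (v + l + 2) + 1) + ((v + n - l + 1) - (v + n - l) + 1) \<le> n - k - l"
        by (intro missing2[of _ _ "v+1"]) (use m1 kl l2 n in auto)
      then show False by simp
    qed
    have x2: "\<not> Adj (v + 2) (v + n - l + 2)"
    proof (cases "A (v + 1) (v + n - l + 1)")
      case True
      have "\<not> A (v + 2) (v + n - l + 2)"
        by (rule fwd_out[OF True]) (use kl l2 n in \<open>auto simp: two_def\<close>)
      moreover have "\<not> A (v + n - l + 2) (v + 2)"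
        by (rule fwd_in[OF a1]) (use kl l2 n in \<open>auto simp: two_def\<close>)
      ultimately show ?thesis by (simp add: Adj_def)
    next
      case False
      then have a2: "A (v + n - l + 1) (v + 1)" using adj by (simp add: Adj_def)
      have "\<not> A (v + 2) (v + n - l + 2)"
        by (rule bwd_out[OF a2]) (use kl l2 n in \<open>auto simp: two_def\<close>)
      moreover have "\<not> A (v + n - l + 2) (v + 2)"
        by (rule fwd_in[OF a1]) (use kl l2 n in \<open>auto simp: two_def\<close>)
      ultimately show ?thesis by (simp add: Adj_def)
    qed
    have "\<not> Adj (v + n - l + 1) (v + 2 + n)" using min[of "v+n-l+1" "v+2+n"] vM Ml by auto
    then have x1: "\<not> Adj (v + 2) (v + n - l + 1)" by (simp add: Adj_sym)
    have m2: "\<not> Adj (v + 2) q" if "v + l + 3 \<le> q" "q \<le> max (v + n - k) (v + l + 3)" for q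
    proof (cases "q = v + l + 3")
      case True
      then show ?thesis using min[of "v+2" q] Ml M2 by auto
    next
      case False
      then show ?thesis
        by (intro bwd_nonadj[OF a]) (use that kl l2 n vM M in \<open>auto simp: two_def\<close>)
    qed
    show False
    proof (cases "n = k + l + 2")
      case True
      have "\<not> Adj (v + 2) q" if q: "v + n - l + 1 \<le> q" "q \<le> v + n - l + 2" for q
      proof -
        have "q = v + n - l + 1 \<or> q = v + n - l + 2" using q by linarith
        then show ?thesis using x1 x2 by auto
      qed
      then have "(max (v + n - k) (v + l + 3) - (v + l + 3) + 1) + ((v + n - l + 2) - (v + n - l + 1) + 1) \<le> n - k - l"
        by (intro missing2[of _ _ "v+2"]) (use m2 kl l2 n True in auto)
      then show False using True by auto
    next
      case False
      have x0: "\<not> Adj (v + 2) (v + n - l)"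
        by (rule fwd_nonadj[OF a1]) (use kl l2 n False in \<open>auto simp: two_def\<close>)
      have "\<not> Adj (v + 2) q" if q: "v + n - l \<le> q" "q \<le> v + n - l + 2" for q
      proof -
        consider "q = v + n - l" | "q = v + n - l + 1" | "q = v + n - l + 2" using q by linarith
        then show ?thesis using x0 x1 x2 by cases auto
      qed
      then have "(max (v + n - k) (v + l + 3) - (v + l + 3) + 1) + ((v + n - l + 2) - (v + n - l) + 1) \<le> n - k - l"
        by (intro missing2[of _ _ "v+2"]) (use m2 kl l2 n False in auto)
      then show False using False n by auto
    qed
  next
    case M: True
    then have a: "A v (v + l + 1)"
      using no_back_l1[of v] vM kl l2 n by (simp add: Adj_def add.assoc)
    \<comment> \<open>These are N vertices, so v + 1 is adjacent to all others.\<close>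
    have m1: "\<not> Adj (v + 1) q" if "v + l + 2 \<le> q" "q \<le> v + n - k + 1" for q
      by (rule fwd_nonadj[OF a]) (use that kl l2 n in \<open>auto simp: two_def\<close>)
    have near1: "Adj (v + 1) q" if "v + n - k + 1 < q" "q < v + n + 1" for q
    proof (rule ccontr)
      assume "\<not> ?thesis"
      then have "((v + n - k + 1) - (v + l + 2) + 1) + (q - q + 1) \<le> n - k - l"
        by (intro missing2[of _ _ "v+1"]) (use m1 that kl l2 n in auto)
      then show False by simp
    qed
    show False
    proof (cases "Adj (v + 2) (v + l + 3)")
      case True
      then have a2: "A (v + 2) (v + l + 3)"
        using no_back_l1[of "v+2"] kl l2 n by (simp add: Adj_def add.commute add.left_commute)
      have m3: "\<not> Adj (v + 3) q" if "v + l + 4 \<le> q" "q \<le> v + n - k + 3" for q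
        by (rule fwd_nonadj[OF a2]) (use that kl l2 n in \<open>auto simp: two_def\<close>)
      have near3: "Adj (v + 3) q" if "v + n - k + 3 < q" "q < v + n + 3" for q
      proof (rule ccontr)
        assume "\<not> ?thesis"
        then have "((v + n - k + 3) - (v + l + 4) + 1) + (q - q + 1) \<le> n - k - l"
          by (intro missing2[of _ _ "v+3"]) (use m3 that kl l2 n in auto)
        then show False by simp
      qed
      show False
      proof (cases "A (v + 1) (v + k + 2)")
        case F: True
        have "\<not> A (v + k + 4) (v + 3)"
          by (rule fwd_in[OF F]) (use kl l2 n in \<open>auto simp: two_def\<close>)
        moreover have "\<not> A (v + 3) (v + k + 4)"
        proof (cases "A (v + 1) (v + k + 3)")
          case True
          show ?thesis
            by (rule fwd_out[OF True]) (use kl l2 n in \<open>auto simp: two_def\<close>)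
        next
          case False
          then have "A (v + k + 3) (v + 1)" using near1[of "v+k+3"] n kl l2 by (auto simp: Adj_def)
          then show ?thesis
            by (rule bwd_out) (use kl l2 n in \<open>auto simp: two_def\<close>)
        qed
        ultimately show False using near3[of "v+k+4"] n kl l2 by (auto simp: Adj_def)
      next
        case False
        then have "A (v + k + 2) (v + 1)" using near1[of "v+k+2"] n kl l2 by (auto simp: Adj_def)
        then have "\<not> Adj (v + 3) (v + k + 3)"
          by (rule bwd_nonadj) (use kl l2 n in \<open>auto simp: two_def\<close>)
        then show False using near3[of "v+k+3"] n kl l2 by auto
      qed
    next
      case no: False
      have few: "q - (v + k + 3) + 1 + 1 \<le> n - k - l" if "\<And>p. v + k + 3 \<le> p \<Longrightarrow> p \<le> q \<Longrightarrow> \<not> Adj (v + 2) p" "q < v + n + 2" for q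
      proof -
        have "(v + l + 3) - (v + l + 3) + 1 + (q - (v + k + 3) + 1) \<le> n - k - l"
          by (rule missing2[of _ _ "v+2"]) (use that no kl l2 n in auto)
        then show ?thesis by simp
      qed
      have "\<not> A (v + 1) (v + k + 2)"
      proof
        assume F: "A (v + 1) (v + k + 2)"
        have "\<not> Adj (v + 2) p" if "v + k + 3 \<le> p" "p \<le> v + n - l + 2" for p
          by (rule fwd_nonadj[OF F]) (use that kl l2 n in \<open>auto simp: two_def\<close>)
        then show False using few[of "v+n-l+2"] l2 by simp
      qed
      then have B: "A (v + k + 2) (v + 1)" using near1[of "v+k+2"] n kl l2 by (auto simp: Adj_def)
      have b: "\<not> Adj (v + 2) p" if "v + k + 3 \<le> p" "p \<le> v + n - l + 1" for p
        by (rule bwd_nonadj[OF B]) (use that kl l2 n in \<open>auto simp: two_def\<close>)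
      have b': "\<not> A (v + 2) (v + n - l + 2)"
        by (rule bwd_out[OF B]) (use kl l2 n in \<open>auto simp: two_def\<close>)
      show False
      proof (cases "A (v + 1) (v + k + 1)")
        case True
        then have "\<not> A (v + n - l + 2) (v + 2)"
          by (rule fwd_in) (use kl l2 n in \<open>auto simp: two_def\<close>)
        then have "\<not> Adj (v + 2) p" if "v + k + 3 \<le> p" "p \<le> v + n - l + 2" for p
          using b[of p] b' that by (cases "p = v + n - l + 2") (auto simp: Adj_def)
        then show False using few[of "v+n-l+2"] l2 by simp
      next
        case False
        then have "A (v + k + 1) (v + 1)" using near1[of "v+k+1"] n kl l2 by (auto simp: Adj_def)
        then have k2: "\<not> Adj (v + 2) (v + k + 2)"
          by (rule bwd_nonadj) (use kl l2 n in \<open>auto simp: two_def\<close>)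
        have "\<not> Adj (v + 2) p" if "v + k + 2 \<le> p" "p \<le> v + n - l + 1" for p
          using b[of p] k2 that by (cases "p = v + k + 2") auto
        then have "(v + l + 3) - (v + l + 3) + 1 + ((v + n - l + 1) - (v + k + 2) + 1) \<le> n - k - l"
          by (intro missing2[of _ _ "v+2"]) (use no kl l2 n in auto)
        then show False by simp
      qed
    qed
  qed
qed

lemma far_False: "l + 3 \<le> k \<Longrightarrow> 2 \<le> l \<Longrightarrow> k + l + 2 \<le> n \<Longrightarrow> False"
  using far_large far_small by force

end

section \<open>The case \<open>k = l + 2\<close>\<close>

context cyclic
begin

text \<open>\<open>nbrs v a b\<close>: the neighbours of \<open>v\<close> are exactly the other vertices of the interval from \<open>a\<close> to \<open>b\<close>.\<close>

definition "nbrs v a b \<longleftrightarrow> (\<forall>q. v < q \<longrightarrow> q < v + n \<longrightarrow> Adj v q \<longleftrightarrow> q \<le> b \<or> a + n \<le> q)"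

text \<open>The excluded interval from b + 1 to a + n - 1 already has at least N vertices, so
  \<open>missing\<close> leaves no room for a non-neighbour elsewhere.\<close>

lemma nbrsI:
  assumes "\<And>q. b < q \<Longrightarrow> q < a + n \<Longrightarrow> \<not> Adj v q" "v \<le> b" "a \<le> v" "n - k - l \<le> a + n - b - 1" "b < a + n"
  shows "nbrs v a b"
  unfolding nbrs_def
proof (intro allI impI)
  fix q assume q: "v < q" "q < v + n"
  have "Adj v q" if "q \<le> b \<or> a + n \<le> q"
  proof (rule ccontr)
    assume no: "\<not> Adj v q"
    have "seg_length (if q \<le> b then [(q,q),(b+1,a+n-1)] else [(b+1,a+n-1),(q,q)]) \<le> n - k - l"
      by (rule missing[of _ v]) (use no that q assms in auto)
    then show False using assms(4) by (auto split: if_splits)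
  qed
  then show "Adj v q \<longleftrightarrow> q \<le> b \<or> a + n \<le> q" using assms(1)[of q] by force
qed

lemma nbrsD: "nbrs v a b \<Longrightarrow> v < q \<Longrightarrow> q < v + n \<Longrightarrow> q \<le> b \<or> a + n \<le> q \<Longrightarrow> Adj v q"
  by (auto simp: nbrs_def)

context
  assumes kl: "k = l + 2" and n: "2 * l + 4 \<le> n"
begin

definition "long_jump v \<longleftrightarrow> A v (v + l + 1)"

lemma k2': "l + 2 \<le> k" "k \<le> l + 2" "2 \<le> l" using kl pos by auto

lemma long_jump_Adj: "Adj v (v + l + 1) \<longleftrightarrow> long_jump v"
  using no_back_l1[of v] k2' n by (auto simp: long_jump_def Adj_def)

text \<open>A long jump excludes exactly N vertices for v + 1, and likewise for v + l, and so fixes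
  their neighbourhoods. Each of these contains a vertex at distance l + 1 on the far side, and the
  jump leaves only one direction for that arc. Thus long jumps repeat at distance l.\<close>

lemma long_jump_nbrs1: "long_jump v \<Longrightarrow> nbrs (v + 1) (v - l) (v + l + 1)"
proof (rule nbrsI)
  fix q assume x: "long_jump v" and q: "v + l + 1 < q" "q < v - l + n"
  from x show "\<not> Adj (v + 1) q" unfolding long_jump_def
    by (rule fwd_nonadj) (use q k2' n in \<open>auto simp: two_def\<close>)
qed (use n k2' in auto)

lemma long_jump_nbrs2: "long_jump v \<Longrightarrow> nbrs (v + l) v (v + 2 * l + 1)"
proof (rule nbrsI)
  fix q assume x: "long_jump v" and q: "v + 2 * l + 1 < q" "q < v + n"
  from x show "\<not> Adj (v + l) q" unfolding long_jump_def
    by (rule fwd_nonadj) (use q k2' n in \<open>auto simp: two_def\<close>)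
qed (use n k2' in auto)

lemma long_jump_minus: "long_jump v \<Longrightarrow> long_jump (v - l)"
proof -
  assume x: "long_jump v"
  have "Adj (v + 1) (v - l + n)"
    by (rule nbrsD[OF long_jump_nbrs1[OF x]]) (use k2' n in \<open>auto simp: algebra_simps\<close>)
  moreover have "\<not> A (v + 1) (v - l + n)"
    by (rule fwd_out[OF x[unfolded long_jump_def]]) (use k2' n in \<open>auto simp: two_def\<close>)
  ultimately have "A (v - l) (v + 1)" by (simp add: Adj_def)
  then show ?thesis by (simp add: long_jump_def)
qed

lemma long_jump_plus: "long_jump v \<Longrightarrow> long_jump (v + l)"
proof -
  assume x: "long_jump v"
  have "Adj (v + l) (v + 2 * l + 1)"
    by (rule nbrsD[OF long_jump_nbrs2[OF x]]) (use k2' n in \<open>auto simp: algebra_simps\<close>)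
  moreover have "\<not> A (v + 2 * l + 1) (v + l)"
    by (rule fwd_in[OF x[unfolded long_jump_def]]) (use k2' n in \<open>auto simp: two_def\<close>)
  ultimately have "A (v + l) (v + 2 * l + 1)" by (simp add: Adj_def)
  then show ?thesis by (simp add: long_jump_def algebra_simps)
qed

lemma long_jump_nbrs: "long_jump v \<Longrightarrow> nbrs v (v - l) (v + l + 1)"
  using long_jump_nbrs2[OF long_jump_minus, of v] by (simp add: algebra_simps)

lemma long_jump_excl: "long_jump v \<Longrightarrow> \<not> long_jump (v + 1)"
  using long_jump_nbrs1[of v] long_jump_Adj[of "v+1"] k2' n unfolding nbrs_def by (auto dest: spec[of _ "v+1+l+1"])

text \<open>The backward jump would fix the neighbourhood of v + 2 and produce an arc from v - l to
  v + 2, which contradicts the neighbourhood of v - l + 1 known from the long jump at v - l. The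
  next lemma is the mirror image.\<close>

lemma long_jump_jump1: "long_jump v \<Longrightarrow> \<not> A (v + l + 1) (v + 1)"
proof
  assume x: "long_jump v" and b: "A (v + l + 1) (v + 1)"
  have "nbrs (v + 2) (v - l) (v + l + 1)"
  proof (rule nbrsI)
    fix q assume q: "v + l + 1 < q" "q < v - l + n"
    show "\<not> Adj (v + 2) q"
      by (rule bwd_nonadj[OF b]) (use q k2' n in \<open>auto simp: two_def\<close>)
  qed (use n k2' in auto)
  from nbrsD[OF this] have "Adj (v + 2) (v - l + n)" using k2' n by (auto simp: algebra_simps)
  moreover have "\<not> A (v + 2) (v - l + n)"
    by (rule bwd_out[OF b]) (use k2' n in \<open>auto simp: two_def\<close>)
  ultimately have a: "A (v - l) (v + 2)" by (simp add: Adj_def)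
  have "\<not> Adj (v - l + 1) (v - 2 * l + n)"
    by (rule fwd_nonadj[OF a]) (use k2' n in \<open>auto simp: two_def\<close>)
  moreover have "Adj (v - l + 1) (v - 2 * l + n)"
    by (rule nbrsD[OF long_jump_nbrs1[OF long_jump_minus[OF x]]]) (use k2' n in auto)
  ultimately show False by simp
qed

lemma long_jump_jump0: "long_jump v \<Longrightarrow> \<not> A (v + l) v"
proof
  assume x: "long_jump v" and b: "A (v + l) v"
  have "nbrs (v + l - 1) v (v + 2 * l + 1)"
  proof (rule nbrsI)
    fix q assume q: "v + 2 * l + 1 < q" "q < v + n"
    show "\<not> Adj (v + l - 1) q"
      by (rule bwd_nonadj[OF b]) (use q k2' n in \<open>auto simp: two_def\<close>)
  qed (use n k2' in auto)
  from nbrsD[OF this] have "Adj (v + l - 1) (v + 2 * l + 1)" using k2' n by (auto simp: algebra_simps)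
  moreover have "\<not> A (v + 2 * l + 1) (v + l - 1)"
    by (rule bwd_in[OF b]) (use k2' n in \<open>auto simp: two_def\<close>)
  ultimately have a: "A (v + l - 1) (v + 2 * l + 1)" by (simp add: Adj_def)
  have "\<not> Adj (v + 2 * l) (v + 3 * l + 1)"
    by (rule fwd_nonadj[OF a]) (use k2' n in \<open>auto simp: two_def\<close>)
  moreover have "Adj (v + 2 * l) (v + 3 * l + 1)"
    using long_jump_nbrs2[OF long_jump_plus[OF x]] k2' n unfolding nbrs_def by (auto simp: algebra_simps)
  ultimately show False by simp
qed

text \<open>The scheme of \<open>k1_no_long\<close>, except that long jumps cannot start at
  consecutive vertices: only every second vertex starts one, and the parity of L - l
  matters.\<close>

lemma k2_no_long: "\<not> (Adj x (x + d) \<and> l + 2 \<le> d \<and> d \<le> n - l - 2)"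
proof
  assume "Adj x (x + d) \<and> l + 2 \<le> d \<and> d \<le> n - l - 2"
  then obtain v L where vL: "Adj v (v + L)" "l + 2 \<le> L" "L \<le> n - l - 2" and
    min: "\<And>x y. Adj x y \<Longrightarrow> l + 2 \<le> y - x \<Longrightarrow> y - x \<le> n - l - 2 \<Longrightarrow> L \<le> y - x"
    using least_length[of x d "l+2" "n-l-2"] k2' by auto
  have "\<not> A v (v + L)"
  proof
    assume a: "A v (v + L)"
    have s: "nbrs (v + 1) (v - l + 1) (v + l + 2)"
    proof (rule nbrsI)
      fix q assume q: "v + l + 2 < q" "q < v - l + 1 + n"
      show "\<not> Adj (v + 1) q"
      proof (cases "q \<le> v + L")
        case True
        then show ?thesis using min[of "v+1" q] q vL by auto
      next
        case False
        then show ?thesis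
          by (intro fwd_nonadj[OF a]) (use q k2' n vL in \<open>auto simp: two_def\<close>)
      qed
    qed (use n k2' in auto)
    have "Adj (v + 1) (v + 1 + l + 1)"
    by (rule nbrsD[OF s]) (use k2' n in \<open>auto simp: algebra_simps\<close>)
    then have x: "long_jump (v + 1)" by (simp only: long_jump_Adj)
    have "Adj (v + 1) (v - l + 1 + n)"
    by (rule nbrsD[OF s]) (use k2' n in \<open>auto simp: algebra_simps\<close>)
    moreover have "\<not> A (v - l + 1 + n) (v + 1)"
      by (rule fwd_in[OF a]) (use k2' n vL in \<open>auto simp: two_def\<close>)
    ultimately have "A (v + 1) (v - l + 1 + n)" by (simp add: Adj_def)
    then have "A (v + 1) (v + 1 - l)" by (simp only: A_periodic) (simp add: algebra_simps)
    then show False using long_jump_jump0[OF long_jump_minus[OF x]] by simp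
  qed
  then have a: "A (v + L) v" using vL by (simp add: Adj_def)
  have blocks: "\<not> Adj (v + i) q" if "\<And>s. 1 \<le> s \<Longrightarrow> s < m \<Longrightarrow> odd s \<Longrightarrow> long_jump (v + s)" "odd m" "m \<le> i" "i \<le> L - l"
     "v + n - l + 1 \<le> q" "q \<le> v + n + m - l - 1" for m i q
  proof -
    define j where "j = q - n - v + l"
    have j: "1 \<le> j" "j \<le> m - 1" using that by (auto simp: j_def)
    \<comment> \<open>Long jumps are known at odd offsets only. The one starting at v + r - l fixes
      the neighbourhoods of v + r - l and v + r - l + 1, and q - n is one of these two.\<close>
    define r where "r = (if odd j then j else j - 1)"
    have r: "odd r" "1 \<le> r" "r < m" "r \<le> m - 2"
    proof -
      show "odd r" by (auto simp: r_def)
      show "1 \<le> r" using j unfolding r_def by presburger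
      show "r < m" using j by (auto simp: r_def)
      then show "r \<le> m - 2" using \<open>odd r\<close> \<open>odd m\<close> by presburger
    qed
    have X: "long_jump (v + r - l)" using long_jump_minus[OF that(1)[of r]] r by simp
    have "nbrs (q - n) (v + r - 2 * l) (v + r + 1)"
    proof (cases "odd j")
      case True
      then show ?thesis using long_jump_nbrs[OF X] by (simp add: r_def j_def algebra_simps)
    next
      case False
      then show ?thesis using long_jump_nbrs1[OF X] by (simp add: r_def j_def algebra_simps)
    qed
    then have "\<not> Adj (q - n) (v + i)"
      using that r j vL k2' unfolding nbrs_def by (auto simp: j_def dest: spec[of _ "v+i"])
    then show ?thesis by (simp add: Adj_sym)
  qed
  have odd_X: "1 \<le> i \<longrightarrow> i + l + 1 \<le> L \<longrightarrow> odd i \<longrightarrow> long_jump (v + i)" for i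
  proof (induction "nat i" arbitrary: i rule: less_induct)
    case less
    show ?case
    proof (intro impI)
      assume i: "1 \<le> i" "i + l + 1 \<le> L" "odd i"
      have g: "long_jump (v + r)" if "1 \<le> r" "r < i" "odd r" for r using less that i by auto
      have "nbrs (v + i) (v + i - l) (v + i + l + 1)"
      proof (rule nbrsI)
        fix q assume q: "v + i + l + 1 < q" "q < v + i - l + n"
        consider "q \<le> v + L" | "v + L < q" "q \<le> v + n - l" | "v + n - l + 1 \<le> q" by linarith
        then show "\<not> Adj (v + i) q"
        proof cases
          case 1
          then show ?thesis using min[of "v+i" q] q vL i by auto
        next
          case 2
          then show ?thesis
            by (intro bwd_nonadj[OF a]) (use q i k2' n vL in \<open>auto simp: two_def\<close>)
        next
          case 3
          then show ?thesis using blocks[OF g, of i i q] i q by auto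
        qed
      qed (use n k2' in auto)
      from nbrsD[OF this] have "Adj (v + i) (v + i + l + 1)" using k2' n by (auto simp: algebra_simps)
      then show "long_jump (v + i)" by (simp only: long_jump_Adj)
    qed
  qed
  have top: "long_jump (v + L - l - 2)"
  proof -
    have "nbrs (v + L - 1) (v + L - l - 2) (v + L + l - 1)"
    proof (rule nbrsI)
      fix q assume q: "v + L + l - 1 < q" "q < v + L - l - 2 + n"
      show "\<not> Adj (v + L - 1) q"
      proof (cases "q < v + n")
        case True
        then show ?thesis
          by (intro bwd_nonadj[OF a]) (use q k2' n vL in \<open>auto simp: two_def\<close>)
      next
        case False
        then have "\<not> Adj (q - n) (v + L - 1)" using min[of "q-n" "v+L-1"] q vL by auto
        then show ?thesis by (simp add: Adj_sym)
      qed
    qed (use n k2' in auto)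
    from nbrsD[OF this] have "Adj (v + L - 1) (v + L - l - 2 + n)" using k2' n by (auto simp: algebra_simps)
    then have "Adj (v + L - l - 2) (v + L - l - 2 + l + 1)" by (simp add: Adj_sym)
    then show ?thesis by (simp only: long_jump_Adj)
  qed
  \<comment> \<open>For even L - l there would be long jumps at the consecutive vertices v + L - l -
    2 and v + L - l - 1.\<close>
  have par: "odd (L - l)"
  proof (rule ccontr)
    assume "\<not> ?thesis"
    then have "long_jump (v + (L - l - 1))" using odd_X[of "L-l-1"] vL by auto
    then show False using long_jump_excl[OF top] by (simp add: algebra_simps)
  qed
  define m where "m = L - l"
  have m: "odd m" "3 \<le> m" using par vL unfolding m_def by presburger+
  have mX: "long_jump (v + r)" if "1 \<le> r" "r < m" "odd r" for r
    using odd_X[of r] that m by (auto simp: m_def)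
  have non: "\<not> Adj (v + m) q" if "v + m + l < q" "q < v + m - l + n" "q \<noteq> v + n - l" for q
  proof (cases "q < v + n - l")
    case True
    then show ?thesis
      by (intro bwd_nonadj[OF a]) (use that k2' n vL m_def in \<open>auto simp: two_def\<close>)
  next
    case False
    then show ?thesis using blocks[OF mX, of m m q] that m by (auto simp: m_def)
  qed
  have "Adj (v + m) (v + n - l)"
  proof (rule ccontr)
    assume "\<not> ?thesis"
    then have "(v + m - l + n - 1) - (v + m + l + 1) + 1 \<le> n - k - l"
      by (intro missing1[of _ _ "v+m"]) (use non k2' n m in force)+
    then show False using k2' by simp
  qed
  moreover have "\<not> A (v + n - l) (v + m)"
    by (rule bwd_in[OF a]) (use k2' n vL m m_def in \<open>auto simp: two_def\<close>)
  ultimately have am: "A (v + m) (v + n - l)" by (simp add: Adj_def)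
  show False
  proof (cases "l \<le> m")
    case True
    show False
    proof (cases "even l")
      case T2: True
      then have lm: "l < m" using True m by (cases "l = m") auto
      have "long_jump (v + (l - 1) - l)" by (rule long_jump_minus, rule mX) (use T2 k2' lm in auto)
      then have "A (v - 1) (v + l)" by (simp add: long_jump_def)
      then have j: "A (v + n - 1) (v + n + l)"
        using A_periodic(1)[of "v-1" "v+n+l"] A_periodic(2)[of "v-1" "v+l"] by (simp add: algebra_simps)
      show False
        by (rule theta_segs[of "[(v+m,v+L),(v+n,v+n+l)]" "[(v+m,v+m),(v+n-l,v+n-1),(v+n+l,v+n+l)]" "v+m" "v+n+l" "v+m"])
          (use j a am lm k2' n vL m m_def in \<open>auto simp: seg_meet_def\<close>)
    next
      case F: False
      then have l3: "3 \<le> l" using k2' by presburger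
      have "long_jump (v + (l - 2) - l)" by (rule long_jump_minus, rule mX) (use F l3 True in auto)
      then have "A (v - 2) (v + l - 1)" by (simp add: long_jump_def algebra_simps)
      then have j: "A (v + n - 2) (v + n + l - 1)"
        using A_periodic(1)[of "v-2" "v+n+l-1"] A_periodic(2)[of "v-2" "v+l-1"] by (simp add: algebra_simps)
      show False
        by (rule theta_segs[of "[(v+m,v+L),(v+n,v+n+l-1)]" "[(v+m,v+m),(v+n-l,v+n-2),(v+n+l-1,v+n+l-1)]" "v+m" "v+n+l-1" "v+m"])
          (use j a am True l3 k2' n vL m m_def in \<open>auto simp: seg_meet_def\<close>)
    qed
  next
    case False
    \<comment> \<open>As for k = l + 1, inserting z lengthens a path from l + 1 to k arcs.\<close>
    define z where "z = v + m - 1"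
    have x: "long_jump (v + (m - 2))" by (rule mX) (use m in auto)
    have sz: "nbrs z (v + m - 2 - l) (v + m + l - 1)"
      using long_jump_nbrs1[OF x] by (simp add: z_def algebra_simps)
    have adj: "Adj z u" if "v + m - 2 - l \<le> u" "u < z" for u
    proof -
      have "Adj z (u + n)" by (rule nbrsD[OF sz]) (use that False n m in \<open>auto simp: z_def\<close>)
      then show ?thesis by simp
    qed
    have "\<not> A (v + n - 1) (v + m - 1)"
      using back_cycle_out_in[of "v+L" v "v+m" "v+n-l" "v+n-1"] a am k2' n vL m m_def by (auto simp: two_def)
    then have "\<not> A (v - 1) z" using A_periodic(1)[of "v-1" z] by (simp add: z_def algebra_simps)
    then have 1: "A z (v - 1)" using adj[of "v-1"] False m by (simp add: Adj_def z_def)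
    have 2: "A (v + m - 2 - l) z" using long_jump_minus[OF x] by (simp add: long_jump_def z_def algebra_simps)
    obtain u where u: "v + m - 2 - l \<le> u" "u < v - 1" "A u z" "A z (u + 1)"
      using insertion[OF 2 1] adj False m by (auto simp: z_def)
    have u': "A (u + n) (z + n)" "A (z + n) (u + n + 1)"
      using u A_periodic(2)[of z "u+1"] by (auto simp: algebra_simps)
    show False
      by (rule theta_segs[of "[(v+m,v+L),(v+n,v+n)]" "[(v+m,v+m),(v+n-l,u+n),(z+n,z+n),(u+n+1,v+n)]" "v+m" "v+n" "v+m"])
        (use a am False u u' z_def k2' n vL m m_def in \<open>auto simp: seg_meet_def\<close>)
  qed
qed

text \<open>Without a long jump at v - 1 there is none at v - l - 1 by
  \<open>long_jump_plus\<close>. If there is none at v either, v is adjacent to no vertex at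
  distance l + 1 to n - l - 1, and these are N + 1 vertices.\<close>

lemma long_jump_alternative: "long_jump v \<or> long_jump (v - 1)"
proof (rule ccontr)
  assume no: "\<not> ?thesis"
  then have nr: "\<not> long_jump (v - l - 1)" using long_jump_plus[of "v-l-1"] by (auto simp: algebra_simps)
  have "(v + n - l - 1) - (v + l + 1) + 1 \<le> n - k - l"
  proof (rule missing1[of _ _ v])
    fix q assume q: "v + l + 1 \<le> q" "q \<le> v + n - l - 1"
    consider "q = v + l + 1" | "q = v + n - l - 1" | "v + l + 2 \<le> q" "q \<le> v + n - l - 2" using q by linarith
    then have "\<not> Adj v q"
    proof cases
      case 1 then show ?thesis using no long_jump_Adj[of v] by simp
    next
      case 2
      from \<open>q = v + n - l - 1\<close> have "q = (v - l - 1) + n" by simp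
      then have "Adj q v = Adj (v - l - 1) (v - l - 1 + l + 1)" by (simp only: Adj_periodic) simp
      then show ?thesis using nr long_jump_Adj[of "v-l-1"] Adj_sym[of v q] by simp
    next
      case 3
      then show ?thesis using k2_no_long[of v "q-v"] by auto
    qed
    then show "v < q \<and> q < v + n \<and> \<not> Adj v q" using q k2' by auto
  qed
  then show False using k2' by simp
qed

lemma k2_False: False
proof -
  have near: "Adj v (v + d)" if "1 \<le> d" "d \<le> l" for v d
    using long_jump_alternative[of v]
  proof
    assume "long_jump v"
    from long_jump_nbrs[OF this] show ?thesis using that n unfolding nbrs_def by auto
  next
    assume "long_jump (v - 1)"
    from long_jump_nbrs1[OF this] show ?thesis using that n unfolding nbrs_def by auto
  qed
  have l_jump: "A v (v + l)" for v
    using long_jump_alternative[of v]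
  proof
    assume "long_jump v"
    from long_jump_jump0[OF this] show ?thesis using near[of l v] k2' by (auto simp: Adj_def)
  next
    assume "long_jump (v - 1)"
    from long_jump_jump1[OF this] show ?thesis using near[of l v] k2' by (auto simp: Adj_def)
  qed
  have no3: "\<not> A v (v + 3)" for v
  proof
    assume a: "A v (v + 3)"
    show False
      by (rule braid[of l "l-1" "v-2*l+2" "v+3"])
        (use a l_jump[of "v-2*l+2"] l_jump[of "v-l+1"] n k2' in \<open>auto simp: two_def algebra_simps\<close>)
  qed
  have l3: "3 \<le> l"
  proof (rule ccontr)
    assume "\<not> ?thesis"
    then have "l = 2" using k2' by simp
    then show False using long_jump_alternative[of 0, unfolded long_jump_def] no3[of 0] no3[of "-1"] by simp
  qed
  have bk: "A (w + 3) w" for w using near[of 3 w] no3[of w] l3 by (auto simp: Adj_def)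
  obtain j where "l = 4 * int j \<or> l = 4 * int j + 1 \<or> l = 4 * int j + 2 \<or> l = 4 * int j + 3"
  proof -
    have "l = 4 * int (nat (l div 4)) + l mod 4" "0 \<le> l mod 4" "l mod 4 < 4" using l3 by auto
    then show ?thesis using that[of "nat (l div 4)"] by linarith
  qed
  then consider "l = 4 * int j" | "l = 4 * int j + 1" | "l = 4 * int j + 2" | "l = 4 * int j + 3" by blast
  then show False
  proof cases
    case 1
    show False
      by (rule backward_braid[of 3 j l l 0]) (use 1 l3 n k2' bk in \<open>auto simp: two_def\<close>)
  next
    case 2
    show False
      by (rule backward_braid[of 3 j "l-1" "l+2" 0]) (use 2 l3 n k2' bk in \<open>auto simp: two_def\<close>)
  next
    case 3
    show False
      by (rule backward_braid[of 3 "j+1" "l+2" "l+2" 0]) (use 3 l3 n k2' bk in \<open>auto simp: two_def\<close>)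
  next
    case 4
    show False
      by (rule backward_braid[of 3 "j+1" "l+1" "l+1" 0]) (use 4 l3 n k2' bk in \<open>auto simp: two_def\<close>)
  qed
qed

end
end

section \<open>The case \<open>k = l\<close>\<close>

context cyclic
begin

lemma back_cycle_adj_in:
  assumes "A y x" "x < i" "i \<le> y" "y < q" "q < u" "u < x + n" "Adj i q" "A u (i - 1)" "two (y - x) (u - q + 1)"
  shows False
  using back_cycle_out_in[of y x i q u] back_cycle_in_in[of y x i q u] assms
    two_mono[OF assms(9)] by (force simp: Adj_def)

lemma nbrs_not: "nbrs v a b \<Longrightarrow> v < q \<Longrightarrow> q < v + n \<Longrightarrow> b < q \<Longrightarrow> q < a + n \<Longrightarrow> \<not> Adj v q"
  by (auto simp: nbrs_def)

lemma nbrs_back: "nbrs v a b \<Longrightarrow> a \<le> q \<Longrightarrow> q < v \<Longrightarrow> v < q + n \<Longrightarrow> Adj v q"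
  using nbrsD[of v a b "q + n"] by simp

context
  assumes kl: "k = l" and n: "2 * l + 2 \<le> n"
begin

lemma k0': "k \<le> l" "l \<le> k" "3 \<le> l" using kl pos by auto

text \<open>The vertices v + 1 and v + F - 1 next to the ends lose N neighbours each; this forces an
  arc from v + F - 1 to v + F + l - 2 and an arc between v - 1 and v + 1, and either direction of
  the latter gives two long paths. F = n - l is included because \<open>kill\<close> uses F = L +
  1.\<close>

lemma no_min_fwd:
  assumes a: "A v (v + F)" and F: "l + 1 \<le> F" "F \<le> n - l"
    and inside1: "\<And>q. v + l + 2 \<le> q \<Longrightarrow> q \<le> v + F \<Longrightarrow> \<not> Adj (v + 1) q"
    and inside2: "\<And>p. v \<le> p \<Longrightarrow> p \<le> v + F - l - 2 \<Longrightarrow> \<not> Adj p (v + F - 1)"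
  shows False
proof -
  have s1: "nbrs (v + 1) (v + 2 - l) (v + l + 1)"
  proof (rule nbrsI)
    fix q assume q: "v + l + 1 < q" "q < v + 2 - l + n"
    show "\<not> Adj (v + 1) q"
    proof (cases "q \<le> v + F")
      case True
      then show ?thesis using inside1 q by simp
    next
      case False
      then show ?thesis
        by (intro fwd_nonadj[OF a]) (use q F k0' n in \<open>auto simp: two_def\<close>)
    qed
  qed (use k0' n in auto)
  have s2: "nbrs (v + F - 1) (v + F - l - 1) (v + F + l - 2)"
  proof (rule nbrsI)
    fix q assume q: "v + F + l - 2 < q" "q < v + F - l - 1 + n"
    show "\<not> Adj (v + F - 1) q"
    proof (cases "q < v + n")
      case True
      then show ?thesis
        by (intro fwd_nonadj[OF a]) (use q F k0' n in \<open>auto simp: two_def\<close>)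
    next
      case False
      have "\<not> Adj (q - n) (v + F - 1)" by (rule inside2) (use q False in auto)
      then show ?thesis by (simp add: Adj_sym)
    qed
  qed (use k0' n in auto)
  have "Adj (v + F - 1) (v + F + l - 2)" by (rule nbrsD[OF s2]) (use k0' n in auto)
  moreover have "\<not> A (v + F + l - 2) (v + F - 1)"
    by (rule fwd_in[OF a]) (use F k0' n in \<open>auto simp: two_def\<close>)
  ultimately have e: "A (v + F - 1) (v + F + l - 2)" by (simp add: Adj_def)
  have "Adj (v + 1) (v - 1)" by (rule nbrs_back[OF s1]) (use k0' n in auto)
  then consider "A (v - 1) (v + 1)" | "A (v + 1) (v - 1)" by (auto simp: Adj_def)
  then show False
  proof cases
    case 1
    show False
      by (rule theta_segs[of "[(v-1,v-1),(v+1,v+F-1),(v+F+l-2,v+F+l-2)]" "[(v-1,v),(v+F,v+F+l-2)]" "v-1" "v+F+l-2" "v-1"])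
        (use a 1 e F k0' n in \<open>auto simp: seg_meet_def\<close>)
  next
    case 2
    show False
      by (rule theta_segs[of "[(v+1,v+F-1),(v+F+l-2,v+F+l-2)]" "[(v+1,v+1),(v-1,v),(v+F,v+F+l-2)]" "v+1" "v+F+l-2" "v-1"])
        (use a 2 e F k0' n in \<open>auto simp: seg_meet_def\<close>)
  qed
qed

lemma jumps_conflict: "A v (v + l) \<Longrightarrow> \<not> A (v + l - 1) (v + 2 * l - 1)"
proof
  assume "A v (v + l)" "A (v + l - 1) (v + 2 * l - 1)"
  then have "\<not> two (v + l - 1 - v + 1) (v + 2 * l - 1 - (v + l) + 1)"
    by (intro crossing1) (use k0' n in auto)
  then show False using k0' by (auto simp: two_def)
qed

text \<open>Made for the least length L of a backward chord, which itself stays allowed. Forward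
  chords are excluded up to and including L.\<close>

definition "short L \<longleftrightarrow> (\<forall>x d. l + 1 \<le> d \<longrightarrow> d \<le> L \<longrightarrow> \<not> A x (x + d)) \<and>
   (\<forall>x d. l + 1 \<le> d \<longrightarrow> d \<le> L - 1 \<longrightarrow> \<not> A (x + d) x)"

lemma short_fwd: "short L \<Longrightarrow> l + 1 \<le> y - x \<Longrightarrow> y - x \<le> L \<Longrightarrow> \<not> A x y"
  unfolding short_def by (metis add_diff_cancel_left' diff_add_cancel add.commute)
lemma short_bwd: "short L \<Longrightarrow> l + 1 \<le> y - x \<Longrightarrow> y - x \<le> L - 1 \<Longrightarrow> \<not> A y x"
  unfolding short_def by (metis add_diff_cancel_left' diff_add_cancel add.commute)
lemma short_Adj: "short L \<Longrightarrow> l + 1 \<le> y - x \<Longrightarrow> y - x \<le> L - 1 \<Longrightarrow> \<not> Adj x y"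
  using short_fwd[of L y x] short_bwd[of L y x] by (auto simp: Adj_def)

text \<open>The backward chord alone leaves open one incoming arc. It would be a forward chord of
  length exactly L, which \<open>short\<close> excludes. In \<open>nbrs_l\<close> the same happens
  with an outgoing arc.\<close>

lemma nbrs_a:
  assumes s: "short L" and L: "l + 1 \<le> L" "L \<le> n - l - 1" and a: "A (w + L) w"
  shows "nbrs (w + L - l + 1) (w + L - 2 * l + 1) (w + L)"
proof (rule nbrsI)
  fix q assume q: "w + L < q" "q < w + L - 2 * l + 1 + n"
  consider "q \<le> w + n - l" | "q = w + n - l + 1" | "w + n - l + 1 < q" by linarith
  then show "\<not> Adj (w + L - l + 1) q"
  proof cases
    case 1
    then show ?thesis
      by (intro bwd_nonadj[OF a]) (use q L k0' n in \<open>auto simp: two_def\<close>)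
  next
    case 2
    have "\<not> A (w + L - l + 1) q"
      by (rule bwd_out[OF a]) (use 2 q L k0' n in \<open>auto simp: two_def\<close>)
    moreover have "\<not> A (q - n) (w + L - l + 1)" by (rule short_fwd[OF s]) (use 2 L in auto)
    ultimately show ?thesis by (simp add: Adj_def)
  next
    case 3
    have "\<not> Adj (q - n) (w + L - l + 1)" by (rule short_Adj[OF s]) (use 3 q in auto)
    then show ?thesis by (simp add: Adj_sym)
  qed
qed (use k0' n L in auto)

lemma nbrs_l:
  assumes s: "short L" and L: "l + 1 \<le> L" "L \<le> n - l - 1" and a: "A (w + L) w"
  shows "nbrs (w + l - 1) w (w + 2 * l - 1)"
proof (rule nbrsI)
  fix q assume q: "w + 2 * l - 1 < q" "q < w + n"
  consider "q \<le> w + L + l - 2" | "q = w + L + l - 1" | "w + L + l \<le> q" by linarith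
  then show "\<not> Adj (w + l - 1) q"
  proof cases
    case 1
    then show ?thesis using short_Adj[OF s] q by simp
  next
    case 2
    have "\<not> A q (w + l - 1)"
      by (rule bwd_in[OF a]) (use 2 q L k0' n in \<open>auto simp: two_def\<close>)
    moreover have "\<not> A (w + l - 1) q" by (rule short_fwd[OF s]) (use 2 L in auto)
    ultimately show ?thesis by (simp add: Adj_def)
  next
    case 3
    then show ?thesis
      by (intro bwd_nonadj[OF a]) (use q L k0' n in \<open>auto simp: two_def\<close>)
  qed
qed (use k0' n L in auto)

text \<open>The vertex \<open>w + m + 1\<close> has an arc to \<open>w + 1 - l\<close>. One path to \<open>w - 1\<close> continues there and
  picks up \<open>w + m\<close> on its way, the other one uses the chord from \<open>w + L\<close> to \<open>w\<close> and the arc from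
  \<open>w + 1\<close> to \<open>w - 1\<close>.\<close>

lemma kill:
  assumes s: "short L" and L: "l + 1 \<le> L" "L \<le> n - l - 1" and a: "A (w + L) w" and m: "m = L - l + 1" "m \<le> l - 2"
    and sp: "\<And>i. 1 \<le> i \<Longrightarrow> i \<le> m \<Longrightarrow> nbrs (w + i) (w + i - l) (w + i + l - 1)"
    and f: "A (w + m - l) (w + m)"
    and b: "\<not> A (w + m + 1) (w + 2 - l)"
  shows False
proof -
  have adj: "Adj (w + j) (w - 1)" if "1 \<le> j" "j \<le> m" for j
    by (rule nbrs_back[OF sp]) (use that m n k0' in auto)
  then have adj': "Adj (w + j) (w + n - 1)" if "1 \<le> j" "j \<le> m" for j
    using adj[OF that] Adj_periodic(2)[of "w+j" "w-1"] by (simp add: algebra_simps)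
  have non: "\<not> Adj (w + m + 1) q" if q: "w + L + 1 \<le> q" "q \<le> w + n + m - l" "q \<noteq> w + n + 1 - l" for q
  proof (cases "q \<le> w + n - l")
    case True
    have "\<not> A q (w + m + 1)"
      by (rule bwd_in[OF a]) (use True q L m k0' n in \<open>auto simp: two_def\<close>)
    moreover have "\<not> A (w + m + 1) q"
    proof
      assume b: "A (w + m + 1) q"
      have "1 \<le> m" using m L by simp
      then have c: "Adj (w + m + 1 - 1) (w + n - 1)" using adj'[of m] by (simp only: add_diff_cancel_right')
      show False
        by (rule back_cycle_out_adj[OF a _ _ _ _ _ b c]) (use True q L m k0' n in \<open>auto simp: two_def\<close>)
    qed
    ultimately show ?thesis by (simp add: Adj_def)
  next
    case False
    have "\<not> A (q - n) (w + m + 1)" by (rule short_fwd[OF s]) (use q False m in auto)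
    moreover have "\<not> A (w + m + 1) (q - n)"
    proof (cases "q = w + n + 2 - l")
      case True
      then have "q - n = w + 2 - l" by simp
      then show ?thesis using b by simp
    next
      case F: False
      show ?thesis by (rule short_bwd[OF s]) (use q False F m in auto)
    qed
    ultimately show ?thesis by (simp add: Adj_def)
  qed
  \<comment> \<open>There are N + 1 vertices from w + L + 1 to w + n + m - l, and this is the only
    one not excluded.\<close>
  have "Adj (w + m + 1) (w + n + 1 - l)"
  proof (rule ccontr)
    assume "\<not> ?thesis"
    then have "(w + n + m - l) - (w + L + 1) + 1 \<le> n - k - l"
      by (intro missing1[of _ _ "w+m+1"]) (use non k0' n m L in force)+
    then show False using k0' m by simp
  qed
  moreover have "\<not> A (w + n + 1 - l) (w + m + 1)"
  proof
    assume "A (w + n + 1 - l) (w + m + 1)"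
    moreover have "w + n + 1 - l = w + 1 - l + n" "w + m + 1 = w + 1 - l + (L + 1)" using m by simp_all
    ultimately have c: "A (w + 1 - l) (w + 1 - l + (L + 1))" by (simp only: A_periodic)
    show False
    proof (rule no_min_fwd[OF c])
      fix q assume q: "w + 1 - l + l + 2 \<le> q" "q \<le> w + 1 - l + (L + 1)"
      show "\<not> Adj (w + 1 - l + 1) q"
      proof (cases "q = w + m + 1")
        case True
        have "w + 1 - l + 1 = w + 2 - l" by simp
        moreover have "\<not> A (w + 2 - l) q" by (rule short_fwd[OF s]) (use True m L in auto)
        moreover have "\<not> A q (w + 2 - l)" using b True by simp
        ultimately show ?thesis by (simp only: Adj_def simp_thms)
      next
        case False
        then show ?thesis by (intro short_Adj[OF s]) (use q m in auto)
      qed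
    next
      fix p assume p: "w + 1 - l \<le> p" "p \<le> w + 1 - l + (L + 1) - l - 2"
      have "\<not> Adj (w + m) (p + n)" by (rule nbrs_not[OF sp]) (use p m L n k0' in auto)
      moreover have "w + 1 - l + (L + 1) - 1 = w + m" using m by simp
      ultimately show "\<not> Adj p (w + 1 - l + (L + 1) - 1)" by (simp only: Adj_sym[of p] Adj_periodic simp_thms)
    qed (use L in auto)
  qed
  ultimately have bo: "A (w + m + 1) (w + n + 1 - l)" by (simp add: Adj_def)
  have out: "A (w + j + n) (w + n - 1)" if j: "1 \<le> j" "j \<le> m" for j
  proof -
    have "\<not> A (w + n - 1) (w + n + j)"
    proof
      assume c: "A (w + n - 1) (w + n + j)"
      show False
        by (rule theta_segs[of "[(w+m+1,w+L),(w+n,w+n+j)]" "[(w+m+1,w+m+1),(w+n+1-l,w+n-1),(w+n+j,w+n+j)]" "w+m+1" "w+n+j" "w+m+1"])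
          (use a bo c j m L k0' n in \<open>auto simp: seg_meet_def\<close>)
    qed
    then have "\<not> A (w + n - 1) (w + j)" using A_periodic(2)[of "w+n-1" "w+j"] by (simp add: algebra_simps)
    then show ?thesis using adj'[OF j] by (simp add: Adj_def)
  qed
  have o1: "A (w + m) (w - 1)"
  proof -
    have "A (w + m + n) (w + n - 1)" by (rule out) (use m L in auto)
    moreover have "w + n - 1 = w - 1 + n" by simp
    ultimately show ?thesis by (simp only: A_periodic)
  qed
  obtain u where u: "w + m - l \<le> u" "u < w - 1" "A u (w + m)" "A (w + m) (u + 1)"
  proof -
    have "Adj (w + m) u" if "w + m - l < u" "u < w - 1" for u
      by (rule nbrs_back[OF sp]) (use that m n k0' L in auto)
    then show ?thesis using insertion[OF f o1] that m by auto
  qed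
  have u': "A (u + n) (w + m + n)" "A (w + m + n) (u + n + 1)"
  proof -
    show "A (u + n) (w + m + n)" using u by (simp only: A_periodic)
    have "u + n + 1 = u + 1 + n" by simp
    then show "A (w + m + n) (u + n + 1)" using u by (simp only: A_periodic)
  qed
  \<comment> \<open>The first path has l + 1 arcs; the second one reaches l arcs only thanks to the
    inserted vertex w + m.\<close>
  show False
    by (rule theta_segs[of "[(w+m+1,w+L),(w+n,w+1+n),(w+n-1,w+n-1)]"
        "[(w+m+1,w+m+1),(w+n+1-l,u+n),(w+m+n,w+m+n),(u+n+1,w+n-1)]" "w+m+1" "w+n-1" "w+m+1"])
      (use a bo u u' out[of 1] m L k0' n in \<open>auto simp: seg_meet_def\<close>)
qed

text \<open>A forward chord of length d is a backward one of length n - d, so every vertex has N - 1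
  non-neighbours at distance l + 1 to n - l - 1, and at least one of its two jumps of length l
  exists and is forward. By \<open>jumps_conflict\<close> a forward jump at v forces one at v - 1,
  and going round the cycle two of them conflict.\<close>

lemma k0_none:
  assumes no: "\<And>x d. l \<le> d \<Longrightarrow> d \<le> n - l - 1 \<Longrightarrow> \<not> A (x + d) x"
  shows False
proof -
  have 1: "\<not> Adj v q" if "v + l + 1 \<le> q" "q \<le> v + n - l - 1" for v q
  proof -
    have "\<not> A q v" using no[of "q - v" v] that by simp
    moreover have "\<not> A (v + n) q" using no[of "v + n - q" q] that by simp
    ultimately show ?thesis by (simp add: Adj_def)
  qed
  have 2: "A v (v + l) \<or> A (v - l) v" for v
  proof (rule ccontr)
    assume c: "\<not> ?thesis"
    then have c: "\<not> Adj v (v + l)" "\<not> Adj (v - l) v"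
      using no[of l v] no[of l "v - l"] n by (auto simp: Adj_def)
    have "\<not> Adj v (v - l + n)" using c by (simp add: Adj_sym)
    then have "\<not> Adj v q" if "v + l \<le> q" "q \<le> v - l + n" for q
      using 1[of v q] c that by (cases "q = v + l"; cases "q = v - l + n") auto
    then have "(v - l + n) - (v + l) + 1 \<le> n - k - l"
      by (intro missing1[of _ _ v]) (use k0' n in auto)
    then show False using k0' by simp
  qed
  obtain v where v: "A v (v + l)" using 2[of 0] by (metis diff_add_cancel add.commute diff_0)
  have "A (v - int m) (v - int m + l)" for m :: nat
  proof (induction m)
    case (Suc m)
    from jumps_conflict[OF Suc] have "\<not> A (v - int m + l - 1) (v - int m + l - 1 + l)" by (simp add: algebra_simps)
    then have "A (v - int m + l - 1 - l) (v - int m + l - 1)" using 2 by blast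
    then show ?case by (simp add: algebra_simps)
  qed (use v in simp)
  from this[of "nat (n - l + 1)"] have "A (v + l - 1 - n) (v + l - 1 - n + l)" using n k0' by (simp add: algebra_simps)
  then have "A (v + l - 1) (v + 2 * l - 1 - n)" using A_periodic(3)[of "v+l-1"] by (simp add: algebra_simps)
  then have "A (v + l - 1) (v + 2 * l - 1)" by simp
  then show False using jumps_conflict[OF v] by simp
qed

text \<open>The backward jump closes a cycle, so the lemmas on two consecutive vertices of such a
  cycle carry the restrictions from w + 1 over to w + 2, and from w + l - 1 over to w + l -
  2.\<close>

lemma back_l_nbrss:
  assumes a: "A (w + l) w" and s: "short (l + 1)"
  shows "nbrs (w + 2) (w + 1 - l) (w + l)" "A (w + 2) (w + 1 - l)"
    "nbrs (w + l - 1) w (w + 2 * l - 1)" "nbrs (w + l - 2) w (w + 2 * l - 1)"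
proof -
  have s1: "nbrs (w + 1) (w + 1 - l) (w + l)"
  proof (rule nbrsI)
    fix q assume q: "w + l < q" "q < w + 1 - l + n"
    show "\<not> Adj (w + 1) q"
      by (rule bwd_nonadj[OF a]) (use q k0' n in \<open>auto simp: two_def\<close>)
  qed (use k0' n in auto)
  have "Adj (w + 1) (w - 1)" by (rule nbrs_back[OF s1]) (use k0' n in auto)
  then have 1: "Adj (w + 1) (w + n - 1)" using Adj_periodic(2)[of "w+1" "w-1"] by (simp add: algebra_simps)
  show s2: "nbrs (w + 2) (w + 1 - l) (w + l)"
  proof (rule nbrsI)
    fix q assume q: "w + l < q" "q < w + 1 - l + n"
    have "\<not> A q (w + 2)"
      by (rule bwd_in[OF a]) (use q k0' n in \<open>auto simp: two_def\<close>)
    moreover have "\<not> A (w + 2) q"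
    proof
      assume b: "A (w + 2) q"
      have c: "Adj (w + 2 - 1) (w + n - 1)" using 1 by (simp add: algebra_simps)
      show False
        by (rule back_cycle_out_adj[OF a _ _ _ _ _ b c]) (use q k0' n in \<open>auto simp: two_def\<close>)
    qed
    ultimately show "\<not> Adj (w + 2) q" by (simp add: Adj_def)
  qed (use k0' n in auto)
  have "Adj (w + 2) (w + 1 - l)" by (rule nbrs_back[OF s2]) (use k0' n in auto)
  moreover have "\<not> A (w + 1 - l) (w + 2)" by (rule short_fwd[OF s]) auto
  ultimately show "A (w + 2) (w + 1 - l)" by (simp add: Adj_def)
  show s3: "nbrs (w + l - 1) w (w + 2 * l - 1)"
  proof (rule nbrsI)
    fix q assume q: "w + 2 * l - 1 < q" "q < w + n"
    show "\<not> Adj (w + l - 1) q"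
      by (rule bwd_nonadj[OF a]) (use q k0' n in \<open>auto simp: two_def\<close>)
  qed (use k0' n in auto)
  have 3: "Adj (w + l - 1) (w + l + 1)" by (rule nbrsD[OF s3]) (use k0' n in auto)
  show "nbrs (w + l - 2) w (w + 2 * l - 1)"
  proof (rule nbrsI)
    fix q assume q: "w + 2 * l - 1 < q" "q < w + n"
    have "\<not> A (w + l - 2) q"
      by (rule bwd_out[OF a]) (use q k0' n in \<open>auto simp: two_def\<close>)
    moreover have "\<not> A q (w + l - 2)"
    proof
      assume "A q (w + l - 2)"
      then have c: "A q (w + l - 1 - 1)" by simp
      show False
        by (rule back_cycle_adj_in[OF a _ _ _ _ _ 3 c]) (use q k0' n in \<open>auto simp: two_def\<close>)
    qed
    ultimately show "\<not> Adj (w + l - 2) q" by (simp add: Adj_def)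
  qed (use k0' n in auto)
qed

lemma short_l1: "short (l + 1)"
proof -
  have "\<not> A x (x + (l + 1))" for x
  proof
    assume "A x (x + (l + 1))"
    then show False by (rule no_min_fwd) (use k0' n in auto)
  qed
  moreover have "d = l + 1" if "l + 1 \<le> d" "d \<le> l + 1" for d using that by simp
  ultimately show ?thesis unfolding short_def by auto
qed

text \<open>If it fails, the arc between s + 2 - l and s + 2 is forward, and \<open>kill\<close>
  applies with L = l + 1 and m = 2; this needs l >= 4, so l = 3 is excluded beforehand.\<close>

lemma back_l1_back_l:
  assumes a: "A (s + l + 1) s"
  shows "A (s + 2) (s + 2 - l)"
proof (rule ccontr)
  assume no: "\<not> ?thesis"
  note sh = short_l1
  have a': "A (s + (l + 1)) s" using a by (simp add: add.assoc)
  have sa: "nbrs (s + 2) (s + 2 - l) (s + l + 1)"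
    using nbrs_a[OF sh _ _ a'] n by (simp add: algebra_simps)
  have sl: "nbrs (s + l - 1) s (s + 2 * l - 1)"
    using nbrs_l[OF sh _ _ a'] n by simp
  have l4: "4 \<le> l"
  proof (rule ccontr)
    assume "\<not> ?thesis"
    then have l: "l = 3" using k0' by simp
    have "Adj (s + l - 1) (s + 5)" by (rule nbrsD[OF sl]) (use l n in auto)
    moreover have "s + l - 1 = s + 2" using l by simp
    ultimately have "Adj (s + 2) (s + 5)" by simp
    moreover have "\<not> Adj (s + 2) (s + 5)" by (rule nbrs_not[OF sa]) (use l n in auto)
    ultimately show False by simp
  qed
  have "Adj (s + 2) (s + 2 - l)" by (rule nbrs_back[OF sa]) (use k0' n in auto)
  then have f: "A (s + 2 - l) (s + 2)" using no by (simp add: Adj_def)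
  have "\<not> A (s + 1) (s + l + 1)" using jumps_conflict[of "s + 2 - l"] f by (simp add: algebra_simps)
  moreover have "\<not> A (s + l + 1) (s + 1)"
  proof
    assume "A (s + l + 1) (s + 1)"
    then have "A (s + 1 + l) (s + 1)" by (simp add: algebra_simps)
    from back_l_nbrss(4)[OF this sh] have sp: "nbrs (s + l - 1) (s + 1) (s + 2 * l)" by (simp add: algebra_simps)
    have "Adj (s + l - 1) (s + 2 * l)" by (rule nbrsD[OF sp]) (use k0' n in auto)
    moreover have "\<not> Adj (s + l - 1) (s + 2 * l)" by (rule nbrs_not[OF sl]) (use k0' n in auto)
    ultimately show False by simp
  qed
  ultimately have m: "\<not> Adj (s + 1) (s + l + 1)" by (simp add: Adj_def)
  have s1: "nbrs (s + 1) (s + 1 - l) (s + l)"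
  proof (rule nbrsI)
    fix q assume q: "s + l < q" "q < s + 1 - l + n"
    show "\<not> Adj (s + 1) q"
    proof (cases "q = s + l + 1")
      case False
      then show ?thesis
        by (intro bwd_nonadj[OF a]) (use q k0' n in \<open>auto simp: two_def\<close>)
    qed (use m in simp)
  qed (use k0' n in auto)
  show False
  proof (rule kill[OF sh _ _ a'])
    fix i :: int assume "1 \<le> i" "i \<le> 2"
    then have "i = 1 \<or> i = 2" by linarith
    then show "nbrs (s + i) (s + i - l) (s + i + l - 1)" using s1 sa by (auto simp: algebra_simps)
  next
    show "\<not> A (s + 2 + 1) (s + 2 - l)"
    proof
      assume "A (s + 2 + 1) (s + 2 - l)"
      then have b: "A (s + 2 - l + (l + 1)) (s + 2 - l)" by (simp add: algebra_simps)
      have sp: "nbrs (s + 1) (s + 2 - l) (s + l + 1)" using nbrs_l[OF sh _ _ b] n by (simp add: algebra_simps)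
      have "Adj (s + 1) (s + l + 1)" by (rule nbrsD[OF sp]) (use k0' n in auto)
      then show False using m by simp
    qed
  qed (use l4 n f in \<open>auto simp: algebra_simps\<close>)
qed

text \<open>Such a jump yields a backward jump of length l + 1, and this one again a backward jump
  of length l, from w + 3 - l. The first and the last jump together give w + 3 at least N + 1
  non-neighbours.\<close>

lemma no_back_l: "\<not> A (w + l) w"
proof
  assume a: "A (w + l) w"
  note b = back_l_nbrss[OF a short_l1]
  have "A (w + 1 - l + l + 1) (w + 1 - l)" using b(2) by (simp add: algebra_simps)
  from back_l1_back_l[OF this] have c: "A (w + 3 - 2 * l + l) (w + 3 - 2 * l)" by (simp add: algebra_simps)
  note d = back_l_nbrss(3,4)[OF c short_l1]
  have "Adj (w + 2) (w - 1)" by (rule nbrs_back[OF b(1)]) (use k0' n in auto)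
  then have 2: "Adj (w + 2) (w + n - 1)" using Adj_periodic(2)[of "w+2" "w-1"] by (simp add: algebra_simps)
  have 3: "\<not> Adj (w + 3) q" if "w + l + 1 \<le> q" "q \<le> w + n - l - 1" for q
  proof
    assume b: "Adj (w + 3) q"
    have c: "Adj (w + 3 - 1) (w + n - 1)" using 2 by (simp add: algebra_simps)
    show False
      by (rule back_cycle_adj_adj[OF a _ _ _ _ _ b c]) (use that k0' n in \<open>auto simp: two_def\<close>)
  qed
  have "\<not> Adj (w + 2 - l) (w + 3)" by (rule nbrs_not[of _ "w+3-2*l" "w+2"]) (use d k0' n in \<open>auto simp: algebra_simps\<close>)
  moreover have "\<not> Adj (w + 1 - l) (w + 3)" by (rule nbrs_not[of _ "w+3-2*l" "w+2"]) (use d k0' n in \<open>auto simp: algebra_simps\<close>)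
  moreover have "q - n = w + 2 - l \<or> q - n = w + 1 - l" if "w + 1 - l + n \<le> q" "q \<le> w + 2 - l + n" for q using that by linarith
  moreover have "Adj (w + 3) q = Adj (q - n) (w + 3)" for q by (simp add: Adj_sym)
  ultimately have "\<not> Adj (w + 3) q" if "w + 1 - l + n \<le> q" "q \<le> w + 2 - l + n" for q using that by metis
  then have "((w + n - l - 1) - (w + l + 1) + 1) + ((w + 2 - l + n) - (w + 1 - l + n) + 1) \<le> n - k - l"
  proof (intro missing2[of _ _ "w+3"])
    fix x assume "w + l + 1 \<le> x" "x \<le> w + n - l - 1"
    moreover have "\<not> (l = 3 \<and> x = w + 3)" using calculation by auto
    ultimately show "w + 3 < x \<and> x < w + 3 + n \<and> \<not> Adj (w + 3) x" using 3 k0' by auto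
  qed (use k0' n in auto)
  then show False using k0' by simp
qed

lemma k0_False: False
proof -
  obtain x d where xd: "l \<le> d" "d \<le> n - l - 1" "A (x + d) x"
    using k0_none by metis
  let ?P = "\<lambda>m::nat. l \<le> int m \<and> int m \<le> n - l - 1 \<and> (\<exists>x. A (x + int m) x)"
  have "?P (nat d)" using xd k0' by auto
  then obtain m where m: "?P m" and least: "\<And>m'. ?P m' \<Longrightarrow> m \<le> m'"
    using exists_least_iff[of ?P] by (metis not_le)
  define L where "L = int m"
  obtain w where a: "A (w + L) w" and L': "l \<le> L" "L \<le> n - l - 1" using m by (auto simp: L_def)
  have min: "L \<le> d" if "A (x + d) x" "l \<le> d" "d \<le> n - l - 1" for x d
  proof -
    have "?P (nat d)" using that k0' by (auto intro: exI[of _ x])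
    from least[OF this] show ?thesis using that k0' by (simp add: L_def)
  qed
  have L: "l + 1 \<le> L"
    using no_back_l[of w] a L' by (cases "L = l") auto
  have s: "short L"
  proof -
    have fw: "\<not> A x (x + d)" if "l + 1 \<le> d" "d \<le> L" for x d
      using that
    proof (induction "nat d" arbitrary: x d rule: less_induct)
      case less
      have adj: "\<not> Adj y z" if "l + 1 \<le> z - y" "z - y < d" for y z
        using less(1)[of "z - y" y] min[of y "z - y"] that less.prems L' k0' by (auto simp: Adj_def)
      show ?case
      proof
        assume "A x (x + d)"
        then show False by (rule no_min_fwd) (use adj less.prems L' in auto)
      qed
    qed
    then show ?thesis unfolding short_def using min L' by force
  qed
  define mm where "mm = L - l + 1"
  have sa: "nbrs (w + mm) (w + mm - l) (w + L)" if "A (w + L) w" for w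
    using nbrs_a[OF s L L'(2) that] by (simp add: mm_def algebra_simps)
  note sl = nbrs_l[OF s L L'(2)]
  have fwd_l: "A (v - l) v" if "Adj v (v - l)" for v
    using that no_back_l[of "v - l"] by (auto simp: Adj_def)
  \<comment> \<open>Descending induction from i = \<open>mm\<close>, where \<open>nbrs_a\<close>
    applies: the forward jump of length l into w + i + 1 conflicts with a forward jump out of w + i,
    so w + i + l is excluded as well.\<close>
  have sp: "1 \<le> i \<longrightarrow> i \<le> mm \<longrightarrow> nbrs (w + i) (w + i - l) (w + i + l - 1) \<and> A (w + i - l) (w + i)" for i
  proof (induction "nat (mm - i)" arbitrary: i rule: less_induct)
    case less
    show ?case
    proof (intro impI)
      assume i: "1 \<le> i" "i \<le> mm"
      have sp: "nbrs (w + i) (w + i - l) (w + i + l - 1)"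
      proof (cases "i = mm")
        case True
        have "w + mm + l - 1 = w + L" by (simp add: mm_def)
        then show ?thesis using sa[OF a] True by (simp only:)
      next
        case False
        then have "A (w + (i + 1) - l) (w + (i + 1))" using less[of "i+1"] i by simp
        then have "\<not> A (w + i) (w + i + l)" using jumps_conflict[of "w + i + 1 - l"] by (simp add: algebra_simps)
        then have 0: "\<not> Adj (w + i) (w + i + l)" using no_back_l[of "w+i"] by (simp add: Adj_def)
        show ?thesis
        proof (rule nbrsI)
          fix q assume q: "w + i + l - 1 < q" "q < w + i - l + n"
          consider "q = w + i + l" | "w + i + l < q" "q \<le> w + L" | "w + L < q" "q \<le> w + n - l" | "w + n - l < q"
            using q by linarith
          then show "\<not> Adj (w + i) q"
          proof cases
            case 2
            then show ?thesis by (intro short_Adj[OF s]) (use i in auto)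
          next
            case 3
            then show ?thesis
              by (intro bwd_nonadj[OF a]) (use q i False mm_def k0' n L L' in \<open>auto simp: two_def\<close>)
          next
            case 4
            have "\<not> Adj (q - n) (w + i)" by (rule short_Adj[OF s]) (use q 4 i False mm_def in auto)
            then show ?thesis by (simp add: Adj_sym)
          qed (use 0 in simp)
        qed (use k0' n in auto)
      qed
      have "Adj (w + i) (w + i - l)" by (rule nbrs_back[OF sp]) (use k0' n in auto)
      then show "nbrs (w + i) (w + i - l) (w + i + l - 1) \<and> A (w + i - l) (w + i)" using sp fwd_l by blast
    qed
  qed
  have ml: "mm \<le> l - 2"
  proof (rule ccontr)
    assume "\<not> ?thesis"
    then have sp': "nbrs (w + (l - 1)) (w + (l - 1) - l) (w + (l - 1) + l - 1)" using sp[of "l - 1"] k0' by auto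
    have "\<not> Adj (w + (l - 1)) (w + 2 * l - 1)" by (rule nbrs_not[OF sp']) (use k0' n in auto)
    moreover have "Adj (w + l - 1) (w + 2 * l - 1)" by (rule nbrsD[OF sl[OF a]]) (use k0' n in auto)
    ultimately show False by (simp add: algebra_simps)
  qed
  show False
  proof (rule kill[OF s L L'(2) a mm_def ml])
    show "\<not> A (w + mm + 1) (w + 2 - l)"
    proof
      assume "A (w + mm + 1) (w + 2 - l)"
      then have b: "A (w + 2 - l + L) (w + 2 - l)" by (simp add: mm_def algebra_simps)
      have sp': "nbrs (w + 1) (w + 2 - l) (w + l + 1)" using sl[OF b] by (simp add: algebra_simps)
      have "Adj (w + 1) (w + l + 1)" by (rule nbrsD[OF sp']) (use k0' n in auto)
      moreover have "\<not> Adj (w + 1) (w + l + 1)"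
        by (rule nbrs_not[of _ "w+1-l" "w+1+l-1"]) (use sp[of 1] L mm_def k0' n in auto)
      ultimately show False by simp
    qed
  next
    show "A (w + mm - l) (w + mm)" using sp[of mm] L mm_def by simp
  qed (use sp in auto)
qed

end
end

section \<open>At most \<open>k + l + 1\<close> vertices\<close>

lemma cyclic_of_list:
  assumes xs: "distinct xs" "int (length xs) = n" "successively E xs" "E (last xs) (hd xs)"
    and free: "\<not> theta E k l" and pos: "1 \<le> k" "1 \<le> l" "k + l \<le> n" "6 \<le> k + l"
    and deg: "\<And>v. v \<in> set xs \<Longrightarrow> card {w \<in> set xs. w \<noteq> v \<and> \<not> (E v w \<or> E w v)} \<le> nat (n - k - l)"
  shows "cyclic E (\<lambda>i. xs ! nat (i mod n)) n k l"
proof -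
  let ?c = "\<lambda>i. xs ! nat (i mod n)"
  have n: "0 < n" using pos by simp
  have len: "nat (i mod n) < length xs" for i
    using pos_mod_bound[OF n, of i] pos_mod_sign[OF n, of i] xs(2) by linarith
  have inj: "n dvd (i - j)" if "?c i = ?c j" for i j
  proof -
    have "nat (i mod n) = nat (j mod n)" using that nth_eq_iff_index_eq[OF xs(1) len len] by simp
    then have "i mod n = j mod n" using pos_mod_sign[OF n] by (metis int_nat_eq)
    then show ?thesis by (simp add: mod_eq_dvd_iff)
  qed
  show ?thesis
  proof
    fix i j
    show "?c (i + n) = ?c i" by simp
    show "n dvd i - j" if "?c i = ?c j" using inj that .
    show "E (?c i) (?c (i + 1))"
    proof (cases "i mod n + 1 < n")
      case True
      then have "(i + 1) mod n = i mod n + 1"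
        using pos_mod_sign[OF n, of i] by (metis mod_add_left_eq mod_pos_pos_trivial add_nonneg_nonneg zero_le_one)
      then have "nat ((i + 1) mod n) = Suc (nat (i mod n))" using pos_mod_sign[OF n, of i] by simp
      then show ?thesis using xs(3) len[of "i+1"] by (simp add: successively_conv_nth)
    next
      case False
      then have m: "i mod n = n - 1" using pos_mod_bound[OF n, of i] by simp
      then have "(i + 1) mod n = 0" by (metis add_diff_cancel_right' diff_add_cancel mod_add_left_eq mod_self)
      moreover have "xs \<noteq> []" using xs(2) n by auto
      moreover have "nat (n - 1) = length xs - 1" using xs(2) by simp
      ultimately show ?thesis using xs(4) m by (simp add: last_conv_nth hd_conv_nth)
    qed
    let ?S = "{x. i < x \<and> x < i + n \<and> \<not> (E (?c i) (?c x) \<or> E (?c x) (?c i))}"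
    let ?T = "{w \<in> set xs. w \<noteq> ?c i \<and> \<not> (E (?c i) w \<or> E w (?c i))}"
    have small: "x = y" if "n dvd (x - y)" "\<bar>x - y\<bar> < n" for x y :: int
      using zdvd_imp_le[of n "\<bar>x - y\<bar>"] that by (cases "x = y") auto
    have "card ?S \<le> card ?T"
    proof (rule card_inj_on_le[where f = ?c])
      show "inj_on ?c ?S"
      proof (rule inj_onI)
        fix x y assume xy: "x \<in> ?S" "y \<in> ?S" "?c x = ?c y"
        then show "x = y" using small[OF inj[OF xy(3)]] by auto
      qed
      show "?c ` ?S \<subseteq> ?T"
      proof
        fix w assume "w \<in> ?c ` ?S"
        then obtain x where x: "x \<in> ?S" "w = ?c x" by blast
        have "?c x \<noteq> ?c i" using small[OF inj[of x i]] x by auto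
        then show "w \<in> ?T" using x len[of x] by auto
      qed
    qed simp
    also have "\<dots> \<le> nat (n - k - l)" using deg[of "?c i"] len[of i] by simp
    finally show "card ?S \<le> nat (n - k - l)" .
  qed (use free pos in auto)
qed

context cyclic
begin

lemma n_pos: "0 < n" using pos by simp

lemma c_add_mult: "c (i + n * int m) = c i"
proof (induction m)
  case (Suc m)
  have "c (i + n * int (Suc m)) = c (i + n * int m + n)" by (simp add: algebra_simps)
  also have "\<dots> = c (i + n * int m)" by (rule periodic)
  finally show ?case using Suc.IH by simp
qed simp

lemma c_cong: "n dvd (x - y) \<Longrightarrow> c x = c y"
proof -
  assume "n dvd (x - y)"
  then obtain t where t: "x - y = n * t" by (auto elim: dvdE)
  show ?thesis
  proof (cases "0 \<le> t")
    case True
    then have "x = y + n * int (nat t)" using t by simp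
    then show ?thesis using c_add_mult[of y "nat t"] by simp
  next
    case False
    then have "y = x + n * int (nat (- t))" using t by (simp add: algebra_simps)
    then show ?thesis using c_add_mult[of x "nat (- t)"] by simp
  qed
qed

lemma c_window: "\<exists>x. w \<le> x \<and> x < w + n \<and> c x = c y"
proof (intro exI[of _ "w + (y - w) mod n"] conjI)
  have "n dvd (w + (y - w) mod n) - y"
    by (metis (no_types, opaque_lifting) add_diff_cancel_left' diff_diff_eq2 dvd_minus_mod dvd_minus_iff minus_diff_eq add.commute)
  then show "c (w + (y - w) mod n) = c y" by (rule c_cong)
qed (use n_pos in \<open>auto\<close>)

lemma range_c: "range c = c ` {w..<w + n}"
proof
  show "range c \<subseteq> c ` {w..<w + n}"
  proof
    fix z assume "z \<in> range c"
    then obtain y where "z = c y" by blast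
    then show "z \<in> c ` {w..<w + n}" using c_window[of w y] by (metis imageI atLeastLessThan_iff)
  qed
qed auto

lemma card_range: "int (card (range c)) = n"
  using card_image[OF inj_window[of 0]] n_pos by (simp add: range_c[of 0])

lemma range_degree:
  assumes "v \<in> range c"
  shows "card {w \<in> range c. w \<noteq> v \<and> \<not> (E v w \<or> E w v)} \<le> nat (n - k - l)"
proof -
  obtain i where i: "v = c i" using assms by blast
  let ?S = "{x. i < x \<and> x < i + n \<and> \<not> (E (c i) (c x) \<or> E (c x) (c i))}"
  have "{w \<in> range c. w \<noteq> v \<and> \<not> (E v w \<or> E w v)} \<subseteq> c ` ?S"
  proof
    fix w assume w: "w \<in> {w \<in> range c. w \<noteq> v \<and> \<not> (E v w \<or> E w v)}"
    then obtain x where x: "i \<le> x" "x < i + n" "c x = w" using c_window[of i] by blast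
    then have "x \<noteq> i" using w i by auto
    then show "w \<in> c ` ?S" using x w i by (intro image_eqI[of _ _ x]) auto
  qed
  moreover have fin: "finite ?S" by (rule finite_subset[of _ "{i..i+n}"]) auto
  ultimately have "card {w \<in> range c. w \<noteq> v \<and> \<not> (E v w \<or> E w v)} \<le> card (c ` ?S)"
    by (intro card_mono) auto
  also have "\<dots> \<le> card ?S" by (rule card_image_le[OF fin])
  finally show ?thesis using degree[of i] by simp
qed

text \<open>The bound on non-neighbours and the absence of \<open>theta\<close> refer to vertices,
  not positions, so any Hamiltonian cycle on these vertices may replace \<open>c\<close>.\<close>

lemma rearranged:
  assumes "distinct xs" "set xs = range c" "successively E xs" "E (last xs) (hd xs)"
  shows "cyclic E (\<lambda>i. xs ! nat (i mod n)) n k l"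
proof (rule cyclic_of_list)
  show "int (length xs) = n" using distinct_card[OF assms(1)] assms(2) card_range by simp
qed (use assms pos free range_degree in auto)

lemma all_adj: "n = k + l \<Longrightarrow> x < y \<Longrightarrow> y < x + n \<Longrightarrow> Adj x y"
  using missing1[of y y x] by (cases "Adj x y") auto

end

text \<open>The argument of \<open>insertion\<close> for a path that no longer follows consecutive
  positions.\<close>

lemma insertion_list:
  assumes "E x z" "E z y" "\<And>w. w \<in> set ws \<Longrightarrow> E w z \<or> E z w"
  shows "\<exists>us' p q vs'. us @ x # ws @ y # vs = us' @ p # q # vs' \<and> E p z \<and> E z q"
  using assms
proof (induction ws arbitrary: us x)
  case Nil
  then show ?case by auto
next
  case (Cons w ws)
  show ?case
  proof (cases "E z w")
    case True
    have "us @ x # (w # ws) @ y # vs = us @ x # w # (ws @ y # vs)" by simp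
    then show ?thesis using Cons.prems(1) True by blast
  next
    case False
    then have "E w z" using Cons.prems by auto
    from Cons.IH[OF this, of "us @ [x]"] show ?thesis using Cons.prems by auto
  qed
qed

section \<open>A Hamiltonian cycle with a forward jump of length two, for n = k + l\<close>

context cyclic
begin

text \<open>The vertices \<open>v + 1, \<dots>, v + m\<close> have been inserted into the path from \<open>v + a\<close> to \<open>v + n\<close>, which a
  forward jump from \<open>v\<close> to \<open>v + a\<close> closes to a cycle. Inserting the last vertex creates a forward jump
  of length two.\<close>

definition inserted :: "int \<Rightarrow> int \<Rightarrow> int \<Rightarrow> 'v list \<Rightarrow> bool" where
  "inserted v a m ys \<longleftrightarrow> distinct ys \<and> set ys = c ` ({v+a..v+n} \<union> {v+1..v+m}) \<and> successively E ys \<and>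
     hd ys = c (v+a) \<and> last ys = c (v+n) \<and> subseq (map c [v+a..v+n]) ys"

text \<open>By \<open>bk\<close>, the new vertex has an arc from lo, a - 1 positions later, and an
  arc to hi, a - 1 positions earlier modulo n. The bound 2a - 2 < n puts lo before hi, and the
  \<open>subseq\<close> clause of \<open>inserted\<close> preserves this order in the current
  list.\<close>

lemma insert_next:
  assumes N0: "n = k + l" and a: "2 * a - 2 < n" "0 \<le> m" "m \<le> a - 2" "2 \<le> a"
    and bk: "\<And>w. A (w + (a - 1)) w" and ys: "inserted v a m ys"
  shows "\<exists>us p q vs. ys = us @ p # q # vs \<and> E p q \<and> inserted v a (m + 1) (us @ p # c (v + m + 1) # q # vs)"
proof -
  define z where "z = v + m + 1"
  define lo where "lo = v + m + a"
  define hi where "hi = v + n + m + 2 - a"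
  have I: "inj_on c {v+1..<v+1+n}" by (rule inj_window)
  have y: "distinct ys" "set ys = c ` ({v+a..v+n} \<union> {v+1..v+m})" "successively E ys" "hd ys = c (v+a)"
    "last ys = c (v+n)" "subseq (map c [v+a..v+n]) ys"
    using ys by (auto simp: inserted_def)
  have z: "c z \<notin> set ys"
  proof
    assume "c z \<in> set ys"
    then obtain x where x: "x \<in> {v+a..v+n} \<union> {v+1..v+m}" "c z = c x" using y(2) by (metis imageE)
    have "z = x" by (rule inj_onD[OF I x(2)]) (use x a z_def in auto)
    then show False using x a z_def by auto
  qed
  have ord: "v + a \<le> lo" "lo < hi" "hi \<le> v + n" using a by (auto simp: lo_def hi_def)
  have e: "E (c lo) (c z)" "E (c z) (c hi)"
  proof -
    show "E (c lo) (c z)" using bk[of z] by (simp add: A_def lo_def z_def algebra_simps)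
    have "A z (z - (a - 1))" using bk[of "z - (a - 1)"] by simp
    then have "A z (z - (a - 1) + n)" by simp
    then show "E (c z) (c hi)" by (simp add: A_def hi_def z_def algebra_simps)
  qed
  have "subseq [c lo, c hi] (map c [v+a..v+n])"
  proof -
    have "[v+a..v+n] = [v+a..lo-1] @ lo # [lo+1..v+n]" using ord by (intro upto_split3) auto
    moreover have "subseq [c hi] (map c [lo+1..v+n])" using ord by (simp add: subseq_singleton_left)
    ultimately show ?thesis by (simp add: list_emb_append2)
  qed
  then have "subseq [c lo, c hi] ys" using y(6) by (rule subseq_order.trans)
  then obtain us0 vs0 where s1: "ys = us0 @ c lo # vs0" "subseq [c hi] vs0"
    using list_emb_ConsD[of "(=)" "c lo" "[c hi]" ys] by auto
  then obtain ws vs1 where s2: "vs0 = ws @ c hi # vs1"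
    by (auto simp: subseq_singleton_left dest: split_list)
  have adj: "E w (c z) \<or> E (c z) w" if "w \<in> set ws" for w
  proof -
    have "w \<in> set ys" using that s1 s2 by auto
    then obtain x where x: "x \<in> {v+a..v+n} \<union> {v+1..v+m}" "w = c x" using y(2) by (metis imageE)
    have "x \<noteq> z" using z \<open>w \<in> set ys\<close> x by auto
    then have "Adj x z" using all_adj[OF N0, of x z] all_adj[OF N0, of z x] x a z_def
      by (auto simp: Adj_sym)
    then show ?thesis using x by (auto simp: Adj_def A_def)
  qed
  obtain us p q vs where s: "ys = us @ p # q # vs" "E p (c z)" "E (c z) q"
    using insertion_list[of E, OF e adj, where us = us0 and vs = vs1] s1 s2 by blast
  have "set (us @ p # c z # q # vs) = insert (c z) (set ys)" using s by auto
  also have "\<dots> = c ` ({v+a..v+n} \<union> {v+1..v+(m+1)})"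
  proof -
    have "{v+1..v+(m+1)} = insert z {v+1..v+m}" using a by (auto simp: z_def)
    then show ?thesis using y(2) by auto
  qed
  finally have st: "set (us @ p # c z # q # vs) = c ` ({v+a..v+n} \<union> {v+1..v+(m+1)})" .
  have sub: "subseq ys (us @ p # c z # q # vs)" unfolding s(1)
    by (intro list_emb_append_mono) auto
  have "inserted v a (m + 1) (us @ p # c z # q # vs)"
    unfolding inserted_def
  proof (intro conjI)
    show "distinct (us @ p # c z # q # vs)" using y(1) z s by auto
    show "set (us @ p # c z # q # vs) = c ` ({v+a..v+n} \<union> {v+1..v+(m+1)})" by (rule st)
    show "successively E (us @ p # c z # q # vs)" using y(3) s by (auto simp: successively_append_iff)
    show "hd (us @ p # c z # q # vs) = c (v + a)" using y(4) s by (cases us) auto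
    show "last (us @ p # c z # q # vs) = c (v + n)" using y(5) s by auto
    show "subseq (map c [v+a..v+n]) (us @ p # c z # q # vs)" using y(6) sub by (rule subseq_order.trans)
  qed
  moreover have "E p q" using y(3) s by (auto simp: successively_append_iff)
  ultimately show ?thesis using s z_def by blast
qed

text \<open>The vertex inserted last stands between p and q, which were consecutive before; so the
  arc from p to q skips one vertex of the new cycle.\<close>

lemma new_cycle_two_jump:
  assumes N0: "n = k + l" and a: "2 * a - 2 < n" "3 \<le> a"
    and bk: "\<And>w. A (w + (a - 1)) w" and j: "A v (v + a)"
  shows "\<exists>c'. cyclic E c' n k l \<and> (\<exists>i. E (c' i) (c' (i + 2)))"
proof -
  have "int m \<le> a - 2 \<longrightarrow> (\<exists>ys. inserted v a (int m) ys)" for m :: nat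
  proof (induction m)
    case 0
    have vn: "v + a \<le> v + n" using a by simp
    have "inj_on c {v+a..v+n}" by (rule inj_on_subset[OF inj_window[of "v+a"]]) (use a in auto)
    moreover have "\<And>i. A i (i + 1)" by simp
    from successively_upto[of A, OF this] have "successively A [v+a..v+n]" .
    ultimately have "inserted v a 0 (map c [v+a..v+n])"
      using vn
      by (simp add: inserted_def distinct_map hd_map last_map hd_upto last_upto successively_map A_def[abs_def])
    then show ?case by auto
  next
    case (Suc m)
    then show ?case using insert_next[OF N0 a(1) _ _ _ bk, of "int m" v] a(2)
      by (auto simp: add.commute) blast
  qed
  from this[of "nat (a - 2)"] obtain ys where "inserted v a (a - 2) ys" using a by auto
  from insert_next[OF N0 a(1) _ _ _ bk this] obtain us p q vs where
    s: "E p q" "inserted v a (a - 2 + 1) (us @ p # c (v + (a - 2) + 1) # q # vs)" using a by auto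
  define zs where "zs = us @ p # c (v + (a - 2) + 1) # q # vs"
  have zs: "distinct zs" "set zs = c ` ({v+a..v+n} \<union> {v+1..v+(a-1)})" "successively E zs" "hd zs = c (v+a)" "last zs = c (v+n)"
    using s(2) by (auto simp: inserted_def zs_def)
  have "{v+a..v+n} \<union> {v+1..v+(a-1)} = {v+1..<v+1+n}" using a by auto
  then have "set zs = range c" using zs(2) range_c[of "v+1"] by simp
  moreover have "E (last zs) (hd zs)" using zs(4,5) j periodic[of v] by (simp add: A_def)
  ultimately have cyc: "cyclic E (\<lambda>i. zs ! nat (i mod n)) n k l" using rearranged zs by blast
  have len: "int (length zs) = n" using distinct_card[OF zs(1)] \<open>set zs = range c\<close> card_range by simp
  have "int (length us) + 2 < n" using len by (simp add: zs_def)
  then have "nat (int (length us) mod n) = length us" "nat ((int (length us) + 2) mod n) = length us + 2"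
    by (simp_all add: nat_add_distrib)
  then have "E (zs ! nat (int (length us) mod n)) (zs ! nat ((int (length us) + 2) mod n))"
    using s(1) by (simp add: zs_def nth_append)
  then show ?thesis using cyc by blast
qed

text \<open>Let a be the least length >= 2 of a forward jump. The arc between 0 and n div 2, read as
  a forward jump, shows 2a <= n + 1. If a >= 3, all jumps of length a - 1 are backward, since all
  vertices are adjacent.\<close>

lemma exists_cycle_two_jump:
  assumes N0: "n = k + l"
  shows "\<exists>c'. cyclic E c' n k l \<and> (\<exists>i. E (c' i) (c' (i + 2)))"
proof -
  have n6: "6 \<le> n" using pos by simp
  let ?P = "\<lambda>a::nat. 2 \<le> a \<and> (\<exists>v. A v (v + int a))"
  define h where "h = n div 2"
  have h: "2 * h \<le> n" "n \<le> 2 * h + 1" using h_def by auto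
  have "Adj 0 h" by (rule all_adj[OF N0]) (use h n6 in auto)
  then have "\<exists>b. ?P b \<and> 2 * int b \<le> n + 1"
  proof (unfold Adj_def, elim disjE)
    assume "A 0 h"
    then show ?thesis using h n6 by (intro exI[of _ "nat h"]) (auto intro: exI[of _ 0])
  next
    assume "A h 0"
    then have "A h (h + (n - h))" using A_n0 by simp
    then show ?thesis using h n6 by (intro exI[of _ "nat (n - h)"]) (auto intro: exI[of _ h])
  qed
  then obtain b where b: "?P b" "2 * int b \<le> n + 1" by blast
  obtain a where a: "?P a" and least: "\<And>a'. ?P a' \<Longrightarrow> a \<le> a'"
    using exists_least_iff[of ?P] b(1) by (metis not_le)
  have ab: "a \<le> b" using least b by blast
  obtain v where v: "A v (v + int a)" using a by blast
  show ?thesis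
  proof (cases "a = 2")
    case True
    then have "E (c v) (c (v + 2))" using v by (simp add: A_def)
    then show ?thesis using cyclic_axioms by blast
  next
    case False
    then have a3: "3 \<le> a" using a by simp
    have "A (w + (int a - 1)) w" for w
    proof -
      have "\<not> A w (w + (int a - 1))"
      proof
        assume "A w (w + (int a - 1))"
        then have "?P (a - 1)" using a3 by (auto simp: of_nat_diff intro: exI[of _ w])
        from least[OF this] show False using a3 by simp
      qed
      moreover have "Adj w (w + (int a - 1))" by (rule all_adj[OF N0]) (use a3 ab b n6 in auto)
      ultimately show ?thesis by (simp add: Adj_def)
    qed
    then show ?thesis by (intro new_cycle_two_jump[OF N0 _ _ _ v]) (use a3 ab b in auto)
  qed
qed

section \<open>Directions of the jumps of length l and k\<close>

lemma swapped: "cyclic E c n l k"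
proof
  show "\<not> theta E l k" using free theta_sym by blast
  show "card {x. i < x \<and> x < i + n \<and> \<not> (E (c i) (c x) \<or> E (c x) (c i))} \<le> nat (n - l - k)" for i
    using degree[of i] by (simp add: algebra_simps)
qed (use periodic inj step pos in auto)

text \<open>The jump at v excludes the backward jump at v + 1. If v + 1 and v + 1 + l were not
  adjacent, they would be each other's only non-neighbour; then the chord between v and v + l + 1
  and the one from v + 1 to v + l + 2 would exist and cross.\<close>

lemma jump_step:
  assumes n: "n \<le> k + l + 1" and l2: "2 \<le> l" "2 \<le> k" and a: "A v (v + l)"
  shows "A (v + 1) (v + 1 + l)"
proof -
  have ni: "\<not> A (v + 1 + l) (v + 1)"
    by (rule fwd_in[OF a]) (use n l2 pos in \<open>auto simp: two_def\<close>)
  have "Adj (v + 1) (v + 1 + l)"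
  proof (rule ccontr)
    assume no: "\<not> ?thesis"
    have N1: "n = k + l + 1"
      using missing1[of "v+1+l" "v+1+l" "v+1"] no l2 n pos by fastforce
    have B0: "Adj v (v + l + 1)"
    proof (rule ccontr)
      assume "\<not> ?thesis"
      then have "\<not> Adj (v + l + 1) (v + n)" by (simp add: Adj_sym)
      moreover have "\<not> Adj (v + l + 1) (v + n + 1)"
        using no Adj_periodic(1)[of "v+1" "v+l+1"] by (simp add: Adj_sym algebra_simps)
      moreover have "q = v + n \<or> q = v + n + 1" if "v + n \<le> q" "q \<le> v + n + 1" for q using that by linarith
      ultimately have "(v + n + 1) - (v + n) + 1 \<le> n - k - l"
        by (intro missing1[of _ _ "v+l+1"]) (use N1 l2 pos in force)+
      then show False using N1 by simp
    qed
    have B1: "Adj (v + 1) (v + l + 2)"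
    proof (rule ccontr)
      assume "\<not> ?thesis"
      moreover have "\<not> Adj (v + 1) (v + l + 1)" using no by (simp add: algebra_simps)
      moreover have "q = v + l + 1 \<or> q = v + l + 2" if "v + l + 1 \<le> q" "q \<le> v + l + 2" for q using that by linarith
      ultimately have "(v + l + 2) - (v + l + 1) + 1 \<le> n - k - l"
        by (intro missing1[of _ _ "v+1"]) (use N1 l2 pos in force)+
      then show False using N1 by simp
    qed
    have i1: "\<not> A (v + l + 2) (v + 1)"
      by (rule fwd_in[OF a]) (use N1 l2 pos in \<open>auto simp: two_def\<close>)
    then have o1: "A (v + 1) (v + l + 2)" using B1 by (simp add: Adj_def)
    show False
    proof (cases "A v (v + l + 1)")
      case True
      have "\<not> A (v + 1) (v + l + 2)"
        by (rule fwd_out[OF True]) (use N1 l2 pos in \<open>auto simp: two_def\<close>)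
      then show False using o1 by simp
    next
      case False
      then have b: "A (v + l + 1) v" using B0 by (simp add: Adj_def)
      have "\<not> A (v + 1) (v + l + 2)"
        by (rule bwd_out[OF b]) (use N1 l2 pos in \<open>auto simp: two_def\<close>)
      then show False using o1 by simp
    qed
  qed
  then show ?thesis using ni by (simp add: Adj_def)
qed

lemma jumps_propagate:
  assumes "\<And>v. A v (v + d) \<Longrightarrow> A (v + 1) (v + 1 + d)" and a: "A v (v + d)"
  shows "A w (w + d)"
proof -
  have 1: "A (v + int m) (v + int m + d)" for m :: nat
  proof (induction m)
    case (Suc m)
    from assms(1)[OF Suc] show ?case by (simp add: algebra_simps)
  qed (use a in simp)
  define m where "m = (w - v) mod n"
  have "0 \<le> m" using n_pos by (simp add: m_def)
  then have "A (v + m) (v + m + d)" using 1[of "nat m"] by simp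
  moreover have "n dvd (w - (v + m))" unfolding m_def by (simp add: diff_diff_eq[symmetric])
  then have "c w = c (v + m)" "c (w + d) = c (v + m + d)" by (auto intro!: c_cong)
  ultimately show ?thesis by (simp add: A_def)
qed

lemma jumps_all:
  assumes "n \<le> k + l + 1" "2 \<le> l" "2 \<le> k" "A v (v + l)"
  shows "A w (w + l)"
  by (rule jumps_propagate[OF jump_step assms(4)]) (use assms in auto)

text \<open>A backward jump of length l is a forward one of length n - l, which is k for n = k + l.
  For n = k + l + 1, a backward chord of length l + 1 is a forward jump of length k; if there are
  none, chords of length l + 1 go forward, and two consecutive ones cross.\<close>

lemma jump_dichotomy:
  assumes n: "n \<le> k + l + 1" and l2: "2 \<le> l" "2 \<le> k"
  shows "(\<forall>v. A v (v + l)) \<or> (\<forall>v. A v (v + k))"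
proof (cases "(\<exists>v. A v (v + l)) \<or> (\<exists>v. A v (v + k))")
  case True
  then show ?thesis
    using jumps_all[OF n l2] cyclic.jumps_all[OF swapped] n l2 by (metis add.commute)
next
  case False
  then have no: "\<not> A v (v + l)" "\<not> A v (v + k)" for v by auto
  have "Adj 0 l"
  proof (rule ccontr)
    assume mA: "\<not> ?thesis"
    have N1: "n = k + l + 1"
      using missing1[of l l 0] mA l2 n pos by fastforce
    have "Adj 0 (l + 1)"
    proof (rule ccontr)
      assume "\<not> ?thesis"
      moreover have "q = l \<or> q = l + 1" if "l \<le> q" "q \<le> l + 1" for q using that by linarith
      ultimately have "(l + 1) - l + 1 \<le> n - k - l"
        by (intro missing1[of _ _ 0]) (use mA N1 l2 pos in force)+
      then show False using N1 by simp
    qed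
    moreover have "\<not> A (l + 1) 0" using no(2)[of "l+1"] N1 A_n0(2)[of "l+1"] by (simp add: algebra_simps)
    ultimately have o0: "A 0 (l + 1)" by (simp add: Adj_def)
    have "Adj (- 1) l"
    proof (rule ccontr)
      assume "\<not> ?thesis"
      then have "\<not> Adj l (- 1 + n)" unfolding Adj_periodic by (simp add: Adj_sym)
      moreover have "\<not> Adj l (0 + n)" using mA unfolding Adj_periodic by (simp add: Adj_sym)
      moreover have "q = - 1 + n \<or> q = 0 + n" if "- 1 + n \<le> q" "q \<le> 0 + n" for q using that by linarith
      ultimately have "(0 + n) - (- 1 + n) + 1 \<le> n - k - l"
        by (intro missing1[of _ _ l]) (use N1 l2 pos in force)+
      then show False using N1 by simp
    qed
    moreover have "\<not> A l (- 1)" using no(2)[of l] N1 A_periodic(2)[of l "-1"] by (simp add: algebra_simps)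
    ultimately have "A (- 1) l" by (simp add: Adj_def)
    then have "\<not> A 0 (l + 1)"
      by (rule fwd_out) (use N1 l2 pos in \<open>auto simp: two_def\<close>)
    then show False using o0 by simp
  qed
  then have a0: "A l 0" using no(1)[of 0] by (simp add: Adj_def)
  show ?thesis
  proof (cases "n = k + l")
    case True
    then have "A l (l + k)" using a0 A_n0 by (simp add: add.commute)
    then show ?thesis using no by blast
  next
    case False
    then have N1: "n = k + l + 1" using n pos by simp
    have i1: "\<not> A (l + 1) 1" by (rule bwd_in[OF a0]) (use N1 l2 pos in \<open>auto simp: two_def\<close>)
    then have mA: "\<not> Adj 1 (l + 1)" using no(1)[of 1] by (simp add: Adj_def add.commute)
    have "Adj 1 (l + 2)"
    proof (rule ccontr)
      assume "\<not> ?thesis"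
      moreover have "q = l + 1 \<or> q = l + 2" if "l + 1 \<le> q" "q \<le> l + 2" for q using that by linarith
      ultimately have "(l + 2) - (l + 1) + 1 \<le> n - k - l"
        by (intro missing1[of _ _ 1]) (use mA N1 l2 pos in force)+
      then show False using N1 by simp
    qed
    moreover have "\<not> A (l + 2) 1" using no(2)[of "l+2"] N1 A_periodic(2)[of "l+2" 1] by (simp add: algebra_simps)
    ultimately have o1: "A 1 (l + 2)" by (simp add: Adj_def)
    have "Adj 0 (l + 1)"
    proof (rule ccontr)
      assume "\<not> ?thesis"
      then have "\<not> Adj (l + 1) (0 + n)" unfolding Adj_periodic by (simp add: Adj_sym)
      moreover have "\<not> Adj (l + 1) (1 + n)" using mA unfolding Adj_periodic by (simp add: Adj_sym)
      moreover have "q = 0 + n \<or> q = 1 + n" if "0 + n \<le> q" "q \<le> 1 + n" for q using that by linarith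
      ultimately have "(1 + n) - (0 + n) + 1 \<le> n - k - l"
        by (intro missing1[of _ _ "l+1"]) (use N1 l2 pos in force)+
      then show False using N1 by simp
    qed
    moreover have "\<not> A (l + 1) 0" using no(2)[of "l+1"] N1 A_n0(2)[of "l+1"] by (simp add: algebra_simps)
    ultimately have "A 0 (l + 1)" by (simp add: Adj_def)
    then have "\<not> A 1 (l + 2)"
      by (rule fwd_out) (use N1 l2 pos in \<open>auto simp: two_def\<close>)
    then show ?thesis using o1 by simp
  qed
qed

lemma equal_False: "k = l \<Longrightarrow> n \<le> k + l + 1 \<Longrightarrow> False"
proof -
  assume kl: "k = l" and n: "n \<le> k + l + 1"
  have l3: "3 \<le> l" using kl pos by simp
  have f: "A v (v + l)" for v using jump_dichotomy n kl l3 by auto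
  have "\<not> two (l - 1 - 0 + 1) (2 * l - 1 - l + 1)"
    by (rule crossing1) (use f[of 0] f[of "l-1"] l3 kl pos n in auto)
  then show False using kl by (simp add: two_def)
qed

lemma k1_N0_False: "k = l + 1 \<Longrightarrow> n = k + l \<Longrightarrow> False"
proof -
  assume kl: "k = l + 1" and n: "n = k + l"
  have l3: "3 \<le> l" using kl pos by simp
  have kl': "k \<le> l + 1" "l + 1 \<le> k" "n \<le> 2 * l + 1" "2 * l + 1 \<le> n" using kl n by auto
  have no2: False if c': "cyclic E c' n k l" and "E (c' v) (c' (v + 2))" for c' v
  proof -
    interpret C: cyclic E c' n k l by (rule c')
    have f: "C.A w (w + l)" for w
    proof -
      have "\<not> C.A (w + l) w"
      proof
        assume b: "C.A (w + l) w"
        have "\<not> C.Adj (w + 1) (w + l + 1)"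
          by (rule C.bwd_nonadj[OF b]) (use l3 kl' in \<open>auto simp: two_def\<close>)
        moreover have "C.Adj (w + 1) (w + l + 1)" by (rule C.all_adj[OF n]) (use l3 kl' in auto)
        ultimately show False by simp
      qed
      moreover have "C.Adj w (w + l)" by (rule C.all_adj[OF n]) (use l3 kl' in auto)
      ultimately show ?thesis by (simp add: C.Adj_def)
    qed
    have a: "C.A v (v + 2)" using that by (simp add: C.A_def)
    show False
      by (rule C.braid[of l "l-1" "v-2*l+2" "v+2"])
        (use a f[of "v-2*l+2"] f[of "v-l+1"] l3 kl' in \<open>auto simp: two_def algebra_simps\<close>)
  qed
  then show False using exists_cycle_two_jump[OF n] by blast
qed

end

lemma successively_map_upto:
  assumes "\<And>i. a \<le> i \<Longrightarrow> i < b \<Longrightarrow> R (f i) (f (i + 1))"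
  shows "successively R (map f [a..b])"
  unfolding successively_conv_nth
proof (intro allI impI)
  fix i assume "Suc i < length (map f [a..b])"
  then have i: "a + int i < b" by auto
  then have "R (f (a + int i)) (f (a + int i + 1))" using assms by simp
  then show "R (map f [a..b] ! i) (map f [a..b] ! Suc i)" using i by (simp add: nth_upto algebra_simps)
qed

section \<open>Missing adjacencies for n = k + l + 1\<close>

context cyclic
begin

text \<open>Arcs at distance l + 1 go forward, and two consecutive ones would cross. Since a vertex
  has at most one non-neighbour, \<open>B\<close> alternates along the cycle, which forces the
  parities. The condition on n keeps v + l + 1 and v + k, the two vertices at distance l + 1 from v,
  distinct.\<close>

lemma only_missing:
  assumes f: "\<And>v. A v (v + l)" and n: "n = k + l + 1" "n \<noteq> 2 * l + 2" and l2: "2 \<le> l" "2 \<le> k"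
  shows "even l" "even n" "\<And>x y. x < y \<Longrightarrow> y < x + n \<Longrightarrow> \<not> Adj x y \<Longrightarrow> y = x + l + 1 \<or> y = x + k"
proof -
  define B where "B v \<longleftrightarrow> Adj v (v + l + 1)" for v
  have one: "y = z" if "x < y" "y < x + n" "x < z" "z < x + n" "\<not> Adj x y" "\<not> Adj x z" for x y z
  proof (rule ccontr)
    assume "y \<noteq> z"
    then have "seg_length (if y < z then [(y,y),(z,z)] else [(z,z),(y,y)]) \<le> n - k - l"
      by (intro missing[of _ x]) (use that in auto)
    then show False using n by (auto split: if_splits)
  qed
  have no_in: "\<not> A (v + l + 1) v" for v
  proof -
    have "A (v - 1) (v - 1 + l)" by (rule f)
    then show ?thesis by (rule fwd_in) (use n l2 in \<open>auto simp: two_def\<close>)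
  qed
  have B1: "\<not> B (v + 1)" if "B v" for v
  proof -
    have "A v (v + l + 1)" using that no_in by (auto simp: B_def Adj_def)
    then have "\<not> A (v + 1) (v + l + 2)"
      by (rule fwd_out) (use n l2 in \<open>auto simp: two_def\<close>)
    then have "\<not> A (v + 1) (v + 1 + l + 1)" by (simp add: algebra_simps)
    then show ?thesis using no_in[of "v+1"] by (auto simp: B_def Adj_def)
  qed
  have miss_k: "\<not> Adj v (v + k)" if "\<not> B (v - l - 1)" for v
  proof -
    have "\<not> Adj v (v - l - 1 + n)" using that unfolding Adj_periodic by (simp add: B_def Adj_sym)
    then show ?thesis using n by (simp add: algebra_simps)
  qed
  have M1: "B v \<or> B (v - l - 1)" for v
    using one[of v "v + l + 1" "v + k"] miss_k[of v] n l2 by (auto simp: B_def)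
  have B2: "B (v - l - 1) \<longleftrightarrow> \<not> B v" for v
  proof
    assume b: "B (v - l - 1)"
    have "\<not> B (v - l)" using B1[OF b] by simp
    then have "B (v + 1)" using M1[of "v + 1"] by auto
    then show "\<not> B v" using B1 by blast
  qed (use M1 in blast)
  have B3: "B (v + 1) \<longleftrightarrow> \<not> B v" for v
  proof
    assume "\<not> B v"
    then have "B (v - l - 1)" using B2 by blast
    from B1[OF this] have "\<not> B (v - l)" by simp
    then show "B (v + 1)" using B2[of "v+1"] by simp
  qed (use B1 in blast)
  have par: "B (v + int m) \<longleftrightarrow> (B v \<longleftrightarrow> even m)" for v m
  proof (induction m)
    case (Suc m)
    then show ?case using B3[of "v + int m"] by (simp add: add.commute add.left_commute)
  qed simp
  show "even l" using par[of "- l - 1" "nat (l + 1)"] B2[of 0] l2 by (auto simp: even_nat_iff)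
  have "B (0 + n) = B 0" unfolding B_def by (metis Adj_periodic(1,2) add.assoc add.commute add.left_commute)
  then show "even n" using par[of 0 "nat n"] n l2 by (auto simp: even_nat_iff)
  show "y = x + l + 1 \<or> y = x + k" if "x < y" "y < x + n" "\<not> Adj x y" for x y
  proof (cases "B x")
    case True
    then have "\<not> Adj x (x + k)" using miss_k B2 by blast
    then show ?thesis using one[of x y "x + k"] that n l2 by auto
  next
    case False
    then show ?thesis using one[of x y "x + l + 1"] that n l2 by (auto simp: B_def)
  qed
qed

lemma exists_two_jump:
  assumes f: "\<And>v. A v (v + l)" and n: "n = k + l + 1" "n \<noteq> 2 * l + 2" and l2: "2 \<le> l" "2 \<le> k"
  shows "\<exists>v. A v (v + 2)"
proof (cases "l = 2")
  case True
  then show ?thesis using f[of 0] by (intro exI[of _ 0]) simp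
next
  case False
  note o = only_missing[OF f n l2]
  have k3: "3 \<le> k" using o(1,2) n l2 by (cases "k = 2") auto
  show ?thesis
  proof (rule ccontr)
    assume no: "\<not> ?thesis"
    have bk: "A (w + 2) w" for w
      using no o(3)[of w "w + 2"] False k3 l2 n by (auto simp: Adj_def)
    obtain j where "l = 3 * int j \<or> l = 3 * int j + 1 \<or> l = 3 * int j + 2"
    proof -
      have "l = 3 * int (nat (l div 3)) + l mod 3" "0 \<le> l mod 3" "l mod 3 < 3" using l2 by auto
      then show ?thesis using that[of "nat (l div 3)"] by linarith
    qed
    then consider "l = 3 * int j" | "l = 3 * int j + 1" | "l = 3 * int j + 2" by blast
    then show False
    proof cases
      case 1
      show False
        by (rule backward_braid[of 2 j l l 0]) (use 1 l2 k3 n False bk in \<open>auto simp: two_def\<close>)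
    next
      case 2
      show False
        by (rule backward_braid[of 2 j "l-1" "l+1" 0]) (use 2 l2 k3 n False bk in \<open>auto simp: two_def\<close>)
    next
      case 3
      show False
        by (rule backward_braid[of 2 "j+1" "l+1" "l+1" 0]) (use 3 l2 k3 n False bk in \<open>auto simp: two_def\<close>)
    qed
  qed
qed

section \<open>Moving one vertex to another place of the cycle\<close>

lemma moved:
  assumes "A (- 1) 1" "A j 0" "A 0 (j + 1)" "1 \<le> j" "j \<le> n - 2"
  obtains c' where "cyclic E c' n k l" "\<And>m. 0 \<le> m \<Longrightarrow> m < j \<Longrightarrow> c' m = c (m + 1)" "c' j = c 0"
    "\<And>m. j < m \<Longrightarrow> m < n \<Longrightarrow> c' m = c m"
proof -
  define zs where "zs = [1..j] @ 0 # [j+1..n-1]"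
  have sz: "set zs = {0..<0+n}" using assms by (auto simp: zs_def)
  have dz: "distinct zs" using assms by (auto simp: zs_def)
  have "\<And>i. A i (i + 1)" by simp
  note up = successively_upto[of A, OF this]
  have su: "successively A zs" using up assms by (auto simp: zs_def successively_append_iff successively_Cons hd_upto last_upto)
  have len: "length [1..j] = nat j" by simp
  have nth: "zs ! nat m = (if m < j then m + 1 else if m = j then 0 else m)" if "0 \<le> m" "m < n" for m
  proof -
    consider "m < j" | "m = j" | "j < m" by linarith
    then show ?thesis
    proof cases
      case 3
      then have "nat m - nat j = Suc (nat (m - j - 1))" using assms by auto
      then show ?thesis using 3 that assms by (simp add: zs_def nth_append nth_upto)
    qed (use that assms in \<open>auto simp: zs_def nth_append nth_upto\<close>)
  qed
  have ln: "int (length zs) = n" using distinct_card[OF dz] sz n_pos by simp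
  have ne: "zs \<noteq> []" by (simp add: zs_def)
  define xs where "xs = map c zs"
  have "cyclic E (\<lambda>i. xs ! nat (i mod n)) n k l"
  proof (rule rearranged)
    show "distinct xs" using dz inj_window[of 0] sz by (simp add: xs_def distinct_map)
    show "set xs = range c" using sz range_c[of 0] by (simp add: xs_def)
    show "successively E xs" using su by (simp add: xs_def successively_map A_def[abs_def])
    have "hd zs = 1" "last zs = n - 1" using assms by (auto simp: zs_def hd_append hd_upto last_upto)
    moreover have "A (n - 1) 1" using assms(1) A_periodic(1)[of "-1" 1] by simp
    ultimately show "E (last xs) (hd xs)" using ne by (simp add: xs_def last_map hd_map A_def)
  qed
  moreover have v: "xs ! nat (m mod n) = c (if m < j then m + 1 else if m = j then 0 else m)" if "0 \<le> m" "m < n" for m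
  proof -
    have "nat m < length zs" using that ln by linarith
    then show ?thesis using that nth[OF that] by (simp add: xs_def)
  qed
  ultimately show thesis
    by (intro that[of "\<lambda>i. xs ! nat (i mod n)"]) (use assms v in auto)
qed

text \<open>Both Hamiltonian cycles have all their jumps of length \<open>l\<close> forward. Jumps of the new cycle across
  the old place of the vertex \<open>0\<close> are jumps of length \<open>l + 1\<close> of the old one, and two consecutive ones
  of these cross.\<close>

lemma switch0:
  assumes f: "\<And>v. A v (v + l)" and n: "n \<le> k + l + 1" "l + 3 \<le> n" and l2: "2 \<le> l" "2 \<le> k"
    and gap: "2 * l < n - 1 \<or> n + 1 < 2 * l"
    and j: "A (- 1) 1" "A j 0" "A 0 (j + 1)" "2 \<le> j" "j \<le> n - 3"
  shows False
proof -
  obtain c' where c': "cyclic E c' n k l" "\<And>m. 0 \<le> m \<Longrightarrow> m < j \<Longrightarrow> c' m = c (m + 1)" "c' j = c 0"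
    "\<And>m. j < m \<Longrightarrow> m < n \<Longrightarrow> c' m = c m"
    using moved[OF j(1-3)] j(4,5) by auto
  interpret C: cyclic E c' n k l by (rule c')
  have "\<exists>v. C.A v (v + l)"
  proof -
    \<comment> \<open>A jump that passes over both or neither of the old and the new place of the
      vertex 0 keeps its length l. By \<open>gap\<close> there is such a jump, and by
      \<open>jumps_all\<close> one is enough.\<close>
    consider "l + 1 \<le> j" | "j + 2 + l \<le> n" | "j \<le> l - 2" | "n - l + 1 \<le> j" using gap j by linarith
    then show ?thesis
    proof cases
      case 1
      have "C.A 0 l" using f[of 1] c'(2)[of 0] c'(2)[of l] 1 j l2 by (simp add: C.A_def A_def add.commute)
      then show ?thesis by (intro exI[of _ 0]) simp
    next
      case 2
      have "C.A (j+1) (j+1+l)" using f[of "j+1"] c'(4)[of "j+1"] c'(4)[of "j+1+l"] 2 j l2 by (simp add: C.A_def A_def)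
      then show ?thesis by blast
    next
      case 3
      have "A (n - 1) (l - 1)" using f[of "- 1"] A_periodic(1)[of "-1" "l-1"] by simp
      then have "C.A (n - 1) (l - 1)" using c'(4)[of "n-1"] c'(4)[of "l-1"] 3 j l2 n by (simp add: C.A_def A_def)
      then have "C.A (n - 1) (l - 1 + n)" by simp
      then show ?thesis by (intro exI[of _ "n-1"]) (simp add: algebra_simps)
    next
      case 4
      have "A (n - l + 1) (1 + n)" using f[of "n - l + 1"] by (simp add: algebra_simps)
      then have "A (n - l + 1) 1" by (simp only: A_periodic)
      then have "C.A (n - l) 0" using c'(2)[of "n-l"] c'(2)[of 0] 4 j l2 n by (simp add: C.A_def A_def)
      then have "C.A (n - l) (0 + n)" by (simp only: C.A_periodic)
      then show ?thesis by (intro exI[of _ "n-l"]) simp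
    qed
  qed
  then have F: "C.A w (w + l)" for w using C.jumps_all[OF n(1) l2] by blast
  have J: "A m (m + l + 1)" if "j < m" "m < n" "n \<le> m + l" "m + l - n < j" for m
  proof -
    have "C.A m (m + l - n)" using F[of m] by simp
    then have "A m (m + l - n + 1)" using c'(4)[of m] c'(2)[of "m+l-n"] that by (simp add: C.A_def A_def)
    then have "A m (m + l - n + 1 + n)" by (simp only: A_periodic)
    moreover have "m + l - n + 1 + n = m + l + 1" by simp
    ultimately show ?thesis by (simp only:)
  qed
  \<comment> \<open>The least m to which \<open>J\<close> applies; it applies to m + 1 too.\<close>
  define m where "m = max (j + 1) (n - l)"
  have "A m (m + l + 1)" by (rule J) (use j n l2 in \<open>auto simp: m_def max_def\<close>)
  then have "\<not> A (m + 1) (m + l + 2)"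
    by (rule fwd_out) (use n l2 pos in \<open>auto simp: two_def\<close>)
  moreover have "A (m + 1) (m + 1 + l + 1)" by (rule J) (use j n l2 in \<open>auto simp: m_def max_def\<close>)
  ultimately show False by (simp add: algebra_simps)
qed

lemma switch:
  assumes f: "\<And>v. A v (v + l)" and n: "n \<le> k + l + 1" "l + 3 \<le> n" and l2: "2 \<le> l" "2 \<le> k"
    and gap: "2 * l < n - 1 \<or> n + 1 < 2 * l"
    and j: "A (v - 1) (v + 1)" "A u v" "A v (u + 1)" "v + 2 \<le> u" "u \<le> v + n - 3"
  shows False
  by (rule cyclic.switch0[OF shift[of v], unfolded shift_A, of "u - v"])
    (use assms f[of "v + x" for x] in \<open>auto simp: add.assoc[symmetric]\<close>)

text \<open>As l exceeds n / 2, the in-neighbour v - l, read as v + n - l, comes before the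
  out-neighbour v + l, and \<open>insertion\<close> finds a new place for v.\<close>

lemma two_jump_large:
  assumes f: "\<And>v. A v (v + l)" and n: "n \<le> k + l + 1" "l + 3 \<le> n" "n + 1 < 2 * l" and k2: "2 \<le> k"
    and a: "A (v - 1) (v + 1)"
  shows False
proof -
  have l2: "2 \<le> l" using n pos by simp
  have 1: "A (v + n - l) v" using f[of "v - l"] A_periodic(1)[of "v-l" v] by (simp add: algebra_simps)
  have "Adj v u" if "v + n - l < u" "u < v + l" for u
  proof (cases "n = k + l")
    case True
    then show ?thesis by (rule all_adj) (use that n in auto)
  next
    case False
    then have "n = k + l + 1" using n pos by simp
    then show ?thesis using only_missing(3)[OF f _ _ l2 k2, of v u] that n by auto
  qed
  then obtain u where "v + n - l \<le> u" "u < v + l" "A u v" "A v (u + 1)"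
    using insertion[OF 1 f[of v]] n by auto
  then show False using switch[OF f n(1,2) l2 k2 _ a, of u] n by auto
qed

text \<open>A forward jump of length two at v forces one at v + 1, since otherwise v + 1 can be
  moved and \<open>switch\<close> applies. When all these jumps are forward, a braid excludes
  forward jumps of length k - 1; their reversals are forward jumps of length n - k + 1, and two
  consecutive ones cross.\<close>

lemma two_jump_small:
  assumes f: "\<And>v. A v (v + l)" and l2: "2 \<le> l"
    and n: "n = k + l \<and> l + 2 \<le> k \<or> n = k + l + 1 \<and> l + 3 \<le> k" and a: "A v (v + 2)"
  shows False
proof -
  have adj: "Adj x (x + d)" if "2 \<le> d" "d < n" "d \<noteq> l + 1 \<and> d \<noteq> k \<or> n = k + l" for x d
  proof (cases "n = k + l")
    case True
    then show ?thesis by (rule all_adj) (use that in auto)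
  next
    case False
    then show ?thesis using only_missing(3)[OF f, of x "x+d"] that n l2 by auto
  qed
  have step: "A (v + 1) (v + 1 + 2)" if "A v (v + 2)" for v
  proof (cases "l = 2")
    case True
    then show ?thesis using f[of "v+1"] by simp
  next
    case False
    show ?thesis
    proof (rule ccontr)
      assume "\<not> ?thesis"
      moreover have "Adj (v + 1) (v + 1 + 2)" by (rule adj) (use n l2 False in auto)
      ultimately have b: "A (v + 1 + 2) (v + 1)" by (simp add: Adj_def)
      have "Adj (v + 1) u" if "v + 1 + 2 < u" "u < v + 1 + l" for u
        using adj[of "u - (v + 1)" "v + 1"] that n l2 by auto
      then obtain u where "v + 1 + 2 \<le> u" "u < v + 1 + l" "A u (v + 1)" "A (v + 1) (u + 1)"
        using insertion[OF b f[of "v+1"]] False l2 by auto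
      moreover have "A (v + 1 - 1) (v + 1 + 1)" using that by (simp add: add.assoc)
      ultimately show False using switch[OF f _ _ l2 _ _, of "v+1" u] n l2 by auto
    qed
  qed
  have 2: "A w (w + 2)" for w by (rule jumps_propagate[OF step a])
  have "A w (w + (n - k + 1))" for w
  proof -
    define s where "s = w + (n - k + 1)"
    have "\<not> A s (s + (k - 1))"
    proof
      assume "A s (s + (k - 1))"
      then show False
        by (intro braid[of 2 "l-1" "s-l" "s+(k-1)"])
          (use 2[of "s-l"] f[of "s-l+1"] n l2 in \<open>auto simp: two_def algebra_simps\<close>)
    qed
    moreover have "Adj s (s + (k - 1))" by (rule adj) (use n l2 in auto)
    ultimately have "A (s + (k - 1)) s" by (simp add: Adj_def)
    then have "A (w + n) s" by (simp add: s_def algebra_simps)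
    then show ?thesis by (simp add: s_def)
  qed
  note d = this
  have "\<not> A 1 (n - k + 2)"
    by (rule fwd_out[OF d[of 0]]) (use n l2 in \<open>auto simp: two_def\<close>)
  then show False using d[of 1] by (simp add: algebra_simps)
qed

lemma two_jump_False:
  assumes l2: "2 \<le> l" and n: "n = k + l \<and> l + 2 \<le> k \<or> n = k + l + 1 \<and> l + 3 \<le> k" and a: "A v (v + 2)"
  shows False
proof (cases "\<forall>v. A v (v + l)")
  case True
  then show ?thesis using two_jump_small[OF _ l2 n a] by blast
next
  case False
  then have no: "\<not> A w (w + l)" for w using jumps_all[of w] l2 n by force
  have fk: "A w (w + k)" for w using jump_dichotomy False l2 n by force
  have "l \<noteq> 2" using no[of v] a by auto
  moreover have "A (v + 1 - 1) (v + 1 + 1)" using a by (simp add: add.assoc)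
  ultimately show False
    by (intro cyclic.two_jump_large[OF swapped fk _ _ _ l2, of "v+1"]) (use l2 n in auto)
qed

lemma N01_False:
  assumes l2: "2 \<le> l" and n: "n = k + l \<and> l + 2 \<le> k \<or> n = k + l + 1 \<and> l + 3 \<le> k"
  shows False
proof (cases "n = k + l")
  case True
  then obtain c' v where c': "cyclic E c' n k l" "E (c' v) (c' (v + 2))" using exists_cycle_two_jump by blast
  then interpret C: cyclic E c' n k l by simp
  show False using C.two_jump_False[OF l2 n, of v] c' by (simp add: C.A_def)
next
  case False
  then have n': "n = k + l + 1" "l + 3 \<le> k" using n by auto
  have "(\<forall>v. A v (v + l)) \<or> (\<forall>v. A v (v + k))" using jump_dichotomy n' l2 by auto
  then obtain v where "A v (v + 2)"
  proof
    assume "\<forall>v. A v (v + l)"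
    then show ?thesis using exists_two_jump that n' l2 by auto
  next
    assume "\<forall>v. A v (v + k)"
    then show ?thesis using cyclic.exists_two_jump[OF swapped] that n' l2 by auto
  qed
  then show False using two_jump_False[OF l2 n] by blast
qed

section \<open>The case l = 1 with n = k + 1\<close>

lemma l1_consecutive: "l = 1 \<Longrightarrow> n = k + 1 \<Longrightarrow> A v (v + 2) \<Longrightarrow> \<not> A (v + 1) (v + 3)"
  \<comment> \<open>The arc from v + 1 to v + 2 would be accompanied by the path v + 1, v + 3, ...,
    v + n, v + 2 with n - 1 = k arcs.\<close>
  by (rule fwd_out[of v "v+2"]) (use pos in \<open>auto simp: two_def\<close>)

text \<open>Whenever i -> 0 -> i + 1, the vertex 0 can be moved between them. In the new cycle the
  arc from i to i + 1 is a jump of length two, and \<open>l1_consecutive\<close> forbids its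
  neighbours, the arcs i - 1 -> 0 and 0 -> i + 2. So directions alternate.\<close>

lemma l1_pattern0:
  assumes l: "l = 1" and n: "n = k + 1" and a: "A (- 1) 1"
  shows "odd n \<and> (\<forall>i. 2 \<le> i \<longrightarrow> i \<le> n - 2 \<longrightarrow> (A i 0 \<longleftrightarrow> even i) \<and> (A 0 i \<longleftrightarrow> odd i))"
proof -
  have n6: "6 \<le> n" using pos l n by simp
  have adj: "A i 0 \<or> A 0 i" if "0 < i" "i < n" for i
    using all_adj[of 0 i] that l n by (auto simp: Adj_def)
  have S: "\<not> A (i - 1) 0 \<and> \<not> A 0 (i + 2)" if i: "2 \<le> i" "i \<le> n - 3" "A i 0" "A 0 (i + 1)" for i
  proof -
    obtain c' where c': "cyclic E c' n k l" "\<And>m. 0 \<le> m \<Longrightarrow> m < i \<Longrightarrow> c' m = c (m + 1)" "c' i = c 0"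
      "\<And>m. i < m \<Longrightarrow> m < n \<Longrightarrow> c' m = c m"
      using moved[OF a i(3,4)] i(1,2) by auto
    interpret C: cyclic E c' n k l by (rule c')
    have j: "C.A (i - 1) (i - 1 + 2)" using c'(2)[of "i-1"] c'(4)[of "i+1"] i step[of i] by (simp add: C.A_def add.commute)
    have "\<not> C.A i (i + 2)" using C.l1_consecutive[OF l n j] by (simp add: algebra_simps)
    moreover have "\<not> C.A (i - 2) i" using C.l1_consecutive[OF l n, of "i-2"] j by (auto simp: algebra_simps)
    ultimately show ?thesis
      using c'(2)[of "i-2"] c'(3) c'(4)[of "i+2"] i by (simp add: C.A_def A_def)
  qed
  have o2: "\<not> A 0 2" using l1_consecutive[OF l n, of "-1"] a by simp
  have "\<not> A (- 2) 0" using l1_consecutive[OF l n, of "-2"] a by auto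
  then have in2: "\<not> A (n - 2) 0" using A_periodic(1)[of "-2" 0] by simp
  \<comment> \<open>If i + 1 also pointed to 0, so would i + 2, i + 3, and so on up to n - 2,
    contrary to \<open>in2\<close>.\<close>
  have nxt: "A 0 (i + 1)" if i: "2 \<le> i" "i \<le> n - 3" "A i 0" for i
  proof (rule ccontr)
    assume no: "\<not> ?thesis"
    have "i + 1 + int m \<le> n - 2 \<longrightarrow> A (i + int m) 0 \<and> A (i + 1 + int m) 0" for m
    proof (induction m)
      case 0
      then show ?case using i no adj[of "i+1"] by auto
    next
      case (Suc m)
      show ?case
      proof
        assume b: "i + 1 + int (Suc m) \<le> n - 2"
        then have 1: "A (i + int m) 0" "A (i + 1 + int m) 0" using Suc by auto
        have "\<not> A 0 (i + 1 + int (Suc m))"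
        proof
          assume "A 0 (i + 1 + int (Suc m))"
          then have "A 0 (i + 1 + int m + 1)" by (simp add: algebra_simps)
          then show False using S[of "i + 1 + int m"] 1 b i by (simp add: algebra_simps)
        qed
        then show "A (i + int (Suc m)) 0 \<and> A (i + 1 + int (Suc m)) 0"
          using 1 adj[of "i + 1 + int (Suc m)"] b i by (auto simp: algebra_simps)
      qed
    qed
    from this[of "nat (n - 3 - i)"] show False using i in2 by (simp add: algebra_simps)
  qed
  have ev: "2 + 2 * int t \<le> n - 2 \<longrightarrow> A (2 + 2 * int t) 0 \<and> \<not> A 0 (2 + 2 * int t)" for t
  proof (induction t)
    case 0
    then show ?case using o2 adj[of 2] n6 by auto
  next
    case (Suc t)
    show ?case
    proof
      assume b: "2 + 2 * int (Suc t) \<le> n - 2"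
      then have "A (2 + 2 * int t) 0" using Suc by auto
      then have "\<not> A 0 (2 + 2 * int t + 2)" using S[of "2 + 2 * int t"] nxt[of "2 + 2 * int t"] b by auto
      then show "A (2 + 2 * int (Suc t)) 0 \<and> \<not> A 0 (2 + 2 * int (Suc t))"
        using adj[of "2 + 2 * int (Suc t)"] b by (auto simp: algebra_simps)
    qed
  qed
  have even: "A i 0 \<and> \<not> A 0 i" if "2 \<le> i" "i \<le> n - 2" "even i" for i
  proof -
    have "2 + 2 * int (nat (i div 2 - 1)) = i" using that by auto
    then show ?thesis using ev[of "nat (i div 2 - 1)"] that by simp
  qed
  have on: "odd n" using even[of "n-2"] in2 n6 by auto
  have odd: "A 0 i \<and> \<not> A i 0" if "2 \<le> i" "i \<le> n - 2" "odd i" for i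
  proof
    have i3: "3 \<le> i" using that by (cases "i = 2") auto
    show "A 0 i" using nxt[of "i-1"] even[of "i-1"] that i3 by auto
    show "\<not> A i 0"
    proof (cases "i = n - 2")
      case True
      then show ?thesis using in2 by simp
    next
      case False
      then have "i \<le> n - 4" using that on by presburger
      then show ?thesis using S[of "i+1"] even[of "i+1"] nxt[of "i+1"] that by auto
    qed
  qed
  show ?thesis using on even odd by blast
qed

lemma l1_pattern:
  assumes "l = 1" "n = k + 1" "A (v - 1) (v + 1)" "2 \<le> i" "i \<le> n - 2"
  shows "odd n" "A (v + i) v \<longleftrightarrow> even i" "A v (v + i) \<longleftrightarrow> odd i"
  using cyclic.l1_pattern0[OF shift[of v], unfolded shift_A] assms by auto

text \<open>Moving the vertex \<open>0\<close> to another place changes the parity of the distance from \<open>v + 1\<close> to some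
  vertex, but both cycles satisfy the parity pattern.\<close>

lemma l1_unique_two_jump:
  assumes l: "l = 1" and n: "n = k + 1" and a: "A (- 1) 1" and v: "1 \<le> v" "v + 2 \<le> n - 1"
  shows "\<not> A v (v + 2)"
proof
  assume b: "A v (v + 2)"
  have n6: "6 \<le> n" using pos l n by simp
  note p = l1_pattern0[OF l n a]
  have n7: "7 \<le> n" using p n6 by (cases "n = 6") auto
  define u where "u = v + 1"
  have q: "A (u + i) u \<longleftrightarrow> even i" if "2 \<le> i" "i \<le> n - 2" for i
    using l1_pattern(2)[OF l n, of u i] b that by (simp add: u_def algebra_simps)
  \<comment> \<open>By the pattern, 0 may be moved behind any even j; this choice leaves v, v + 1, v
    + 2 consecutive.\<close>
  define j where "j = (if v + 2 \<le> n - 3 then if even v then v + 2 else v + 3 else 2)"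
  have j: "even j" "2 \<le> j" "j \<le> n - 3" "v + 2 \<le> j \<or> j + 1 \<le> v"
    using v p n7 unfolding j_def by (auto; presburger)+
  have J: "A j 0" "A 0 (j + 1)" using p j by auto
  obtain c' where c': "cyclic E c' n k l" "\<And>m. 0 \<le> m \<Longrightarrow> m < j \<Longrightarrow> c' m = c (m + 1)" "c' j = c 0"
    "\<And>m. j < m \<Longrightarrow> m < n \<Longrightarrow> c' m = c m"
    using moved[OF a J] j by auto
  interpret C: cyclic E c' n k l by (rule c')
  from j(4) show False
  proof
    assume jv: "v + 2 \<le> j"
    have "C.A (v - 1) (v + 1)" using c'(2)[of "v-1"] c'(2)[of "v+1"] b v jv by (simp add: C.A_def A_def add.commute)
    then have "C.A (v + (j + 1 - v)) v \<longleftrightarrow> even (j + 1 - v)"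
      by (rule C.l1_pattern(2)[OF l n]) (use jv j v in auto)
    moreover have "C.A (v + (j + 1 - v)) v = A (u + (j - v)) u"
      using c'(2)[of v] c'(4)[of "j+1"] v jv j by (simp add: C.A_def A_def u_def algebra_simps)
    ultimately show False using q[of "j - v"] jv j v by auto
  next
    assume jv: "j + 1 \<le> v"
    have "C.A (u - 1) (u + 1)" using c'(4)[of v] c'(4)[of "v+2"] b v jv by (simp add: C.A_def A_def u_def add.commute)
    then have "C.A (u + (j - 1 - u + n)) u \<longleftrightarrow> even (j - 1 - u + n)"
      by (rule C.l1_pattern(2)[OF l n]) (use jv j v in \<open>auto simp: u_def\<close>)
    moreover have "u + (j - 1 - u + n) = j - 1 + n" by simp
    then have "C.A (u + (j - 1 - u + n)) u = C.A (j - 1) u" by (simp only: C.A_periodic)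
    moreover have "C.A (j - 1) u = A j u"
      using c'(2)[of "j-1"] c'(4)[of u] v jv j by (simp add: C.A_def A_def u_def)
    moreover have "A (u + (j - u + n)) u = A j u" by (simp add: algebra_simps)
    ultimately show False using q[of "j - u + n"] jv j v by (auto simp: u_def)
  qed
qed

lemma l1_two_jump_False:
  assumes l: "l = 1" and n: "n = k + 1" and a: "A (- 1) 1"
  shows False
proof -
  have n6: "6 \<le> n" using pos l n by simp
  note p = l1_pattern0[OF l n a]
  define h where "h = n div 2"
  have h: "n = 2 * h + 1" "3 \<le> h" using p n6 by (auto simp: h_def)
  have bk: "A (v + 2) v" if "0 \<le> v" "v \<le> n - 3" for v
  proof (cases "v = 0")
    case True
    then show ?thesis using p n6 by auto
  next
    case False
    then have "\<not> A v (v + 2)" using l1_unique_two_jump[OF l n a, of v] that by auto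
    moreover have "Adj v (v + 2)" by (rule all_adj) (use l n n6 in auto)
    ultimately show ?thesis by (simp add: Adj_def)
  qed
  \<comment> \<open>Backward jumps of length two lead from n - 1 through the even positions to 0,
    then from n - 2 through the odd ones to 1. This Hamiltonian path has k arcs, and the arc from n
    - 1 to 1 is the other path.\<close>
  define zs where "zs = map (\<lambda>t. 2 * (h - t)) [0..h] @ map (\<lambda>t. 2 * (h - t) - 1) [0..h-1]"
  have s: "successively A zs"
  proof -
    have 1: "successively A (map (\<lambda>t. 2 * (h - t)) [0..h])"
      by (rule successively_map_upto) (use bk[of "2 * (h - i) - 2" for i] h in \<open>force simp: algebra_simps\<close>)
    have 2: "successively A (map (\<lambda>t. 2 * (h - t) - 1) [0..h-1])"
      by (rule successively_map_upto) (use bk[of "2 * (h - i) - 3" for i] h in \<open>force simp: algebra_simps\<close>)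
    have "A 0 (n - 2)" using p n6 by auto
    then have "A 0 (2 * h - 1)" using h by simp
    then have "A (last (map (\<lambda>t. 2 * (h - t)) [0..h])) (hd (map (\<lambda>t. 2 * (h - t) - 1) [0..h-1]))"
      using h by (simp add: last_map hd_map last_upto hd_upto)
    then show ?thesis unfolding zs_def successively_append_iff using 1 2 by blast
  qed
  have d: "distinct zs"
  proof -
    have "2 * (h - x) \<noteq> 2 * (h - y) - 1" for x y by presburger
    then show ?thesis by (auto simp: zs_def distinct_map inj_on_def)
  qed
  have sz: "set zs \<subseteq> {0..<0+n}" using h by (auto simp: zs_def)
  have ne: "zs \<noteq> []" using h by (simp add: zs_def)
  have hl: "hd zs = n - 1" "last zs = 1" using h by (auto simp: zs_def hd_append hd_map last_map hd_upto last_upto)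
  have ln: "int (length zs) = n" using h by (simp add: zs_def)
  have A1: "A (n - 1) 1" using a A_periodic(1)[of "-1" 1] by simp
  have ne1: "c (n - 1) \<noteq> c 1" using inj_onD[OF inj_window[of 0], of "n-1" 1] n6 by auto
  have "theta E k l" unfolding theta_def
  proof (rule exI[of _ "map c zs"], rule exI[of _ "[c (n-1), c 1]"], intro conjI)
    show "vpath E (map c zs)"
      using s d ne inj_on_subset[OF inj_window sz] by (simp add: vpath_def successively_map distinct_map A_def[abs_def])
    show "vpath E [c (n-1), c 1]" using A1 ne1 by (simp add: vpath_def A_def)
  qed (use ne hl ln l n in \<open>auto simp: hd_map last_map\<close>)
  then show False using free by simp
qed

lemma l1_N0_False: "l = 1 \<Longrightarrow> n = k + l \<Longrightarrow> False"
proof -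
  assume l: "l = 1" and n: "n = k + l"
  obtain c' i where c': "cyclic E c' n k l" "E (c' i) (c' (i + 2))" using exists_cycle_two_jump[OF n] by blast
  then interpret C: cyclic E c' n k l by simp
  show False
    by (rule cyclic.l1_two_jump_False[OF C.shift[of "i+1"] l, unfolded C.shift_A])
      (use n l c' in \<open>auto simp: C.A_def algebra_simps\<close>)
qed

theorem no_cyclic:
  assumes "l \<le> k"
  shows False
proof -
  consider "l = 1" | "2 \<le> l" using pos by linarith
  then show False
  proof cases
    case 1
    then show False using case_l1 l1_N0_False pos by force
  next
    case 2
    consider "k = l" | "k = l + 1" | "k = l + 2" | "l + 3 \<le> k" using assms by linarith
    then show False
    proof cases
      case 1
      then show False using equal_False k0_False pos by force
    next
      case k1: 2
      then show False using k1_N0_False k1_False pos by force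
    next
      case 3
      show False
      proof (cases "2 * l + 4 \<le> n")
        case True
        then show False using k2_False 3 by blast
      next
        case False
        show False
        proof (cases "n = k + l")
          case True
          then show False using N01_False 2 3 by auto
        next
          case F: False
          \<comment> \<open>Here n = 2l + 3 is odd, whereas \<open>only_missing\<close> makes n
            even, whichever jumps are forward.\<close>
          then have "n = k + l + 1" using False 3 pos by auto
          moreover from this have "odd n" using 3 by presburger
          ultimately have n: "n = k + l + 1" "odd n" by blast+
          have "(\<forall>v. A v (v + l)) \<or> (\<forall>v. A v (v + k))" using jump_dichotomy n 2 3 by auto
          then show False
          proof
            assume f: "\<forall>v. A v (v + l)"
            have "even n" by (rule only_missing(2)) (use f n 2 3 in auto)
            then show False using n(2) by simp
          next
            assume f: "\<forall>v. A v (v + k)"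
            have "even n" by (rule cyclic.only_missing(2)[OF swapped]) (use f n 2 3 in auto)
            then show False using n(2) by simp
          qed
        qed
      qed
    next
      case 4
      then show False using N01_False far_False 2 pos by force
    qed
  qed
qed

end

section \<open>From digraphs to cyclic sequences\<close>

definition ham_cycle :: "('v \<Rightarrow> 'v \<Rightarrow> bool) \<Rightarrow> 'v list \<Rightarrow> bool" where
  "ham_cycle E xs \<longleftrightarrow> xs \<noteq> [] \<and> distinct xs \<and> successively E xs \<and> E (last xs) (hd xs)"

lemma ham_cycle_rotate: "ham_cycle E (us @ vs) \<Longrightarrow> ham_cycle E (vs @ us)"
  by (cases "us = []"; cases "vs = []") (auto simp: ham_cycle_def successively_append_iff)

text \<open>A path visits a only once, so it uses the shortcut from a to b at most once, and the
  parts before and after it consist of arcs of \<open>E\<close>.\<close>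

lemma vpath_lift:
  assumes P: "vpath E' P" and E': "\<And>x y. x \<in> set P \<Longrightarrow> y \<in> set P \<Longrightarrow> E' x y \<Longrightarrow> E x y \<or> x = a \<and> y = b"
    and z: "z \<notin> set P" "E a z" "E z b"
  obtains "vpath E P" | us vs where "P = us @ a # b # vs" "vpath E (us @ a # z # b # vs)"
proof (cases "successively E P")
  case True
  then show ?thesis using P that(1) by (simp add: vpath_def)
next
  case False
  have P': "P \<noteq> []" "distinct P" "successively E' P" using P by (auto simp: vpath_def)
  obtain i where i: "Suc i < length P" "\<not> E (P ! i) (P ! Suc i)"
    using False by (auto simp: successively_conv_nth)
  have "E' (P ! i) (P ! Suc i)" using P'(3) i(1) by (auto simp: successively_conv_nth)
  then have ab: "P ! i = a" "P ! Suc i = b" using E'[of "P ! i" "P ! Suc i"] i by auto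
  have s: "P = take i P @ a # b # drop (Suc (Suc i)) P"
    using i(1) ab by (metis Cons_nth_drop_Suc Suc_lessD id_take_nth_drop)
  define us vs where "us = take i P" and "vs = drop (Suc (Suc i)) P"
  have s: "P = us @ a # b # vs" using s by (simp add: us_def vs_def)
  have 1: "successively E (us @ [a])"
  proof (rule successively_mono)
    show "successively E' (us @ [a])" using P'(3) s by (auto simp: successively_append_iff)
    show "E x y" if "x \<in> set (us @ [a])" "y \<in> set (us @ [a])" "E' x y" for x y
      using E'[of x y] that P'(2) s by auto
  qed
  have 2: "successively E (b # vs)"
  proof (rule successively_mono)
    show "successively E' (b # vs)" using P'(3) s by (auto simp: successively_append_iff)
    show "E x y" if "x \<in> set (b # vs)" "y \<in> set (b # vs)" "E' x y" for x y
      using E'[of x y] that P'(2) s by auto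
  qed
  have "successively E (us @ a # z # b # vs)" using 1 2 z by (auto simp: successively_append_iff)
  moreover have "distinct (us @ a # z # b # vs)" using P'(2) z(1) s by auto
  ultimately show ?thesis using that(2)[OF s] by (simp add: vpath_def)
qed

text \<open>Used for an arc that lies on both paths: its ends are the common ends of the paths, so
  the path of length at least k >= 2 would be a single arc.\<close>

lemma end_arc:
  assumes "distinct P" "P = us @ a # b # vs" "a \<in> {hd P, last P}" "b \<in> {hd P, last P}"
  shows "length P = 2"
proof -
  have "a \<noteq> last P" using assms(1,2) by auto
  then have "a = hd P" using assms by auto
  then have us: "us = []" using assms(1,2) by (cases us) auto
  then have "b = last P" using assms by auto
  then have "vs = []" using assms(1,2) us by (cases vs rule: rev_cases) auto
  then show ?thesis using us assms by simp
qed

text \<open>A path that uses the shortcut \<open>a \<rightarrow> b\<close> is rerouted through \<open>z\<close>. Since \<open>k \<ge> 2\<close>, the shortcut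
  lies on at most one of the two paths.\<close>

lemma theta_lift:
  assumes th: "theta E' k l" and kl: "2 \<le> k" "1 \<le> l"
    and E': "\<And>x y. E' x y \<Longrightarrow> x \<noteq> z \<and> y \<noteq> z \<and> (E x y \<or> x = a \<and> y = b)"
    and z: "E a z" "E z b"
  shows "theta E k l"
proof -
  obtain P Q where PQ: "vpath E' P" "vpath E' Q" "hd P = hd Q" "last P = last Q"
     "set P \<inter> set Q \<subseteq> {hd P, last P}" "k < int (length P)" "l < int (length Q)"
    using th unfolding theta_def by blast
  have nz: "z \<notin> set R" if R: "vpath E' R" "2 \<le> length R" for R
  proof
    assume "z \<in> set R"
    then obtain i where i: "i < length R" "R ! i = z" by (auto simp: in_set_conv_nth)
    have suc: "E' (R ! j) (R ! Suc j)" if "Suc j < length R" for j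
      using R that by (auto simp: vpath_def successively_conv_nth)
    show False
    proof (cases "Suc i < length R")
      case True
      then show False using suc E' i by blast
    next
      case False
      then obtain j where "i = Suc j" using R i by (cases i) auto
      then show False using suc[of j] E' i by blast
    qed
  qed
  have zP: "z \<notin> set P" and zQ: "z \<notin> set Q" using nz PQ kl by auto
  have d: "distinct P" using PQ by (simp add: vpath_def)
  have thI: "theta E k l" if "vpath E P'" "vpath E Q'" "hd P' = hd P" "hd Q' = hd P" "last P' = last P" "last Q' = last P"
      "set P' \<inter> set Q' \<subseteq> {hd P, last P}" "k < int (length P')" "l < int (length Q')" for P' Q'
    unfolding theta_def
    by (rule exI[of _ P'], rule exI[of _ Q']) (simp only: that simp_thms)
  have ins: "hd (us @ a # z # b # vs) = hd R" "last (us @ a # z # b # vs) = last R"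
      "set (us @ a # z # b # vs) = insert z (set R)" "int (length R) < int (length (us @ a # z # b # vs))"
    if "R = us @ a # b # vs" for R us vs
    using that by (auto simp: hd_append)
  have P: "vpath E P \<or> (\<exists>us vs. P = us @ a # b # vs \<and> vpath E (us @ a # z # b # vs))"
    by (rule vpath_lift[where E = E and a = a and b = b and z = z, OF PQ(1) _ zP z]) (use E' in blast)+
  have Q: "vpath E Q \<or> (\<exists>us vs. Q = us @ a # b # vs \<and> vpath E (us @ a # z # b # vs))"
    by (rule vpath_lift[where E = E and a = a and b = b and z = z, OF PQ(2) _ zQ z]) (use E' in blast)+
  show ?thesis
  proof (cases "vpath E P")
    case vP: True
    show ?thesis
    proof (cases "vpath E Q")
      case True
      show ?thesis by (rule thI[OF vP True]) (use PQ in simp_all)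
    next
      case False
      then obtain us vs where Q': "Q = us @ a # b # vs" "vpath E (us @ a # z # b # vs)" using Q by blast
      show ?thesis
      proof (rule thI[OF vP Q'(2)])
        show "set P \<inter> set (us @ a # z # b # vs) \<subseteq> {hd P, last P}"
          unfolding ins(3)[OF Q'(1)] using PQ(5) zP by blast
      qed (use PQ ins[OF Q'(1)] in linarith | simp only: refl ins[OF Q'(1)] PQ)+
    qed
  next
    case False
    then obtain us vs where P': "P = us @ a # b # vs" "vpath E (us @ a # z # b # vs)" using P by blast
    show ?thesis
    proof (cases "vpath E Q")
      case True
      show ?thesis
      proof (rule thI[OF P'(2) True])
        show "set (us @ a # z # b # vs) \<inter> set Q \<subseteq> {hd P, last P}"
          unfolding ins(3)[OF P'(1)] using PQ(5) zQ by blast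
      qed (use PQ ins[OF P'(1)] in linarith | simp only: refl ins[OF P'(1)] PQ)+
    next
      case False
      then obtain us' vs' where Q': "Q = us' @ a # b # vs'" using Q by blast
      have "a \<in> set P \<inter> set Q" "b \<in> set P \<inter> set Q" using P'(1) Q' by simp_all
      then have "length P = 2" using end_arc[OF d P'(1)] PQ(5) by blast
      then show ?thesis using PQ(6) kl by simp
    qed
  qed
qed

text \<open>The induction varies the relation \<open>E\<close>, since the arc that bridges a deleted
  vertex need not belong to the digraph. Arcs inside S survive the deletion, so degrees in S do not
  drop.\<close>

lemma ham_cycle_low_degree:
  assumes "ham_cycle E xs" and "S \<subseteq> set xs" "S \<noteq> {}"
    and "\<not> theta E k l" and kl: "1 \<le> l" "l \<le> k" "6 \<le> k + l"
  shows "\<exists>v\<in>S. int (card {w \<in> S. w \<noteq> v \<and> (E v w \<or> E w v)}) \<le> k + l - 2"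
  using assms(1-4)
proof (induction "length xs" arbitrary: E xs rule: less_induct)
  case less
  show ?case
  proof (rule ccontr)
    assume "\<not> ?thesis"
    then have deg: "k + l - 1 \<le> int (card {w \<in> S. w \<noteq> v \<and> (E v w \<or> E w v)})" if "v \<in> S" for v
      using that by force
    have fin: "finite S" using less.prems(2) finite_subset by auto
    have big: "k + l \<le> int (card S)"
    proof -
      obtain v where v: "v \<in> S" using less.prems(3) by blast
      have "{w \<in> S. w \<noteq> v \<and> (E v w \<or> E w v)} \<subseteq> S - {v}" by auto
      then have "card {w \<in> S. w \<noteq> v \<and> (E v w \<or> E w v)} \<le> card (S - {v})" using fin by (intro card_mono) auto
      also have "\<dots> = card S - 1" using v fin by simp
      finally show ?thesis using deg[OF v] kl by linarith
    qed
    show False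
    proof (cases "S = set xs")
      case True
      have len: "length xs = card S" using True less.prems(1) distinct_card[of xs] by (simp add: ham_cycle_def)
      have "cyclic E (\<lambda>i. xs ! nat (i mod int (length xs))) (int (length xs)) k l"
      proof (rule cyclic_of_list)
        fix v assume v: "v \<in> set xs"
        let ?A = "{w \<in> set xs. w \<noteq> v \<and> (E v w \<or> E w v)}" and ?B = "{w \<in> set xs. w \<noteq> v \<and> \<not> (E v w \<or> E w v)}"
        have "?A \<union> ?B = set xs - {v}" by auto
        moreover have "card (?A \<union> ?B) = card ?A + card ?B" by (rule card_Un_disjoint) auto
        ultimately have "card ?A + card ?B = length xs - 1" using v len True by simp
        then show "card ?B \<le> nat (int (length xs) - k - l)" using deg[of v] v True by simp
      qed (use less.prems kl big len in \<open>auto simp: ham_cycle_def\<close>)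
      then show False using cyclic.no_cyclic kl by blast
    next
      case False
      then obtain z where z: "z \<in> set xs" "z \<notin> S" using less.prems(2) by blast
      then obtain us vs where xs: "xs = us @ z # vs" by (auto dest: split_list)
      define ys where "ys = vs @ us"
      have zys: "ham_cycle E (z # ys)"
        using ham_cycle_rotate[of E us "z # vs"] less.prems(1) xs by (simp add: ys_def)
      have Sys: "S \<subseteq> set ys" using less.prems(2) z xs by (auto simp: ys_def)
      then have ne: "ys \<noteq> []" using less.prems(3) by auto
      have zn: "z \<notin> set ys" using zys by (simp add: ham_cycle_def)
      define E' where "E' x y \<longleftrightarrow> (E x y \<and> x \<noteq> z \<and> y \<noteq> z) \<or> (x = last ys \<and> y = hd ys)" for x y
      have su: "successively E ys" "E z (hd ys)" "E (last ys) z" "distinct ys"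
        using zys ne by (auto simp: ham_cycle_def successively_Cons)
      have "ham_cycle E' ys" unfolding ham_cycle_def
      proof (intro conjI)
        show "successively E' ys"
          by (rule successively_mono[OF su(1)]) (use zn E'_def in auto)
      qed (use ne su E'_def in auto)
      moreover have "\<not> theta E' k l"
      proof
        assume "theta E' k l"
        then have "theta E k l"
          by (rule theta_lift[where z = z and a = "last ys" and b = "hd ys"])
            (use kl su zn ne E'_def in auto)
        then show False using less.prems(4) by simp
      qed
      moreover have "length ys < length xs" using xs by (simp add: ys_def)
      ultimately obtain v where v: "v \<in> S" "int (card {w \<in> S. w \<noteq> v \<and> (E' v w \<or> E' w v)}) \<le> k + l - 2"
        using less.hyps[of ys E'] Sys less.prems(3) by blast
      have "card {w \<in> S. w \<noteq> v \<and> (E v w \<or> E w v)} \<le> card {w \<in> S. w \<noteq> v \<and> (E' v w \<or> E' w v)}"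
        using fin z v(1) by (intro card_mono) (auto simp: E'_def)
      then show False using v deg[OF v(1)] by linarith
    qed
  qed
qed

section \<open>Vertex lists and directed walks\<close>

context wf_digraph
begin

lemma awalk_successively: "cas u p v \<Longrightarrow> set p \<subseteq> arcs G \<Longrightarrow> successively (\<lambda>x y. (x, y) \<in> arcs_ends G) (awalk_verts u p)"
proof (induction p arbitrary: u)
  case (Cons e p)
  have "hd (awalk_verts (head G e) p) = head G e" using Cons.prems by (cases p) auto
  moreover have "(tail G e, head G e) \<in> arcs_ends G" using Cons.prems by (auto simp: arcs_ends_conv)
  ultimately show ?case using Cons by (simp add: successively_Cons)
qed simp

lemma hamiltonian_ham_cycle:
  assumes "hamiltonian G"
  obtains xs where "ham_cycle (\<lambda>x y. (x, y) \<in> arcs_ends G) xs" "set xs = verts G"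
proof -
  obtain u p where p: "cycle p" "awalk u p u" "set (awalk_verts u p) = verts G"
    using assms unfolding hamiltonian_def by blast
  obtain u' where u': "awalk u' p u'" "distinct (tl (awalk_verts u' p))" "p \<noteq> []"
    using p(1) unfolding cycle_def by blast
  have eq: "awalk_verts u' p = awalk_verts u p" using awalk_verts_ne_eq[OF u'(3)] by blast
  \<comment> \<open>The closed walk lists u at both ends; without the first entry every vertex
    occurs once.\<close>
  define xs where "xs = tl (awalk_verts u p)"
  have c: "cas u p u" "set p \<subseteq> arcs G" using p(2) by (auto simp: awalk_def)
  have hd: "hd (awalk_verts u p) = u" using p(2) by simp
  have ne: "xs \<noteq> []" using u'(3) by (cases p) (auto simp: xs_def)
  have "awalk_verts u p \<noteq> []" by simp
  then have "awalk_verts u p = hd (awalk_verts u p) # xs" unfolding xs_def by (rule list.collapse[symmetric])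
  then have ux: "awalk_verts u p = u # xs" by (simp only: hd)
  have "last (awalk_verts u p) = u" using p(2) by simp
  then have last: "last xs = u" using ux ne by simp
  have "successively (\<lambda>x y. (x, y) \<in> arcs_ends G) (u # xs)" using awalk_successively[OF c] unfolding ux .
  moreover have "distinct xs" using u'(2) unfolding eq ux by simp
  ultimately have "ham_cycle (\<lambda>x y. (x, y) \<in> arcs_ends G) xs"
    using ne last unfolding ham_cycle_def by (simp add: successively_Cons)
  moreover have "u \<in> set xs" using last_in_set[OF ne] last by simp
  then have "set xs = verts G" using p(3) unfolding ux by auto
  ultimately show thesis by (rule that)
qed

lemma vpath_awalk:
  assumes "successively (\<lambda>x y. (x, y) \<in> arcs_ends G) P" "P \<noteq> []" "hd P \<in> verts G"
  shows "\<exists>p. awalk (hd P) p (last P) \<and> awalk_verts (hd P) p = P"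
  using assms
proof (induction P)
  case (Cons x P)
  show ?case
  proof (cases "P = []")
    case True
    then show ?thesis using Cons.prems by (intro exI[of _ "[]"]) (simp add: awalk_Nil_iff)
  next
    case False
    then have suc: "(x, hd P) \<in> arcs_ends G" "successively (\<lambda>x y. (x, y) \<in> arcs_ends G) P"
      using Cons.prems by (simp_all add: successively_Cons)
    then obtain e where e: "e \<in> arcs G" "tail G e = x" "head G e = hd P" by (auto simp: arcs_ends_conv)
    have "hd P \<in> verts G" using head_in_verts[OF e(1)] e(3) by simp
    then obtain p where p: "awalk (hd P) p (last P)" "awalk_verts (hd P) p = P"
      using Cons.IH False suc(2) by blast
    then show ?thesis using e False by (intro exI[of _ "e # p"]) (auto simp: awalk_Cons_iff)
  qed
qed simp

lemma arc_consecutive: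
  "cas u p v \<Longrightarrow> e \<in> set p \<Longrightarrow> \<exists>us vs. awalk_verts u p = us @ tail G e # head G e # vs"
proof (induction p arbitrary: u)
  case (Cons f p)
  show ?case
  proof (cases "e = f")
    case True
    have "hd (awalk_verts (head G f) p) = head G f" using Cons.prems by (cases p) auto
    then have "awalk_verts (head G f) p = head G f # tl (awalk_verts (head G f) p)"
      using list.collapse[OF awalk_verts_non_Nil, of "head G f" p] by simp
    then have "awalk_verts u (f # p) = [] @ tail G e # head G e # tl (awalk_verts (head G f) p)"
      using True by simp
    then show ?thesis by blast
  next
    case False
    then have "cas (head G f) p v" "e \<in> set p" using Cons.prems by auto
    from Cons.IH[OF this] obtain us vs where "awalk_verts (head G f) p = us @ tail G e # head G e # vs" by blast
    then have "awalk_verts u (f # p) = (tail G f # us) @ tail G e # head G e # vs" by simp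
    then show ?thesis by blast
  qed
qed simp

end

lemma (in digraph) theta_two_block:
  assumes th: "theta (\<lambda>x y. (x, y) \<in> arcs_ends G) (int k) (int l)" and kl: "2 \<le> k" "1 \<le> l"
  shows "\<not> two_block_free k l G"
proof -
  obtain P Q where PQ: "vpath (\<lambda>x y. (x, y) \<in> arcs_ends G) P" "vpath (\<lambda>x y. (x, y) \<in> arcs_ends G) Q"
     "hd P = hd Q" "last P = last Q" "set P \<inter> set Q \<subseteq> {hd P, last P}" "k < length P" "l < length Q"
    using th unfolding theta_def by auto
  have P: "P \<noteq> []" "distinct P" "successively (\<lambda>x y. (x, y) \<in> arcs_ends G) P"
    and Q: "Q \<noteq> []" "distinct Q" "successively (\<lambda>x y. (x, y) \<in> arcs_ends G) Q"
    using PQ by (auto simp: vpath_def)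
  define s t where "s = hd P" and "t = last P"
  have "(P ! 0, P ! 1) \<in> arcs_ends G" using P(3) PQ(6) kl by (auto simp: successively_conv_nth)
  then have sv: "s \<in> verts G" using P(1) by (auto simp: s_def hd_conv_nth arcs_ends_conv)
  obtain p where p: "awalk s p t" "awalk_verts s p = P"
    using vpath_awalk[OF P(3,1)] sv by (auto simp: s_def t_def)
  obtain q where q: "awalk s q t" "awalk_verts s q = Q"
    using vpath_awalk[OF Q(3,1)] sv PQ(3,4) by (auto simp: s_def t_def)
  have lp: "length P = Suc (length p)" "length Q = Suc (length q)" using p q length_awalk_verts by metis+
  have st: "s \<noteq> t"
  proof
    assume "s = t"
    obtain x R where R: "P = x # R" using P(1) by (cases P) auto
    then have "R \<noteq> []" using PQ(6) kl by auto
    then show False using \<open>s = t\<close> P(2) R last_in_set[of R] by (auto simp: s_def t_def)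
  qed
  have cp: "cas s p t" "set p \<subseteq> arcs G" and cq: "cas s q t" "set q \<subseteq> arcs G" using p q by (auto simp: awalk_def)
  have inter: "set P \<inter> set Q = {s, t}"
    using PQ(3-5) P(1) Q(1) by (auto simp: s_def t_def) (metis hd_in_set last_in_set)+
  have disj: "set p \<inter> set q = {}"
  proof (rule ccontr)
    assume "set p \<inter> set q \<noteq> {}"
    then obtain e where e: "e \<in> set p" "e \<in> set q" by blast
    obtain us vs where 1: "P = us @ tail G e # head G e # vs" using arc_consecutive[OF cp(1) e(1)] p(2) by auto
    obtain us' vs' where 2: "Q = us' @ tail G e # head G e # vs'" using arc_consecutive[OF cq(1) e(2)] q(2) by auto
    have "length P = 2"
      by (rule end_arc[OF P(2) 1]) (use PQ(5) 1 2 in auto)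
    then show False using PQ(6) kl by simp
  qed
  define H where "H = \<lparr>verts = set P \<union> set Q, arcs = set p \<union> set q, tail = tail G, head = head G\<rparr>"
  have H: "verts H = set P \<union> set Q" "arcs H = set p \<union> set q" "tail H = tail G" "head H = head G"
    by (simp_all add: H_def)
  have cas: "pre_digraph.cas H u r v = cas u r v" for u r v
    by (induction r arbitrary: u) (simp_all add: pre_digraph.cas.simps H)
  have av: "pre_digraph.awalk_verts H u r = awalk_verts u r" for u r
    by (induction r arbitrary: u) (simp_all add: pre_digraph.awalk_verts.simps H)
  have ends: "tail G e \<in> set P \<and> head G e \<in> set P" if "e \<in> set p" for e
    using arc_consecutive[OF cp(1) that] p(2) by auto
  have ends': "tail G e \<in> set Q \<and> head G e \<in> set Q" if "e \<in> set q" for e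
    using arc_consecutive[OF cq(1) that] q(2) by auto
  have sub: "arcs H \<subseteq> arcs G" using cp cq by (simp add: H)
  have dig: "digraph H"
  proof
    show "tail H e \<in> verts H" "head H e \<in> verts H" if "e \<in> arcs H" for e
      using that ends ends' by (auto simp: H)
    show "finite (verts H)" "finite (arcs H)" by (simp_all add: H)
    show "tail H e \<noteq> head H e" if "e \<in> arcs H" for e using that sub no_loops by (auto simp: H(3,4))
    show "e1 = e2" if "e1 \<in> arcs H" "e2 \<in> arcs H" "arc_to_ends H e1 = arc_to_ends H e2" for e1 e2
      using that sub no_multi_arcs[of e1 e2] by (auto simp: arc_to_ends_def H(3,4))
  qed
  have Pv: "set P \<subseteq> verts G" "set Q \<subseteq> verts G"
    using awalk_verts_in_verts[OF sv cp(2)] awalk_verts_in_verts[OF sv cq(2)] p(2) q(2) by auto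
  have "subgraph H G" unfolding subgraph_def
  proof (intro conjI)
    show "wf_digraph H" using dig by (simp add: digraph_def fin_digraph_def)
    show "compatible G H" by (simp add: compatible_def H)
  qed (use sub Pv H wf_digraph in auto)
  moreover have "H \<in> two_block_cycles k l"
    unfolding two_block_cycles_def mem_Collect_eq
  proof (rule conjI[OF dig], rule exI[of _ s], rule exI[of _ t], rule exI[of _ p], rule exI[of _ q], intro conjI)
    have "s \<in> verts H" using P(1) by (simp add: H s_def)
    then show "pre_digraph.apath H s p t" "pre_digraph.apath H s q t"
      using cp cq p q P Q by (auto simp: pre_digraph.apath_def pre_digraph.awalk_def cas av H)
    show "k \<le> length p" "l \<le> length q" using PQ(6,7) lp by auto
    show "set (pre_digraph.awalk_verts H s p) \<inter> set (pre_digraph.awalk_verts H s q) = {s, t}"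
      using inter p q by (simp add: av)
    show "verts H = set (pre_digraph.awalk_verts H s p) \<union> set (pre_digraph.awalk_verts H s q)"
      using p q by (simp add: av H)
  qed (use st disj H in auto)
  ultimately show ?thesis unfolding two_block_free_def by blast
qed

section \<open>Greedy colouring and the final theorem\<close>

lemma greedy_coloring:
  assumes "finite V" and "\<And>u v. R u v \<Longrightarrow> R v u" and "\<And>v. \<not> R v v"
    and "\<And>W. W \<subseteq> V \<Longrightarrow> W \<noteq> {} \<Longrightarrow> \<exists>v\<in>W. card {w \<in> W. R v w} \<le> d"
  shows "\<exists>c. (\<forall>v\<in>V. c v \<le> d) \<and> (\<forall>u\<in>V. \<forall>v\<in>V. R u v \<longrightarrow> c u \<noteq> c v)"
  using assms(1,4)
proof (induction "card V" arbitrary: V)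
  case 0
  then show ?case by auto
next
  case (Suc m)
  then have "V \<noteq> {}" by auto
  then obtain v where v: "v \<in> V" "card {w \<in> V. R v w} \<le> d" using Suc.prems(2)[of V] by auto
  have "\<exists>c. (\<forall>v\<in>V - {v}. c v \<le> d) \<and> (\<forall>u\<in>V - {v}. \<forall>w\<in>V - {v}. R u w \<longrightarrow> c u \<noteq> c w)"
  proof (rule Suc.hyps(1))
    show "m = card (V - {v})" using Suc.hyps(2) v Suc.prems(1) by simp
    show "\<exists>v\<in>W. card {w \<in> W. R v w} \<le> d" if "W \<subseteq> V - {v}" "W \<noteq> {}" for W
      using Suc.prems(2)[of W] that by auto
  qed (use Suc.prems in auto)
  then obtain c :: "'a \<Rightarrow> nat" where c: "\<And>w. w \<in> V - {v} \<Longrightarrow> c w \<le> d"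
    "\<And>u w. u \<in> V - {v} \<Longrightarrow> w \<in> V - {v} \<Longrightarrow> R u w \<Longrightarrow> c u \<noteq> c w" by blast
  have "card (c ` {w \<in> V. R v w}) \<le> d" using card_image_le[of "{w \<in> V. R v w}" c] v(2) Suc.prems(1) by simp
  then have "\<not> {..d} \<subseteq> c ` {w \<in> V. R v w}"
    using card_mono[of "c ` {w \<in> V. R v w}" "{..d}"] Suc.prems(1) by auto
  then obtain x where x: "x \<le> d" "\<And>w. w \<in> V \<Longrightarrow> R v w \<Longrightarrow> c w \<noteq> x" by blast
  show ?case
  proof (intro exI[of _ "c(v := x)"] conjI ballI impI)
    fix u w assume "u \<in> V" "w \<in> V" "R u w"
    then show "(c(v := x)) u \<noteq> (c(v := x)) w"
      using c(2)[of u w] x(2)[of u] x(2)[of w] assms(2)[of u w] assms(3)[of v] by auto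
  qed (use c x in auto)
qed

theorem theorem1p5:
  fixes k l :: nat and D :: "('a, 'b) pre_digraph"
  assumes "k \<ge> l" and "l \<ge> 1" and "k + l \<ge> 6"
    and "digraph D"
    and "two_block_free k l D"
    and "hamiltonian D"
  shows "degenerate (k + l - 2) (underlying_graph D) \<and>
    chromatic_number (underlying_graph D) \<le> k + l - 1"
proof -
  interpret digraph D by fact
  let ?E = "\<lambda>x y. (x, y) \<in> arcs_ends D"
  let ?R = "\<lambda>v w. w \<noteq> v \<and> (?E v w \<or> ?E w v)"
  let ?U = "underlying_graph D"
  have E_parcs: "(u, v) \<in> parcs (mk_symmetric D) \<longleftrightarrow> ?E u v \<or> ?E v u" for u v
    by (auto simp: parcs_mk_symmetric arcs_ends_conv)
  obtain xs where xs: "ham_cycle ?E xs" "set xs = verts D" using hamiltonian_ham_cycle assms(6) by blast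
  have nth: "\<not> theta ?E (int k) (int l)" using theta_two_block assms by force
  have low: "\<exists>v\<in>S. card {w \<in> S. ?R v w} \<le> k + l - 2" if "S \<subseteq> verts D" "S \<noteq> {}" for S
  proof -
    have "\<exists>v\<in>S. int (card {w \<in> S. ?R v w}) \<le> int k + int l - 2"
      by (rule ham_cycle_low_degree[OF xs(1)]) (use that xs(2) nth assms(1-3) in auto)
    then obtain v where "v \<in> S" "int (card {w \<in> S. ?R v w}) \<le> int k + int l - 2" by blast
    then show ?thesis by (intro bexI[of _ v]) auto
  qed
  have "degenerate (k + l - 2) ?U"
    unfolding degenerate_def
  proof (intro allI impI)
    fix H :: "('a, 'a \<times> 'a) pre_digraph"
    assume H: "subgraph H ?U \<and> graph H \<and> verts H \<noteq> {}"
    then interpret H: graph H by simp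
    have sub: "verts H \<subseteq> verts D" "arcs H \<subseteq> parcs (mk_symmetric D)" "compatible ?U H"
      using H unfolding subgraph_def by auto
    obtain v where v: "v \<in> verts H" "card {w \<in> verts H. ?R v w} \<le> k + l - 2" using low[OF sub(1)] H by blast
    have th: "tail H e = fst e" "head H e = snd e" for e
      by (simp_all flip: compatible_tail[OF sub(3)] compatible_head[OF sub(3)])
    have "out_degree H v \<le> card {w \<in> verts H. ?R v w}"
      unfolding out_degree_def
    proof (rule card_inj_on_le)
      show "inj_on snd (out_arcs H v)" by (rule inj_onI) (auto simp: th prod_eq_iff)
      show "snd ` out_arcs H v \<subseteq> {w \<in> verts H. ?R v w}"
      proof
        fix w assume "w \<in> snd ` out_arcs H v"
        then obtain e where e: "e \<in> arcs H" "tail H e = v" "w = snd e" by auto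
        have "w \<in> verts H" using H.head_in_verts[OF e(1)] e th by simp
        moreover have "w \<noteq> v" using H.no_loops[OF e(1)] e th by simp
        moreover have "e = (v, w)" using e th by (simp add: prod_eq_iff)
        then have "?E v w \<or> ?E w v" using e(1) sub(2) E_parcs by blast
        ultimately show "w \<in> {w \<in> verts H. ?R v w}" by simp
      qed
    qed simp
    then show "\<exists>v\<in>verts H. out_degree H v \<le> k + l - 2" using v by force
  qed
  moreover have "chromatic_number ?U \<le> k + l - 1"
  proof -
    have "\<exists>c. (\<forall>v\<in>verts D. c v \<le> k + l - 2) \<and> (\<forall>u\<in>verts D. \<forall>v\<in>verts D. ?R u v \<longrightarrow> c u \<noteq> c v)"
      by (rule greedy_coloring) (use low in auto)
    then obtain c :: "'a \<Rightarrow> nat" where c: "\<And>v. v \<in> verts D \<Longrightarrow> c v \<le> k + l - 2"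
      "\<And>u v. u \<in> verts D \<Longrightarrow> v \<in> verts D \<Longrightarrow> ?R u v \<Longrightarrow> c u \<noteq> c v" by blast
    have "proper_coloring ?U (k + l - 1) c"
      unfolding proper_coloring_def
    proof (intro conjI)
      have "c v < k + l - 1" if "v \<in> verts D" for v using c(1)[OF that] assms(3) by linarith
      then show "c ` verts ?U \<subseteq> {..<k + l - 1}" by auto
      have "c u \<noteq> c v" if "(u, v) \<in> parcs (mk_symmetric D)" for u v
      proof (rule c(2))
        have "?E u v \<or> ?E v u" using that E_parcs by simp
        then show "u \<in> verts D" "v \<in> verts D" "?R u v" using adj_in_verts adj_not_same by auto
      qed
      moreover have "arcs_ends ?U = parcs (mk_symmetric D)" by (auto simp: arcs_ends_conv)
      ultimately show "\<forall>(u, v)\<in>arcs_ends ?U. c u \<noteq> c v" by auto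
    qed
    then show ?thesis unfolding chromatic_number_def by (intro Least_le) blast
  qed
  ultimately show ?thesis by blast
qed

end
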